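(* Let $n\ge1$, $\alpha\in(0,1)$ and $p\in\left[1,\frac{n}{n-\alpha}\right)$. Let $\Phi:\mathbb{R}\to\mathbb{R}$ be a Lipschitz function such that $\Phi(0)=0$ and $\Phi\ge0$. If for every $f\in BV^{\alpha,p}(\mathbb{R}^n)$ one has $\Phi(f)\in BV^{\alpha,p}(\mathbb{R}^n)$ with $$\operatorname{supp}|D^\alpha\Phi(f)|\subset\operatorname{supp}|D^\alpha f|,$$ then $\Phi\equiv0$.
   Context: Let $\mu_{n,\alpha}=2^{\alpha}\pi^{-n/2}\,\Gamma\left(\frac{n+\alpha+1}{2}\right)/\Gamma\left(\frac{1-\alpha}{2}\right)$. For $\varphi\in \mathrm{Lip}_c(\mathbb{R}^n;\mathbb{R}^n)$ (compactly supported Lipschitz), the fractional $\alpha$-divergence is $$\mathrm{div}^\alpha\varphi(x)=\mu_{n,\alpha}\int_{\mathbb{R}^n}\frac{(y-x)\cdot(\varphi(y)-\varphi(x))}{|y-x|^{n+\alpha+1}}\,dy,\quad x\in\mathbb{R}^n.$$ For $p\in[1,+\infty]$ and $f\in L^p(\mathbb{R}^n)$ let $$|D^\alpha f|(\mathbb{R}^n)=\sup\left\{\int_{\mathbb{R}^n} f\,\mathrm{div}^\alpha\varphi\,dx:\varphi\in C^\infty_c(\mathbb{R}^n;\mathbb{R}^n),\ \|\varphi\|_{L^\infty(\mathbb{R}^n;\mathbb{R}^n)}\le1\right\},$$ and $BV^{\alpha,p}(\mathbb{R}^n)=\{f\in L^p(\mathbb{R}^n):|D^\alpha f|(\mathbb{R}^n)<+\infty\}$.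 A function $f\in L^p(\mathbb{R}^n)$ belongs to $BV^{\alpha,p}(\mathbb{R}^n)$ if and only if there is a (unique) finite $\mathbb{R}^n$-valued Radon measure $D^\alpha f$ on $\mathbb{R}^n$ with $\int_{\mathbb{R}^n} f\,\mathrm{div}^\alpha\varphi\,dx=-\int_{\mathbb{R}^n}\varphi\cdot dD^\alpha f$ for all $\varphi\in \mathrm{Lip}_c(\mathbb{R}^n;\mathbb{R}^n)$; $|D^\alpha f|$ denotes its total variation measure. *)

theory Defs
  imports "HOL-Analysis.Analysis"
begin

section \<open>Test fields\<close>

definition fun_supp :: "('a::topological_space \<Rightarrow> 'b::zero) \<Rightarrow> 'a set" where
  "fun_supp f = closure {x. f x \<noteq> 0}"

definition Lip_c :: "((real ^ 'n) \<Rightarrow> (real ^ 'n)) set" where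
  "Lip_c = {\<phi>. (\<exists>L. L-lipschitz_on UNIV \<phi>) \<and> compact (fun_supp \<phi>)}"

primrec is_Ck :: "nat \<Rightarrow> ('a::euclidean_space \<Rightarrow> 'b::real_normed_vector) \<Rightarrow> bool" where
  "is_Ck 0 f \<longleftrightarrow> continuous_on UNIV f"
| "is_Ck (Suc k) f \<longleftrightarrow>
     (\<forall>x. f differentiable (at x)) \<and> (\<forall>v. is_Ck k (\<lambda>x. frechet_derivative f (at x) v))"

definition C_inf_c :: "((real ^ 'n) \<Rightarrow> (real ^ 'n)) set" where
  "C_inf_c = {\<phi>. (\<forall>k. is_Ck k \<phi>) \<and> compact (fun_supp \<phi>)}"

section \<open>Finite vector-valued Borel measures\<close>

text \<open>
  On \<open>\<real>\<^sup>n\<close> every countably additive set function on the Borel sets with values in a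
  finite-dimensional space has finite total variation and is Radon.  Such a set function
  is required to vanish off the Borel sets, so that it is determined as a HOL function by its
  values on the Borel sets.
\<close>

definition finite_vector_measure :: "('a::topological_space set \<Rightarrow> 'b::real_normed_vector) \<Rightarrow> bool" where
  "finite_vector_measure \<mu> \<longleftrightarrow>
     (\<forall>E :: nat \<Rightarrow> 'a set. range E \<subseteq> sets borel \<longrightarrow> disjoint_family E \<longrightarrow>
        (\<lambda>i. \<mu> (E i)) sums \<mu> (\<Union>i. E i)) \<and>
     (\<forall>A. A \<notin> sets borel \<longrightarrow> \<mu> A = 0)"

definition variation :: "('a::topological_space set \<Rightarrow> 'b::real_normed_vector) \<Rightarrow> 'a set \<Rightarrow> ennreal" where
  "variation \<mu> A =
     (SUP E \<in> {E :: nat \<Rightarrow> 'a set. range E \<subseteq> sets borel \<and> disjoint_family E \<and> (\<Union>i. E i) = A}.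
        \<Sum>i. ennreal (norm (\<mu> (E i))))"

definition total_variation :: "('a::topological_space set \<Rightarrow> 'b::real_normed_vector) \<Rightarrow> 'a measure" where
  "total_variation \<mu> = measure_of UNIV (sets borel) (variation \<mu>)"

text \<open>Jordan decomposition \<open>\<nu>\<^sup>\<plusminus> = (|\<nu>| \<plusminus> \<nu>) / 2\<close> of a real-valued measure.\<close>

definition pos_part :: "('a::topological_space set \<Rightarrow> real) \<Rightarrow> 'a measure" where
  "pos_part \<nu> =
     measure_of UNIV (sets borel) (\<lambda>A. ennreal ((measure (total_variation \<nu>) A + \<nu> A) / 2))"

definition neg_part :: "('a::topological_space set \<Rightarrow> real) \<Rightarrow> 'a measure" where
  "neg_part \<nu> =
     measure_of UNIV (sets borel) (\<lambda>A. ennreal ((measure (total_variation \<nu>) A - \<nu> A) / 2))"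

definition signed_integral :: "('a::topological_space \<Rightarrow> real) \<Rightarrow> ('a set \<Rightarrow> real) \<Rightarrow> real" where
  "signed_integral g \<nu> = (LINT x|pos_part \<nu>. g x) - (LINT x|neg_part \<nu>. g x)"

text \<open>The integral \<open>\<integral> \<phi> \<cdot> d\<mu>\<close> of a vector field against a vector measure.\<close>

definition vector_integral :: "((real ^ 'n) \<Rightarrow> (real ^ 'n)) \<Rightarrow> ((real ^ 'n) set \<Rightarrow> real ^ 'n) \<Rightarrow> real" where
  "vector_integral \<phi> \<mu> = (\<Sum>i\<in>UNIV. signed_integral (\<lambda>x. \<phi> x $ i) (\<lambda>A. \<mu> A $ i))"

definition measure_supp :: "'a::topological_space measure \<Rightarrow> 'a set" where
  "measure_supp M = {x. \<forall>U. open U \<longrightarrow> x \<in> U \<longrightarrow> emeasure M U > 0}"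

section \<open>Fractional divergence and fractional variation\<close>

definition frac_const :: "nat \<Rightarrow> real \<Rightarrow> real" where
  "frac_const n \<alpha> =
     2 powr \<alpha> * pi powr (- real n / 2) * Gamma ((real n + \<alpha> + 1) / 2) / Gamma ((1 - \<alpha>) / 2)"

definition frac_div :: "real \<Rightarrow> ((real ^ 'n) \<Rightarrow> (real ^ 'n)) \<Rightarrow> real ^ 'n \<Rightarrow> real" where
  "frac_div \<alpha> \<phi> x =
     frac_const CARD('n) \<alpha> *
     (LINT y|lebesgue. ((y - x) \<bullet> (\<phi> y - \<phi> x)) / norm (y - x) powr (real CARD('n) + \<alpha> + 1))"

definition Lp :: "real \<Rightarrow> ((real ^ 'n) \<Rightarrow> real) set" where
  "Lp p = {f. f \<in> borel_measurable lebesgue \<and> integrable lebesgue (\<lambda>x. \<bar>f x\<bar> powr p)}"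

definition frac_var :: "real \<Rightarrow> ((real ^ 'n) \<Rightarrow> real) \<Rightarrow> ereal" where
  "frac_var \<alpha> f =
     (SUP \<phi> \<in> {\<phi> \<in> C_inf_c. AE x in lebesgue. norm (\<phi> x) \<le> 1}.
        ereal (LINT x|lebesgue. f x * frac_div \<alpha> \<phi> x))"

definition BV_frac :: "real \<Rightarrow> real \<Rightarrow> ((real ^ 'n) \<Rightarrow> real) set" where
  "BV_frac \<alpha> p = {f \<in> Lp p. frac_var \<alpha> f < \<infinity>}"

text \<open>
  The measure \<open>D\<^sup>\<alpha> f\<close>.  The description is proper for \<open>f\<close> in \<open>BV_frac \<alpha> p\<close> with
  \<open>p \<ge> 1\<close>, by the structure theorem for \<open>BV\<^sup>\<alpha>\<^sup>,\<^sup>p\<close>, and is only meant to be used there.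
\<close>

definition frac_grad :: "real \<Rightarrow> ((real ^ 'n) \<Rightarrow> real) \<Rightarrow> (real ^ 'n) set \<Rightarrow> real ^ 'n" where
  "frac_grad \<alpha> f =
     (THE \<mu>. finite_vector_measure \<mu> \<and>
        (\<forall>\<phi> \<in> Lip_c. (LINT x|lebesgue. f x * frac_div \<alpha> \<phi> x) = - vector_integral \<phi> \<mu>))"

end

theory Submission
  imports Defs
begin

text \<open>
  Let \<open>u \<ge> 0\<close> be a bump function supported in the unit ball and let \<open>f\<close> be a multiple of
  \<open>(- \<Delta>) ^ ((1 - \<alpha>) / 2) u\<close>.  Then \<open>D\<^sup>\<alpha> f\<close> is a multiple of \<open>\<nabla>u\<close>, hence supported in the unit
  ball, while \<open>f\<close> has no zero outside the ball; so \<open>f\<close> may be scaled to attain a value \<open>t\<close> with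
  \<open>\<Phi> t \<noteq> 0\<close>.  By hypothesis, \<open>D\<^sup>\<alpha>\<close> of the function \<open>g = \<Phi> \<circ> f \<ge> 0\<close> vanishes outside the ball
  as well.  There the gradient of the Riesz potential of \<open>g\<close> of order \<open>1 - \<alpha>\<close> vanishes, so the
  potential is constant along half-lines.  It tends to \<open>0\<close> at infinity and is positive
  unless \<open>g = 0\<close>, a contradiction.

  Both \<open>f\<close> and \<open>g\<close> are integrable Lipschitz functions in \<open>W\<^sup>\<alpha>\<^sup>,\<^sup>1\<close>, for which \<open>D\<^sup>\<alpha>\<close> has an explicit
  density.  Hence the existence part of the structure theorem is not needed, only the uniqueness
  of the measure.
\<close>

section \<open>The variation of a vector measure\<close>

text \<open>As Fourier multipliers, the fractional gradient is a multiple of i xi |xi| ^ (\<alpha> -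
  1) and (- \<Delta>) ^ ((1 - \<alpha>) / 2) is |xi| ^ (1 - \<alpha>); the non-local factors cancel,
  and only the gradient remains. The proof stays in physical space and shows only the vanishing
  outside the ball, so the constant of this composition is never computed. In dimension n, the
  product of the two kernels z |z| ^ (- n - \<alpha> - 1) and |w| ^ (- n - 1 + \<alpha>) is
  homogeneous of degree - 2 n - 1 whatever \<alpha> is. It can therefore be written as a mixture of
  powers of quadratic forms, and for each of these the cancellation comes down to completing a
  square.

  The other obstacle is the gradient of the kernel of the Riesz potential: its norm is of order |z|
  ^ (- n - \<alpha>), which is not integrable at 0. The potential of the merely Lipschitz function g
  is thus not differentiated; it is approximated by potentials with smooth kernels, and the error is
  controlled by increments of g.\<close>

lemma fvm_sums:
  assumes "finite_vector_measure \<mu>" "\<And>i. E i \<in> sets borel" "disjoint_family E"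
  shows "(\<lambda>i::nat. \<mu> (E i)) sums \<mu> (\<Union>i. E i)"
  using assms unfolding finite_vector_measure_def by blast

lemma fvm_empty:
  assumes "finite_vector_measure \<mu>"
  shows "\<mu> {} = 0"
proof -
  have "(\<lambda>i::nat. \<mu> {}) sums \<mu> {}"
    using fvm_sums[OF assms, of "\<lambda>_. {}"] by (simp add: disjoint_family_on_def)
  thus ?thesis using summable_const_iff sums_summable by metis
qed

lemma fvm_Un:
  assumes "finite_vector_measure \<mu>" "A \<in> sets borel" "B \<in> sets borel" "A \<inter> B = {}"
  shows "\<mu> (A \<union> B) = \<mu> A + \<mu> B"
proof -
  have 1: "(\<lambda>i. \<mu> (binaryset A B i)) sums \<mu> (\<Union>i. binaryset A B i)"
    using assms by (intro fvm_sums) (auto simp: binaryset_def disjoint_family_on_def)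
  have 2: "(\<lambda>i. \<mu> (binaryset A B i)) sums (\<mu> A + \<mu> B)"
    by (rule binaryset_sums) (rule fvm_empty[OF assms(1)])
  show ?thesis using sums_unique2[OF 1 2] by (simp add: UN_binaryset_eq)
qed

lemma fvm_Diff:
  assumes "finite_vector_measure \<mu>" "A \<in> sets borel" "B \<in> sets borel" "A \<subseteq> B"
  shows "\<mu> (B - A) = \<mu> B - \<mu> A"
  using fvm_Un[OF assms(1,2), of "B - A"] assms by (simp add: Un_absorb1)

lemma fvm_finite_UN:
  assumes "finite_vector_measure \<mu>" "finite I" "\<And>i. i \<in> I \<Longrightarrow> E i \<in> sets borel"
    "disjoint_family_on E I"
  shows "\<mu> (\<Union>i\<in>I. E i) = (\<Sum>i\<in>I. \<mu> (E i))"
  using assms(2,3,4)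
proof (induction I)
  case (insert i I)
  have "\<mu> (E i \<union> (\<Union>i\<in>I. E i)) = \<mu> (E i) + \<mu> (\<Union>i\<in>I. E i)"
    using insert by (intro fvm_Un[OF assms(1)]) (auto simp: disjoint_family_on_def)
  thus ?case using insert by (auto simp: disjoint_family_on_def)
qed (simp add: fvm_empty[OF assms(1)])

lemma ennreal_norm_le_suminf:
  assumes "f sums s"
  shows "ennreal (norm s) \<le> (\<Sum>i. ennreal (norm (f i)))"
proof (rule LIMSEQ_le_const2)
  show "(\<lambda>n. ennreal (norm (\<Sum>i<n. f i))) \<longlonglongrightarrow> ennreal (norm s)"
    using assms unfolding sums_def by (intro tendsto_ennrealI tendsto_norm)
  have "ennreal (norm (\<Sum>i<n. f i)) \<le> (\<Sum>i. ennreal (norm (f i)))" for n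
  proof -
    have "ennreal (norm (\<Sum>i<n. f i)) \<le> ennreal (\<Sum>i<n. norm (f i))"
      by (intro ennreal_leI norm_sum)
    also have "\<dots> = (\<Sum>i<n. ennreal (norm (f i)))" by simp
    also have "\<dots> \<le> (\<Sum>i. ennreal (norm (f i)))" by (intro sum_le_suminf) auto
    finally show ?thesis .
  qed
  thus "\<exists>N. \<forall>n\<ge>N. ennreal (norm (\<Sum>i<n. f i)) \<le> (\<Sum>i. ennreal (norm (f i)))" by blast
qed

lemma ennreal_suminf_swap:
  fixes a :: "nat \<Rightarrow> nat \<Rightarrow> ennreal"
  shows "(\<Sum>i. \<Sum>j. a i j) = (\<Sum>j. \<Sum>i. a i j)"
proof -
  have "(\<Sum>i. \<Sum>j. a i j) = (\<integral>\<^sup>+i. (\<Sum>j. a i j) \<partial>count_space UNIV)"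
    by (rule nn_integral_count_space_nat[symmetric])
  also have "\<dots> = (\<Sum>j. \<integral>\<^sup>+i. a i j \<partial>count_space UNIV)"
    by (intro nn_integral_suminf) simp
  finally show ?thesis by (simp add: nn_integral_count_space_nat)
qed

lemma norm_suminf_le_variation:
  assumes "\<And>i. E i \<in> sets borel" "disjoint_family E" "(\<Union>i. E i) = A"
  shows "(\<Sum>i::nat. ennreal (norm (\<mu> (E i)))) \<le> variation \<mu> A"
  unfolding variation_def using assms by (intro SUP_upper) auto

lemma norm_le_variation:
  assumes "finite_vector_measure \<mu>" "A \<in> sets borel"
  shows "ennreal (norm (\<mu> A)) \<le> variation \<mu> A"
proof -
  have "(\<lambda>i. ennreal (norm (\<mu> (binaryset A {} i)))) sums (ennreal (norm (\<mu> A)) + ennreal (norm (\<mu> {})))"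
    by (rule binaryset_sums[where f="\<lambda>A. ennreal (norm (\<mu> A))"]) (simp add: fvm_empty[OF assms(1)])
  hence "ennreal (norm (\<mu> A)) = (\<Sum>i. ennreal (norm (\<mu> (binaryset A {} i))))"
    by (simp add: sums_iff fvm_empty[OF assms(1)])
  also have "\<dots> \<le> variation \<mu> A"
    using assms by (intro norm_suminf_le_variation)
      (auto simp: binaryset_def disjoint_family_on_def UN_binaryset_eq[of A "{}", simplified])
  finally show ?thesis .
qed

lemma variation_empty:
  assumes "finite_vector_measure \<mu>"
  shows "variation \<mu> {} = 0"
proof -
  have "variation \<mu> {} \<le> 0" unfolding variation_def
    by (intro SUP_least) (auto simp: fvm_empty[OF assms])
  thus ?thesis by simp
qed

text \<open>A partition of \<open>A\<close> and one of \<open>B\<close> merge into a single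
  countable partition of the union: they form rows 0 and 1 of a table \<open>G\<close> whose other
  rows are empty, and \<open>prod_decode\<close> enumerates the table.\<close>

lemma variation_Un_ge:
  fixes \<mu> :: "'a::topological_space set \<Rightarrow> 'b::real_normed_vector"
  assumes \<mu>: "finite_vector_measure \<mu>" and A: "A \<in> sets borel" and B: "B \<in> sets borel"
    and AB: "A \<inter> B = {}"
  shows "variation \<mu> A + variation \<mu> B \<le> variation \<mu> (A \<union> B)"
proof -
  define P where "P = (\<lambda>A. {E :: nat \<Rightarrow> 'a set. range E \<subseteq> sets borel \<and> disjoint_family E \<and> (\<Union>i. E i) = A})"
  define S where "S = (\<lambda>E::nat \<Rightarrow> 'a set. \<Sum>i. ennreal (norm (\<mu> (E i))))"
  have V: "variation \<mu> A = (SUP E\<in>P A. S E)" for A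
    by (simp add: variation_def P_def S_def)
  have ne: "P A \<noteq> {}" if "A \<in> sets borel" for A
  proof -
    have "binaryset A {} \<in> P A" using that unfolding P_def
      by (auto simp: binaryset_def disjoint_family_on_def UN_binaryset_eq[of A "{}", simplified])
    thus ?thesis by blast
  qed
  have "S E + S F \<le> variation \<mu> (A \<union> B)" if E: "E \<in> P A" and F: "F \<in> P B" for E F
  proof -
    define G where "G = (\<lambda>(i::nat, j). if i = 0 then E j else if i = 1 then F j else {})"
    define g where "g = (\<lambda>p. ennreal (norm (\<mu> (G p))))"
    have dE: "E i \<inter> E j = {}" "F i \<inter> F j = {}" if "i \<noteq> j" for i j
      using E F that by (auto simp: P_def disjoint_family_on_def)
    have sub: "E i \<subseteq> A" "F i \<subseteq> B" for i using E F by (auto simp: P_def)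
    have dG: "G p \<inter> G q = {}" if "p \<noteq> q" for p q
    proof -
      obtain i j where p: "p = (i, j)" by (cases p)
      obtain k l where q: "q = (k, l)" by (cases q)
      have x: "E a \<inter> F b = {}" for a b using sub[of a] sub(2)[of b] AB by auto
      hence x': "F b \<inter> E a = {}" for a b by auto
      show ?thesis using that unfolding p q G_def by (simp add: x x' dE)
    qed
    have "(\<Sum>i. ennreal (norm (\<mu> (G (prod_decode i))))) = (\<Sum>i. g (prod_decode i))"
      by (simp only: g_def)
    also have "\<dots> = (\<Sum>m. \<Sum>n. g (m, n))"
      using suminf_ennreal_2dimen[of "\<lambda>m. \<Sum>n. g (m, n)" g, OF refl] .
    also have "\<dots> = (\<Sum>m. if m = 0 then S E else if m = 1 then S F else 0)"
    proof (rule suminf_cong)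
      fix m :: nat
      consider "m = 0" | "m = 1" | "m > 1" by linarith
      thus "(\<Sum>n. g (m, n)) = (if m = 0 then S E else if m = 1 then S F else 0)"
        by cases (simp_all add: g_def G_def S_def fvm_empty[OF \<mu>])
    qed
    also have "\<dots> = (\<Sum>m\<in>{0,1::nat}. if m = 0 then S E else if m = 1 then S F else 0)"
      by (rule suminf_finite) auto
    also have "\<dots> = S E + S F" by simp
    finally have eq: "(\<Sum>i. ennreal (norm (\<mu> (G (prod_decode i))))) = S E + S F" .
    have "(\<Sum>i. ennreal (norm (\<mu> ((\<lambda>i. G (prod_decode i)) i)))) \<le> variation \<mu> (A \<union> B)"
    proof (rule norm_suminf_le_variation)
      show "G (prod_decode i) \<in> sets borel" for i
        using E F by (cases "prod_decode i") (auto simp: G_def P_def)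
      show "disjoint_family (\<lambda>i. G (prod_decode i))"
        by (auto simp: disjoint_family_on_def intro!: dG)
      have "(\<Union>i. G (prod_decode i)) = (\<Union>p. G p)"
      proof -
        have "range (\<lambda>i. G (prod_decode i)) = G ` range prod_decode" by blast
        thus ?thesis by (simp add: surj_prod_decode)
      qed
      also have "\<dots> = (\<Union>j. E j) \<union> (\<Union>j. F j)"
      proof -
        have "G p \<subseteq> (\<Union>j. E j) \<union> (\<Union>j. F j)" for p by (cases p) (auto simp: G_def)
        moreover have "E j \<subseteq> (\<Union>p. G p)" for j
          using UN_upper[of "(0, j)" UNIV G] by (simp add: G_def)
        moreover have "F j \<subseteq> (\<Union>p. G p)" for j
          using UN_upper[of "(1, j)" UNIV G] by (simp add: G_def)
        ultimately show ?thesis by (intro equalityI UN_least Un_least) simp_all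
      qed
      finally show "(\<Union>i. G (prod_decode i)) = A \<union> B" using E F by (simp add: P_def)
    qed
    thus ?thesis by (simp add: eq)
  qed
  hence "S E + variation \<mu> B \<le> variation \<mu> (A \<union> B)" if "E \<in> P A" for E
    using that unfolding V[of B] ennreal_SUP_add_right[OF ne[OF B]]
    by (intro SUP_least) auto
  thus ?thesis
    unfolding V[of A] ennreal_SUP_add_left[OF ne[OF A], symmetric]
    by (intro SUP_least) auto
qed

lemma variation_mono:
  assumes "finite_vector_measure \<mu>" "A \<in> sets borel" "B \<in> sets borel" "A \<subseteq> B"
  shows "variation \<mu> A \<le> variation \<mu> B"
proof -
  have "variation \<mu> A \<le> variation \<mu> A + variation \<mu> (B - A)" by simp
  also have "\<dots> \<le> variation \<mu> (A \<union> (B - A))"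
    using assms by (intro variation_Un_ge) auto
  finally show ?thesis using assms by (simp add: Un_absorb1)
qed

text \<open>One inequality is the limit of finite superadditivity. For the other, a partition
  \<open>E\<close> of the union is refined by the sets \<open>A j\<close>; exchanging the two sums
  groups the refined pieces into partitions of the single \<open>A j\<close>.\<close>

lemma countably_additive_variation:
  fixes \<mu> :: "'a::topological_space set \<Rightarrow> 'b::real_normed_vector"
  assumes \<mu>: "finite_vector_measure \<mu>"
  shows "countably_additive (sets borel) (variation \<mu>)"
  unfolding countably_additive_def
proof (intro allI impI antisym)
  fix A :: "nat \<Rightarrow> 'a set"
  assume A: "range A \<subseteq> sets borel" "disjoint_family A" "\<Union> (range A) \<in> sets borel"
  have fin: "(\<Sum>i<n. variation \<mu> (A i)) \<le> variation \<mu> (\<Union>i<n. A i)" for n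
  proof (induction n)
    case (Suc n)
    have "A i \<inter> A n = {}" if "i < n" for i
      using A(2) that by (auto simp: disjoint_family_on_def)
    hence disj: "(\<Union>i<n. A i) \<inter> A n = {}" by blast
    have "(\<Sum>i<Suc n. variation \<mu> (A i)) \<le> variation \<mu> (\<Union>i<n. A i) + variation \<mu> (A n)"
      using Suc by (simp add: add_mono)
    also have "\<dots> \<le> variation \<mu> ((\<Union>i<n. A i) \<union> A n)"
      using A(1) disj by (intro variation_Un_ge \<mu>) auto
    finally show ?case by (simp add: lessThan_Suc Un_commute)
  qed simp
  show "(\<Sum>i. variation \<mu> (A i)) \<le> variation \<mu> (\<Union>i. A i)"
    using A(1,3) by (intro suminf_le_const summableI order.trans[OF fin] variation_mono \<mu>) auto
  show "variation \<mu> (\<Union>i. A i) \<le> (\<Sum>i. variation \<mu> (A i))"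
    unfolding variation_def[of \<mu> "\<Union>i. A i"]
  proof (intro SUP_least, clarsimp)
    fix E :: "nat \<Rightarrow> 'a set"
    assume E: "range E \<subseteq> sets borel" "disjoint_family E" "(\<Union>i. E i) = (\<Union>i. A i)"
    have "(\<Sum>i. ennreal (norm (\<mu> (E i)))) \<le> (\<Sum>i. \<Sum>j. ennreal (norm (\<mu> (E i \<inter> A j))))"
    proof (intro suminf_le summableI)
      fix i
      have "(\<lambda>j. \<mu> (E i \<inter> A j)) sums \<mu> (\<Union>j. E i \<inter> A j)"
        using A E by (intro fvm_sums[OF \<mu>]) (auto simp: disjoint_family_on_def)
      moreover have "(\<Union>j. E i \<inter> A j) = E i" using E(3) by blast
      ultimately show "ennreal (norm (\<mu> (E i))) \<le> (\<Sum>j. ennreal (norm (\<mu> (E i \<inter> A j))))"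
        by (intro ennreal_norm_le_suminf) simp
    qed
    also have "\<dots> = (\<Sum>j. \<Sum>i. ennreal (norm (\<mu> (E i \<inter> A j))))"
      by (rule ennreal_suminf_swap)
    also have "\<dots> \<le> (\<Sum>j. variation \<mu> (A j))"
    proof (intro suminf_le summableI norm_suminf_le_variation)
      fix j
      show "(\<Union>i. E i \<inter> A j) = A j" using E(3) by blast
      show "disjoint_family (\<lambda>i. E i \<inter> A j)" using E(2) by (auto simp: disjoint_family_on_def)
      show "E i \<inter> A j \<in> sets borel" for i using A E by auto
    qed
    finally show "(\<Sum>i. ennreal (norm (\<mu> (E i)))) \<le> (\<Sum>j. variation \<mu> (A j))" .
  qed
qed

lemma sets_total_variation [simp, measurable_cong]: "sets (total_variation \<mu>) = sets borel"
  using sets.sigma_sets_eq[of borel] unfolding total_variation_def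
  by (subst sets_measure_of) auto

lemma space_total_variation [simp]: "space (total_variation \<mu>) = UNIV"
  by (simp add: total_variation_def space_measure_of_conv)

lemma emeasure_total_variation:
  assumes "finite_vector_measure \<mu>" "A \<in> sets borel"
  shows "emeasure (total_variation \<mu>) A = variation \<mu> A"
  unfolding total_variation_def
  using sets.sigma_algebra_axioms[of borel] assms
  by (intro emeasure_measure_of_sigma)
     (auto simp: positive_def variation_empty countably_additive_variation)

text \<open>If \<nu> is unbounded on the subsets of a set, one can remove a piece with |\<nu>| > 1
  so that \<nu> is still unbounded on the subsets of the rest. Iteration yields disjoint pieces
  whose measures form a convergent series with terms that do not tend to 0.\<close>

lemma real_fvm_bounded:
  fixes \<nu> :: "'a::topological_space set \<Rightarrow> real"
  assumes \<nu>: "finite_vector_measure \<nu>"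
  shows "\<exists>C. \<forall>A\<in>sets borel. \<bar>\<nu> A\<bar> \<le> C"
proof (rule ccontr)
  define bad where "bad = (\<lambda>E. E \<in> sets borel \<and> (\<forall>C. \<exists>A\<in>sets borel. A \<subseteq> E \<and> \<bar>\<nu> A\<bar> > C))"
  assume "\<not> ?thesis"
  hence bad0: "bad UNIV" unfolding bad_def by (auto simp: not_le)
  have step: "\<exists>E'. bad E' \<and> E' \<subseteq> E \<and> \<bar>\<nu> (E - E')\<bar> > 1" if E: "bad E" for E
  proof -
    \<comment> \<open>The margin |\<nu> E| makes both \<open>A\<close> and \<open>E - A\<close> have
      measure above 1 in absolute value; so whichever of the two stays bad, the other one is a piece
      that may be removed.\<close>
    obtain A where A: "A \<in> sets borel" "A \<subseteq> E" "\<bar>\<nu> A\<bar> > 1 + \<bar>\<nu> E\<bar>"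
      using E unfolding bad_def by blast
    have Eb: "E \<in> sets borel" using E by (simp add: bad_def)
    have D: "\<nu> (E - A) = \<nu> E - \<nu> A" using A Eb by (intro fvm_Diff[OF \<nu>])
    have "bad A \<or> bad (E - A)"
    proof (rule ccontr)
      assume "\<not> ?thesis"
      hence nb: "\<not> bad A" "\<not> bad (E - A)" by auto
      have "\<exists>C. \<forall>B\<in>sets borel. B \<subseteq> A \<longrightarrow> \<bar>\<nu> B\<bar> \<le> C"
        using nb(1) A(1) unfolding bad_def by (simp add: not_less)
      then obtain C1 where C1: "\<And>B. B \<in> sets borel \<Longrightarrow> B \<subseteq> A \<Longrightarrow> \<bar>\<nu> B\<bar> \<le> C1" by blast
      have "E - A \<in> sets borel" using A(1) Eb by simp
      hence "\<exists>C. \<forall>B\<in>sets borel. B \<subseteq> E - A \<longrightarrow> \<bar>\<nu> B\<bar> \<le> C"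
        using nb(2) unfolding bad_def by (simp add: not_less)
      then obtain C2 where C2: "\<And>B. B \<in> sets borel \<Longrightarrow> B \<subseteq> E - A \<Longrightarrow> \<bar>\<nu> B\<bar> \<le> C2" by blast
      obtain B where B: "B \<in> sets borel" "B \<subseteq> E" "\<bar>\<nu> B\<bar> > C1 + C2"
        using E unfolding bad_def by blast
      have "\<nu> B = \<nu> (B \<inter> A) + \<nu> (B - A)"
      proof -
        have "B = (B \<inter> A) \<union> (B - A)" by blast
        moreover have "(B \<inter> A) \<inter> (B - A) = {}" by blast
        ultimately show ?thesis using fvm_Un[OF \<nu>, of "B \<inter> A" "B - A"] A(1) B(1) by simp
      qed
      moreover have "\<bar>\<nu> (B \<inter> A)\<bar> \<le> C1" using A B by (intro C1) auto
      moreover have "\<bar>\<nu> (B - A)\<bar> \<le> C2" using A B by (intro C2) auto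
      ultimately show False using B(3) by linarith
    qed
    thus ?thesis
    proof
      assume "bad A" thus ?thesis using A D by (intro exI[of _ A]) auto
    next
      assume "bad (E - A)"
      moreover have "E - (E - A) = A" using A by auto
      ultimately show ?thesis using A by (intro exI[of _ "E - A"]) auto
    qed
  qed
  have "\<exists>E. \<forall>n::nat. bad (E n) \<and> (E (Suc n) \<subseteq> E n \<and> \<bar>\<nu> (E n - E (Suc n))\<bar> > 1)"
  proof (rule dependent_nat_choice)
    show "\<exists>E. bad E" using bad0 by blast
    show "\<exists>E'. bad E' \<and> (E' \<subseteq> E \<and> \<bar>\<nu> (E - E')\<bar> > 1)" if "bad E" for E and n :: nat
      using step[OF that] .
  qed
  then obtain E where E: "\<And>n::nat. bad (E n)" "\<And>n. E (Suc n) \<subseteq> E n"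
      "\<And>n. \<bar>\<nu> (E n - E (Suc n))\<bar> > 1" by blast
  have anti: "E n \<subseteq> E m" if "m \<le> n" for m n
    using lift_Suc_antimono_le[of E, OF E(2) that] .
  have disj: "(E i - E (Suc i)) \<inter> (E j - E (Suc j)) = {}" if "i < j" for i j
    using anti[of "Suc i" j] that by auto
  have "disjoint_family (\<lambda>n. E n - E (Suc n))"
    unfolding disjoint_family_on_def
    using disj by (metis Int_commute linorder_neqE_nat)
  hence "(\<lambda>n. \<nu> (E n - E (Suc n))) sums \<nu> (\<Union>n. E n - E (Suc n))"
    using E(1) by (intro fvm_sums[OF \<nu>]) (auto simp: bad_def)
  hence "(\<lambda>n. \<nu> (E n - E (Suc n))) \<longlonglongrightarrow> 0"
    using summable_LIMSEQ_zero sums_summable by blast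
  hence "eventually (\<lambda>n. \<bar>\<nu> (E n - E (Suc n))\<bar> < 1) sequentially"
    by (auto simp: tendsto_iff dist_real_def)
  thus False using E(3) by (metis (no_types, lifting) eventually_sequentially less_asym order_refl)
qed

text \<open>The factor 2 comes from grouping finitely many pieces of a partition by the sign of
  their measure: each group has a union of measure at most \<open>C\<close> in absolute
  value.\<close>

lemma real_variation_finite:
  fixes \<nu> :: "'a::topological_space set \<Rightarrow> real"
  assumes \<nu>: "finite_vector_measure \<nu>"
  shows "variation \<nu> UNIV < \<infinity>"
proof -
  obtain C where C: "\<And>A. A \<in> sets borel \<Longrightarrow> \<bar>\<nu> A\<bar> \<le> C" using real_fvm_bounded[OF \<nu>] by blast
  have "variation \<nu> UNIV \<le> ennreal (2 * C)"
    unfolding variation_def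
  proof (intro SUP_least, clarsimp)
    fix E :: "nat \<Rightarrow> 'a set"
    assume E: "range E \<subseteq> sets borel" "disjoint_family E" 
    have "(\<Sum>i<n. \<bar>\<nu> (E i)\<bar>) \<le> 2 * C" for n
    proof -
      define P where "P = {i. i < n \<and> \<nu> (E i) \<ge> 0}"
      define N where "N = {i. i < n \<and> \<nu> (E i) < 0}"
      have fin: "finite P" "finite N" by (auto simp: P_def N_def)
      have *: "\<bar>\<Sum>i\<in>I. \<nu> (E i)\<bar> \<le> C" if "finite I" for I
      proof -
        have "\<nu> (\<Union>i\<in>I. E i) = (\<Sum>i\<in>I. \<nu> (E i))"
          using E that by (intro fvm_finite_UN[OF \<nu>]) (auto simp: disjoint_family_on_def)
        moreover have "(\<Union>i\<in>I. E i) \<in> sets borel" using E that by auto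
        ultimately show ?thesis using C by metis
      qed
      have PN: "{..<n} = P \<union> N" "P \<inter> N = {}" by (auto simp: P_def N_def)
      have "(\<Sum>i<n. \<bar>\<nu> (E i)\<bar>) = (\<Sum>i\<in>P. \<bar>\<nu> (E i)\<bar>) + (\<Sum>i\<in>N. \<bar>\<nu> (E i)\<bar>)"
        unfolding PN(1) using fin PN(2) by (intro sum.union_disjoint)
      also have "(\<Sum>i\<in>P. \<bar>\<nu> (E i)\<bar>) = (\<Sum>i\<in>P. \<nu> (E i))" by (intro sum.cong) (auto simp: P_def)
      also have "(\<Sum>i\<in>N. \<bar>\<nu> (E i)\<bar>) = - (\<Sum>i\<in>N. \<nu> (E i))"
        unfolding sum_negf[symmetric] by (intro sum.cong) (auto simp: N_def)
      finally show ?thesis using *[OF fin(1)] *[OF fin(2)] by linarith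
    qed
    hence "(\<Sum>i<n. ennreal \<bar>\<nu> (E i)\<bar>) \<le> ennreal (2 * C)" for n
      by (simp add: ennreal_leI)
    thus "(\<Sum>i. ennreal \<bar>\<nu> (E i)\<bar>) \<le> ennreal (2 * C)"
      by (intro suminf_le_const summableI)
  qed
  thus ?thesis by (metis ennreal_less_top infinity_ennreal_def order_le_less_trans)
qed

section \<open>Jordan decomposition of a real-valued measure\<close>

lemma finite_measure_total_variation:
  fixes \<nu> :: "'a::topological_space set \<Rightarrow> real"
  assumes \<nu>: "finite_vector_measure \<nu>"
  shows "finite_measure (total_variation \<nu>)"
  using real_variation_finite[OF \<nu>] by (intro finite_measureI) (auto simp: emeasure_total_variation \<nu>)

text \<open>Treats both Jordan parts at once: \<open>s\<close> is 1 for the positive and -1 for the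
  negative part. The set function is non-negative because |\<nu> A| is at most the total variation
  of \<open>A\<close>.\<close>

lemma measure_of_half_total_variation:
  fixes \<nu> :: "'a::topological_space set \<Rightarrow> real"
  assumes \<nu>: "finite_vector_measure \<nu>" and s: "\<bar>s\<bar> = 1"
    and M_def: "M = measure_of UNIV (sets borel) (\<lambda>A. ennreal ((measure (total_variation \<nu>) A + s * \<nu> A) / 2))"
  shows "sets M = sets borel" "finite_measure M"
    "\<And>A. A \<in> sets borel \<Longrightarrow> measure M A = (measure (total_variation \<nu>) A + s * \<nu> A) / 2"
proof -
  interpret T: finite_measure "total_variation \<nu>" by (rule finite_measure_total_variation[OF \<nu>])
  show sets: "sets M = sets borel"
    using sets.sigma_sets_eq[of borel] unfolding M_def by (subst sets_measure_of) auto
  have nn: "(measure (total_variation \<nu>) A + s * \<nu> A) / 2 \<ge> 0" if "A \<in> sets borel" for A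
  proof -
    have "ennreal \<bar>\<nu> A\<bar> \<le> ennreal (measure (total_variation \<nu>) A)"
      using norm_le_variation[OF \<nu> that] that
      by (simp add: emeasure_total_variation[OF \<nu>, symmetric] T.emeasure_eq_measure)
    hence "\<bar>\<nu> A\<bar> \<le> measure (total_variation \<nu>) A" by simp
    moreover have "\<bar>s * \<nu> A\<bar> = \<bar>\<nu> A\<bar>" using s by (simp add: abs_mult)
    ultimately have "- (s * \<nu> A) \<le> measure (total_variation \<nu>) A" by linarith
    thus ?thesis by simp
  qed
  have em: "emeasure M A = ennreal ((measure (total_variation \<nu>) A + s * \<nu> A) / 2)" if "A \<in> sets borel" for A
    unfolding M_def
  proof (rule emeasure_measure_of_sigma)
    show "sigma_algebra UNIV (sets (borel :: 'a measure))"
      using sets.sigma_algebra_axioms[of borel] by simp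
    show "positive (sets borel) (\<lambda>A. ennreal ((measure (total_variation \<nu>) A + s * \<nu> A) / 2))"
      by (simp add: positive_def fvm_empty[OF \<nu>])
    show "countably_additive (sets borel) (\<lambda>A. ennreal ((measure (total_variation \<nu>) A + s * \<nu> A) / 2))"
      unfolding countably_additive_def
    proof (intro allI impI)
      fix A :: "nat \<Rightarrow> 'a set"
      assume A: "range A \<subseteq> sets borel" "disjoint_family A" "\<Union> (range A) \<in> sets borel"
      have S: "(\<lambda>i. (measure (total_variation \<nu>) (A i) + s * \<nu> (A i)) / 2) sums
          ((measure (total_variation \<nu>) (\<Union>i. A i) + s * \<nu> (\<Union>i. A i)) / 2)"
        using A by (intro sums_divide sums_add sums_mult T.finite_measure_UNION fvm_sums[OF \<nu>]) auto
      have "(\<Sum>i. ennreal ((measure (total_variation \<nu>) (A i) + s * \<nu> (A i)) / 2)) =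
          ennreal (\<Sum>i. (measure (total_variation \<nu>) (A i) + s * \<nu> (A i)) / 2)"
        using A(1) by (intro suminf_ennreal2[OF _ sums_summable[OF S]] nn) auto
      thus "(\<Sum>i. ennreal ((measure (total_variation \<nu>) (A i) + s * \<nu> (A i)) / 2)) =
          ennreal ((measure (total_variation \<nu>) (\<Union>i. A i) + s * \<nu> (\<Union>i. A i)) / 2)"
        by (simp only: sums_unique[OF S])
    qed
  qed (use that in auto)
  show "measure M A = (measure (total_variation \<nu>) A + s * \<nu> A) / 2" if "A \<in> sets borel" for A
    using nn[OF that] em[OF that] by (simp add: measure_def)
  show "finite_measure M"
  proof (rule finite_measureI)
    have "space M = UNIV" using sets_eq_imp_space_eq[OF sets] by simp
    thus "emeasure M (space M) \<noteq> \<infinity>" using em[of UNIV] by simp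
  qed
qed

lemma
  fixes \<nu> :: "'a::topological_space set \<Rightarrow> real"
  assumes \<nu>: "finite_vector_measure \<nu>"
  shows sets_pos_part: "sets (pos_part \<nu>) = sets borel"
    and sets_neg_part: "sets (neg_part \<nu>) = sets borel"
    and finite_pos_part: "finite_measure (pos_part \<nu>)"
    and finite_neg_part: "finite_measure (neg_part \<nu>)"
    and jordan_decomposition: "A \<in> sets borel \<Longrightarrow> \<nu> A = measure (pos_part \<nu>) A - measure (neg_part \<nu>) A"
proof -
  have p: "pos_part \<nu> = measure_of UNIV (sets borel) (\<lambda>A. ennreal ((measure (total_variation \<nu>) A + 1 * \<nu> A) / 2))"
    by (simp add: pos_part_def)
  have n: "neg_part \<nu> = measure_of UNIV (sets borel) (\<lambda>A. ennreal ((measure (total_variation \<nu>) A + (- 1) * \<nu> A) / 2))"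
    by (simp add: neg_part_def)
  have 1: "\<bar>1::real\<bar> = 1" "\<bar>-1::real\<bar> = 1" by auto
  note P = measure_of_half_total_variation[OF \<nu> 1(1) p]
  note N = measure_of_half_total_variation[OF \<nu> 1(2) n]
  show "sets (pos_part \<nu>) = sets borel" by (rule P(1))
  show "sets (neg_part \<nu>) = sets borel" by (rule N(1))
  show "finite_measure (pos_part \<nu>)" by (rule P(2))
  show "finite_measure (neg_part \<nu>)" by (rule N(2))
  show "A \<in> sets borel \<Longrightarrow> \<nu> A = measure (pos_part \<nu>) A - measure (neg_part \<nu>) A"
    by (simp only: P(3) N(3)) (simp add: field_simps)
qed

section \<open>Integrals over Euclidean space\<close>

lemma nn_integral_lborel_affine:
  fixes f :: "'a::euclidean_space \<Rightarrow> ennreal"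
  assumes [measurable]: "f \<in> borel_measurable borel" and c: "c \<noteq> 0"
  shows "(\<integral>\<^sup>+x. f x \<partial>lborel) = ennreal (\<bar>c\<bar> ^ DIM('a)) * (\<integral>\<^sup>+x. f (t + c *\<^sub>R x) \<partial>lborel)"
  by (subst lborel_affine[OF c, of t])
     (simp add: nn_integral_density nn_integral_distr nn_integral_cmult)

text \<open>The degenerate case is an alternative in the conclusion instead of a premise, so that
  simplification removes it in instances with a concrete \<open>c\<close>.\<close>

lemma integrable_lborel_affine:
  fixes f :: "'a::euclidean_space \<Rightarrow> 'b::{banach, second_countable_topology}"
  assumes f: "integrable lborel f"
  shows "integrable lborel (\<lambda>x. f (t + c *\<^sub>R x)) \<or> c = 0"
proof (cases "c = 0")
  case False
  have [measurable]: "f \<in> borel_measurable borel" using f by auto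
  have *: "integrable (density (distr lborel borel (\<lambda>x. t + c *\<^sub>R x)) (\<lambda>_. ennreal (\<bar>c\<bar> ^ DIM('a)))) f"
    using f by (subst (asm) lborel_affine[OF False, of t])
  hence "integrable lborel (\<lambda>x. \<bar>c\<bar> ^ DIM('a) *\<^sub>R f (t + c *\<^sub>R x))"
    by (simp add: integrable_density integrable_distr_eq)
  from integrable_scaleR_right[OF this, of "inverse (\<bar>c\<bar> ^ DIM('a))"]
  show ?thesis using False by simp
qed auto

lemma integral_lborel_affine:
  fixes f :: "'a::euclidean_space \<Rightarrow> 'b::{banach, second_countable_topology}"
  assumes [measurable]: "f \<in> borel_measurable borel" and c: "c \<noteq> 0"
  shows "integral\<^sup>L lborel f = \<bar>c\<bar> ^ DIM('a) *\<^sub>R (\<integral>x. f (t + c *\<^sub>R x) \<partial>lborel)"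
  by (subst lborel_affine[OF c, of t])
     (simp add: integral_density integral_distr)

lemma integral_lborel_translate:
  fixes f :: "'a::euclidean_space \<Rightarrow> 'b::{banach, second_countable_topology}"
  assumes "f \<in> borel_measurable borel"
  shows "(\<integral>x. f (t + x) \<partial>lborel) = integral\<^sup>L lborel f" 
  using integral_lborel_affine[OF assms, of 1 t] by simp

lemma integrable_lborel_translate:
  fixes f :: "'a::euclidean_space \<Rightarrow> 'b::{banach, second_countable_topology}"
  assumes "integrable lborel f"
  shows "integrable lborel (\<lambda>x. f (t + x))"
  using integrable_lborel_affine[OF assms, of t 1] by simp

lemma nn_integral_lborel_translate:
  fixes f :: "'a::euclidean_space \<Rightarrow> ennreal"
  assumes [measurable]: "f \<in> borel_measurable borel"
  shows "(\<integral>\<^sup>+x. f (t + x) \<partial>lborel) = (\<integral>\<^sup>+x. f x \<partial>lborel)"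
  using nn_integral_lborel_affine[OF assms, of 1 t] by simp

lemma integral_lborel_uminus:
  fixes f :: "'a::euclidean_space \<Rightarrow> 'b::{banach, second_countable_topology}"
  assumes "f \<in> borel_measurable borel"
  shows "(\<integral>x. f (- x) \<partial>lborel) = integral\<^sup>L lborel f"
  using integral_lborel_affine[OF assms, of "-1" 0] by simp

text \<open>Reflection preserves the integral, also that of a non-integrable function, which is 0 by
  convention.\<close>

lemma integral_lborel_odd:
  fixes f :: "'a::euclidean_space \<Rightarrow> 'b::{banach, second_countable_topology}"
  assumes "f \<in> borel_measurable borel" "\<And>x. f (- x) = - f x"
  shows "integral\<^sup>L lborel f = 0"
proof -
  have "integral\<^sup>L lborel f = - integral\<^sup>L lborel f"
    using integral_lborel_uminus[OF assms(1)] by (simp add: assms(2))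
  hence "2 *\<^sub>R integral\<^sup>L lborel f = 0"
    by (simp add: scaleR_2 eq_neg_iff_add_eq_0)
  thus ?thesis by simp
qed

lemma nn_integral_powr_0_1:
  assumes "(a::real) > -1"
  shows "(\<integral>\<^sup>+x\<in>{0..1}. ennreal (x powr a) \<partial>lborel) < \<infinity>"
proof -
  have "((\<lambda>x. x powr a) has_integral (1 powr (a+1) / (a+1))) {0..1}"
    using has_integral_powr_from_0[of a 1] assms by simp
  hence "(\<integral>\<^sup>+x\<in>{0..1}. ennreal (x powr a) \<partial>lborel) = ennreal (1 powr (a+1) / (a+1))"
    by (intro nn_integral_has_integral_lebesgue') auto
  thus ?thesis by simp
qed

lemma nn_integral_powr_1_infinity:
  assumes "(a::real) < -1"
  shows "(\<integral>\<^sup>+x\<in>{1..}. ennreal (x powr a) \<partial>lborel) < \<infinity>"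
proof -
  have "((\<lambda>x. x powr a) has_integral (- (1 powr (a+1) / (a+1)))) {1..}"
    using has_integral_powr_to_inf[of a 1] assms by simp
  hence "(\<integral>\<^sup>+x\<in>{1..}. ennreal (x powr a) \<partial>lborel) = ennreal (- (1 powr (a+1) / (a+1)))"
    by (intro nn_integral_has_integral_lebesgue') auto
  thus ?thesis by simp
qed

lemma AE_zero_continuous_imp_zero:
  fixes f :: "'a::euclidean_space \<Rightarrow> real"
  assumes "continuous_on UNIV f" "AE x in lborel. f x = 0"
  shows "f x = 0"
proof (rule ccontr)
  assume "f x \<noteq> 0"
  define V where "V = {x. f x \<noteq> 0}"
  have V: "open V" "x \<in> V"
    unfolding V_def using assms(1) \<open>f x \<noteq> 0\<close> by (auto intro!: open_Collect_neq continuous_on_const)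
  have "emeasure lborel V = 0"
    using AE_iff_measurable[of V lborel "\<lambda>x. f x = 0"] assms(2) V by (auto simp: V_def)
  hence "V \<in> null_sets lebesgue" using V by (intro null_sets_completionI) auto
  hence "negligible V" by (simp add: negligible_iff_null_sets)
  thus False using open_not_negligible[OF V(1)] V(2) by blast
qed

text \<open>The majorant of the singular integrals below: increments of a bounded Lipschitz function
  are at most a multiple of min 1 |z|, and the kernels have size |z| ^ (- n - \<gamma>). The product
  is integrable at 0 because \<gamma> < 1 and at infinity because \<gamma> > 0.\<close>

definition trunc_kernel :: "real \<Rightarrow> 'a::euclidean_space \<Rightarrow> real" where
  "trunc_kernel \<gamma> z = min 1 (norm z) * norm z powr - (real DIM('a) + \<gamma>)"

lemma trunc_kernel_nonneg: "trunc_kernel \<gamma> z \<ge> 0"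
  by (simp add: trunc_kernel_def)

lemma trunc_kernel_measurable [measurable]:
  "trunc_kernel \<gamma> \<in> borel_measurable borel"
  unfolding trunc_kernel_def by measurable

text \<open>
  \<open>trunc_kernel \<gamma> z\<close> is dominated by a multiple of the average of \<open>q\<close> over
  \<open>{norm z..2 * norm z}\<close>; after Tonelli only the volumes of balls enter.
\<close>

lemma integrable_trunc_kernel:
  assumes \<gamma>: "0 < \<gamma>" "\<gamma> < 1"
  shows "integrable lborel (trunc_kernel \<gamma> :: 'a::euclidean_space \<Rightarrow> real)"
proof -
  define n where "n = real DIM('a)"
  \<comment> \<open>\<open>q\<close> is the radial profile of the kernel divided by the radius. On
    [r, 2 r] it is at least \<open>q r / C\<close>, so its integral over this interval is at least
    the kernel at radius r divided by \<open>C\<close>.\<close>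
  define q where "q = (\<lambda>l::real. if l > 0 then min 1 l * l powr - (n + \<gamma> + 1) else 0)"
  define C where "C = 2 powr (n + \<gamma> + 1)"
  have n: "n \<ge> 1" unfolding n_def using DIM_positive[where 'a='a]
    by (metis One_nat_def Suc_leI of_nat_1 of_nat_le_iff)
  have q0: "q l \<ge> 0" for l by (simp add: q_def)
  have [measurable]: "q \<in> borel_measurable borel" unfolding q_def by measurable
  have [measurable]: "{x::'a\<times>real. norm (fst x) \<le> snd x} \<in> sets (borel \<Otimes>\<^sub>M borel)"
    unfolding borel_prod by (intro borel_closed closed_Collect_le continuous_intros)
  let ?I = "\<lambda>(z::'a) l. ennreal (q l) * indicator {x::'a\<times>real. norm (fst x) \<le> snd x} (z, l)"
  have mI: "(\<lambda>(z,l). ?I z l) \<in> borel_measurable (lborel \<Otimes>\<^sub>M lborel)"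
    by measurable
  have bound: "ennreal (trunc_kernel \<gamma> z) \<le> ennreal C * (\<integral>\<^sup>+l. ?I z l \<partial>lborel)" for z :: 'a
  proof (cases "z = 0")
    case False
    define r where "r = norm z"
    have r: "r > 0" using False by (simp add: r_def)
    define v where "v = min 1 r * (2 * r) powr - (n + \<gamma> + 1)"
    have v0: "v \<ge> 0" using r by (simp add: v_def)
    have le: "v \<le> q l" if "l \<in> {r..2*r}" for l
      unfolding v_def q_def using that r n \<gamma>
      by (auto intro!: mult_mono powr_mono2')
    have "ennreal v * ennreal r = (\<integral>\<^sup>+l. ennreal v * indicator {r..2*r} l \<partial>lborel)"
      using r by (simp add: nn_integral_cmult)
    also have "\<dots> \<le> (\<integral>\<^sup>+l. ?I z l \<partial>lborel)"
      by (intro nn_integral_mono) (auto simp: indicator_def r_def[symmetric] intro!: le ennreal_leI)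
    finally have 1: "ennreal v * ennreal r \<le> (\<integral>\<^sup>+l. ?I z l \<partial>lborel)" .
    have "trunc_kernel \<gamma> z = C * (v * r)"
    proof -
      have "r powr - (n + \<gamma>) = r powr (-(n+\<gamma>+1) + 1)" by simp
      also have "\<dots> = r powr (-(n+\<gamma>+1)) * r" unfolding powr_add using r by simp
      finally have "r powr - (n + \<gamma>) = r powr (-(n+\<gamma>+1)) * r" .
      moreover have "C * 2 powr (-(n+\<gamma>+1)) = 1" unfolding C_def by (simp flip: powr_add)
      ultimately show ?thesis
        unfolding trunc_kernel_def v_def n_def[symmetric] r_def[symmetric]
        using r by (simp add: powr_mult mult_ac) 
    qed
    hence "ennreal (trunc_kernel \<gamma> z) = ennreal C * (ennreal v * ennreal r)"
      using v0 r by (simp add: C_def ennreal_mult)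
    thus ?thesis using 1 by (simp add: mult_left_mono)
  qed (simp add: trunc_kernel_def)
  have fin1: "(\<integral>\<^sup>+l. ennreal (q l * l ^ DIM('a)) \<partial>lborel) < \<infinity>"
  proof -
    have "(\<integral>\<^sup>+l. ennreal (q l * l ^ DIM('a)) \<partial>lborel)
       \<le> (\<integral>\<^sup>+l. ennreal (l powr (-\<gamma>)) * indicator {0..1} l + ennreal (l powr (-\<gamma>-1)) * indicator {1..} l \<partial>lborel)"
    proof (intro nn_integral_mono)
      fix l :: real
      show "ennreal (q l * l ^ DIM('a)) \<le> ennreal (l powr (-\<gamma>)) * indicator {0..1} l + ennreal (l powr (-\<gamma>-1)) * indicator {1..} l"
      proof (cases "l > 0")
        case True
        have e: "l ^ DIM('a) = l powr n" using True by (simp add: n_def powr_realpow)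
        have e1: "l powr - (n + \<gamma> + 1) * l powr n = l powr (-\<gamma>-1)"
          by (simp add: powr_add[symmetric])
        have e2: "l * l powr (-\<gamma>-1) = l powr (-\<gamma>)"
          using True powr_add[of l 1 "-\<gamma>-1"] by simp
        have "q l * l ^ DIM('a) = min 1 l * l powr (-\<gamma>-1)"
          unfolding q_def using True e e1 by (simp add: mult.assoc)
        thus ?thesis using True e2
          by (cases "l \<le> 1"; cases "l = 1") (auto simp: min_def)
      qed (simp add: q_def)
    qed
    also have "\<dots> < \<infinity>"
      using nn_integral_powr_0_1[of "-\<gamma>"] nn_integral_powr_1_infinity[of "-\<gamma>-1"] \<gamma>
      by (subst nn_integral_add) auto
    finally show ?thesis .
  qed
  have "(\<integral>\<^sup>+z. ennreal (trunc_kernel \<gamma> (z::'a)) \<partial>lborel) \<le> (\<integral>\<^sup>+z. ennreal C * (\<integral>\<^sup>+l. ?I z l \<partial>lborel) \<partial>lborel)"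
    by (intro nn_integral_mono bound)
  also have "\<dots> = ennreal C * (\<integral>\<^sup>+z. (\<integral>\<^sup>+l. ?I z l \<partial>lborel) \<partial>lborel)"
    using mI by (intro nn_integral_cmult lborel.borel_measurable_nn_integral) auto
  also have "(\<integral>\<^sup>+z. (\<integral>\<^sup>+l. ?I z l \<partial>lborel) \<partial>lborel) = (\<integral>\<^sup>+l. (\<integral>\<^sup>+z. ?I z l \<partial>lborel) \<partial>lborel)"
    using lborel_pair.Fubini'[OF mI] by simp
  also have "\<dots> = (\<integral>\<^sup>+l. ennreal (unit_ball_vol n) * ennreal (q l * l ^ DIM('a)) \<partial>lborel)"
  proof (intro nn_integral_cong)
    fix l :: real
    have "(\<integral>\<^sup>+z. ?I z l \<partial>lborel) = (\<integral>\<^sup>+z. ennreal (q l) * indicator (cball (0::'a) l) z \<partial>lborel)"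
      by (intro nn_integral_cong) (auto simp: indicator_def)
    also have "\<dots> = ennreal (q l) * emeasure lborel (cball (0::'a) l)"
      by (simp add: nn_integral_cmult_indicator)
    also have "\<dots> = ennreal (unit_ball_vol n) * ennreal (q l * l ^ DIM('a))"
    proof (cases "l > 0")
      case True
      thus ?thesis using q0[of l]
        by (simp add: emeasure_cball n_def ennreal_mult mult_ac)
    qed (simp add: q_def)
    finally show "(\<integral>\<^sup>+z. ?I z l \<partial>lborel) = ennreal (unit_ball_vol n) * ennreal (q l * l ^ DIM('a))" .
  qed
  also have "\<dots> = ennreal (unit_ball_vol n) * (\<integral>\<^sup>+l. ennreal (q l * l ^ DIM('a)) \<partial>lborel)"
    by (intro nn_integral_cmult) measurable
  also have "ennreal C * \<dots> < \<infinity>"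
    using fin1 by (simp add: ennreal_mult_less_top)
  finally show ?thesis
    by (intro integrableI_nonneg) (auto simp: trunc_kernel_nonneg)
qed

section \<open>Integration against vector measures\<close>

text \<open>The equation M1 - M2 = N1 - N2 with all terms moved to the positive side, because
  subtraction in \<open>ennreal\<close> is truncated. In this form it passes through sums, multiples
  and monotone limits.\<close>

lemma nn_integral_add_eqI:
  assumes sets: "sets M1 = sets borel" "sets M2 = sets borel" "sets N1 = sets borel" "sets N2 = sets borel"
    and eq: "\<And>A. A \<in> sets borel \<Longrightarrow> emeasure M1 A + emeasure N2 A = emeasure N1 A + emeasure M2 A"
    and h: "h \<in> borel_measurable borel"
  shows "(\<integral>\<^sup>+x. h x \<partial>M1) + (\<integral>\<^sup>+x. h x \<partial>N2) = (\<integral>\<^sup>+x. h x \<partial>N1) + (\<integral>\<^sup>+x. h x \<partial>M2)"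
  using h
proof (induction rule: borel_measurable_induct)
  case (cong f g)
  then show ?case by auto
next
  case (set A)
  then show ?case using eq[of A] sets by simp
next
  case (mult u c)
  have "u \<in> borel_measurable M1" "u \<in> borel_measurable M2" "u \<in> borel_measurable N1" "u \<in> borel_measurable N2"
    using mult sets measurable_cong_sets by blast+
  thus ?case using mult.IH by (simp add: nn_integral_cmult flip: distrib_left)
next
  case (add u v)
  have "u \<in> borel_measurable M1" "u \<in> borel_measurable M2" "u \<in> borel_measurable N1" "u \<in> borel_measurable N2"
    "v \<in> borel_measurable M1" "v \<in> borel_measurable M2" "v \<in> borel_measurable N1" "v \<in> borel_measurable N2"
    using add sets measurable_cong_sets by blast+
  thus ?case using add.IH by (simp add: nn_integral_add) (metis (no_types, lifting) add.assoc add.left_commute)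
next
  case (seq U)
  have m: "U i \<in> borel_measurable M1" "U i \<in> borel_measurable M2" "U i \<in> borel_measurable N1" "U i \<in> borel_measurable N2" for i
    using seq sets measurable_cong_sets by blast+
  have incU: "incseq U" using seq by blast
  have inc: "incseq (\<lambda>i. integral\<^sup>N M (U i))" for M
    using incU by (intro incseq_SucI nn_integral_mono) (auto simp: incseq_Suc_iff le_fun_def)
  have S: "integral\<^sup>N M (Sup (range U)) = (SUP i. integral\<^sup>N M (U i))" if "\<And>i. U i \<in> borel_measurable M" for M
  proof -
    have "Sup (range U) = (\<lambda>x. SUP i. U i x)" by (simp add: fun_eq_iff Sup_fun_def image_comp)
    thus ?thesis using nn_integral_monotone_convergence_SUP[OF incU that] by simp
  qed
  show ?case
    by (simp only: S[OF m(1)] S[OF m(2)] S[OF m(3)] S[OF m(4)] ennreal_SUP_add[OF inc inc, symmetric] seq.IH)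
qed

text \<open>Signed integrals are defined by the Jordan parts; this allows computing them from any
  other decomposition into finite measures. The bound on \<open>h\<close> makes all four integrals
  finite.\<close>

lemma integral_diff_eqI:
  fixes h :: "'a::topological_space \<Rightarrow> real"
  assumes sets: "sets M1 = sets borel" "sets M2 = sets borel" "sets N1 = sets borel" "sets N2 = sets borel"
    and fin: "finite_measure M1" "finite_measure M2" "finite_measure N1" "finite_measure N2"
    and eq: "\<And>A. A \<in> sets borel \<Longrightarrow> measure M1 A - measure M2 A = measure N1 A - measure N2 A"
    and h: "h \<in> borel_measurable borel" and B: "\<And>x. \<bar>h x\<bar> \<le> B"
  shows "(\<integral>x. h x \<partial>M1) - (\<integral>x. h x \<partial>M2) = (\<integral>x. h x \<partial>N1) - (\<integral>x. h x \<partial>N2)"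
proof -
  have int: "integrable M g" if "sets M = sets borel" "finite_measure M" "g \<in> borel_measurable borel" "\<And>x. \<bar>g x\<bar> \<le> B"
    for M :: "'a measure" and g :: "'a \<Rightarrow> real"
    using that measurable_cong_sets[OF that(1) refl]
    by (intro finite_measure.integrable_const_bound[where B=B]) auto
  have e: "emeasure M1 A + emeasure N2 A = emeasure N1 A + emeasure M2 A" if "A \<in> sets borel" for A
    using eq[OF that] fin by (simp add: finite_measure.emeasure_eq_measure flip: ennreal_plus)
  have pos: "(\<integral>x. g x \<partial>M1) - (\<integral>x. g x \<partial>M2) = (\<integral>x. g x \<partial>N1) - (\<integral>x. g x \<partial>N2)"
    if g: "g \<in> borel_measurable borel" "\<And>x. \<bar>g x\<bar> \<le> B" "\<And>x. g x \<ge> 0" for g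
  proof -
    have I: "(\<integral>\<^sup>+x. ennreal (g x) \<partial>M) = ennreal (\<integral>x. g x \<partial>M)" if "sets M = sets borel" "finite_measure M" for M
      using int[OF that g(1,2)] g(3) by (intro nn_integral_eq_integral) auto
    have nn: "(\<integral>x. g x \<partial>M) \<ge> 0" for M using g(3) by (intro integral_nonneg_AE) auto
    have "(\<lambda>x. ennreal (g x)) \<in> borel_measurable borel" using g(1) by simp
    from nn_integral_add_eqI[OF sets e this] 
    have "ennreal ((\<integral>x. g x \<partial>M1) + (\<integral>x. g x \<partial>N2)) = ennreal ((\<integral>x. g x \<partial>N1) + (\<integral>x. g x \<partial>M2))"
      by (simp add: I sets fin nn)
    hence "(\<integral>x. g x \<partial>M1) + (\<integral>x. g x \<partial>N2) = (\<integral>x. g x \<partial>N1) + (\<integral>x. g x \<partial>M2)"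
      by (subst (asm) ennreal_inj) (auto intro!: add_nonneg_nonneg nn)
    thus ?thesis by linarith
  qed
  define p n where "p = (\<lambda>x. max 0 (h x))" and "n = (\<lambda>x. max 0 (- h x))"
  have [measurable]: "p \<in> borel_measurable borel" "n \<in> borel_measurable borel"
    using h unfolding p_def n_def by auto
  have pn: "\<bar>p x\<bar> \<le> B" "\<bar>n x\<bar> \<le> B" for x using B[of x] by (auto simp: p_def n_def)
  have hpn: "h x = p x - n x" for x by (auto simp: p_def n_def)
  have D: "(\<integral>x. h x \<partial>M) = (\<integral>x. p x \<partial>M) - (\<integral>x. n x \<partial>M)" if "sets M = sets borel" "finite_measure M" for M
    unfolding hpn using that pn by (intro Bochner_Integration.integral_diff int) auto
  show ?thesis using pos[of p] pos[of n] pn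
    by (simp add: D sets fin) (simp add: p_def n_def)
qed

lemma signed_integral_eq:
  fixes h :: "'a::topological_space \<Rightarrow> real"
  assumes \<nu>: "finite_vector_measure \<nu>"
    and "sets M = sets borel" "sets N = sets borel" "finite_measure M" "finite_measure N"
    and "\<And>A. A \<in> sets borel \<Longrightarrow> \<nu> A = measure M A - measure N A"
    and "h \<in> borel_measurable borel" "\<And>x. \<bar>h x\<bar> \<le> B"
  shows "signed_integral h \<nu> = (\<integral>x. h x \<partial>M) - (\<integral>x. h x \<partial>N)"
  unfolding signed_integral_def
  using assms jordan_decomposition[OF \<nu>]
  by (intro integral_diff_eqI[where B=B] sets_pos_part sets_neg_part finite_pos_part finite_neg_part) auto

section \<open>A vector measure is determined by its integrals of compactly supported Lipschitz
  fields\<close>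

lemma fvm_eqI_closed:
  assumes 1: "finite_vector_measure \<mu>" and 2: "finite_vector_measure \<mu>'"
    and eq: "\<And>C. closed C \<Longrightarrow> \<mu> C = \<mu>' C"
  shows "\<mu> = \<mu>'"
proof
  fix A
  show "\<mu> A = \<mu>' A"
  proof (cases "A \<in> sets borel")
    case True
    have sb: "sets borel = sigma_sets UNIV (Collect closed)"
      by (subst borel_eq_closed) simp
    have "Int_stable (Collect closed)" by (auto simp: Int_stable_def)
    moreover have "Collect closed \<subseteq> Pow UNIV" by simp
    moreover have "A \<in> sigma_sets UNIV (Collect closed)" using True by (simp add: sb)
    ultimately show ?thesis
    proof (induction rule: sigma_sets_induct_disjoint)
      case (compl A)
      thus ?case using fvm_Diff[OF 1, of A UNIV] fvm_Diff[OF 2, of A UNIV] eq[of UNIV] by (simp add: sb)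
    next
      case (union E)
      have "E i \<in> sets borel" for i using union(2) by (auto simp: sb)
      from fvm_sums[OF 1 this union(1)] fvm_sums[OF 2 this union(1)] show ?case
        using union(3) by (simp add: sums_iff)
    qed (use eq fvm_empty[OF 1] fvm_empty[OF 2] in auto)
  qed (use 1 2 in \<open>simp add: finite_vector_measure_def\<close>)
qed

text \<open>A compactly supported Lipschitz approximation of the indicator of \<open>C\<close>: the
  first term falls from 1 on \<open>C\<close> to 0 at distance 1 / k, the second one from 1 on the
  ball of radius k - 1 to 0 on the sphere of radius k. With a minimum in place of a product the
  Lipschitz constants simply add up to k + 1.\<close>

definition cutoff :: "'a::real_normed_vector set \<Rightarrow> nat \<Rightarrow> 'a \<Rightarrow> real" where
  "cutoff C k x = min (max 0 (1 - real k * infdist x C)) (max 0 (min 1 (real k - norm x)))"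

lemma cutoff_bounds: "0 \<le> cutoff C k x" "cutoff C k x \<le> 1"
  by (auto simp: cutoff_def)

lemma cutoff_lipschitz: "\<bar>cutoff C k x - cutoff C k y\<bar> \<le> (real k + 1) * norm (x - y)"
proof -
  define a b d where "a = real k * infdist x C" and "b = real k * infdist y C" and "d = norm (x - y)"
  have "\<bar>infdist x C - infdist y C\<bar> \<le> d"
    using infdist_triangle_abs[of x C y] by (simp add: d_def dist_norm)
  hence "real k * \<bar>infdist x C - infdist y C\<bar> \<le> real k * d" by (intro mult_left_mono) auto
  hence 1: "\<bar>a - b\<bar> \<le> real k * d" by (simp add: a_def b_def abs_mult flip: right_diff_distrib)
  have 2: "\<bar>norm x - norm y\<bar> \<le> d" unfolding d_def by (rule norm_triangle_ineq3)
  have 3: "d \<ge> 0" "real k * d \<ge> 0" by (auto simp: d_def)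
  have "\<bar>min (max 0 (1 - a)) (max 0 (min 1 (real k - norm x))) - min (max 0 (1 - b)) (max 0 (min 1 (real k - norm y)))\<bar> \<le> real k * d + d"
  proof -
    have min_diff: "\<bar>min p q - min p' q'\<bar> \<le> X + Y"
      if "\<bar>p - p'\<bar> \<le> X" "\<bar>q - q'\<bar> \<le> Y" for p p' q q' X Y :: real
      using that by (auto simp: min_def)
    show ?thesis using 1 2 by (intro min_diff) (auto simp: max_def min_def)
  qed
  thus ?thesis by (simp only: cutoff_def a_def b_def d_def distrib_right mult_1_left)
qed

lemma cutoff_eq_0: "norm x \<ge> real k \<Longrightarrow> cutoff C k x = 0"
  by (simp add: cutoff_def)

lemma cutoff_continuous: "continuous_on UNIV (cutoff C k)"
  unfolding cutoff_def by (intro continuous_intros)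

text \<open>The empty set is excluded because \<open>infdist x {}\<close> is 0, which would make the
  first term of the cutoff equal to 1 everywhere.\<close>

lemma cutoff_tendsto:
  assumes "closed C" "C \<noteq> {}"
  shows "(\<lambda>k. cutoff C k x) \<longlonglongrightarrow> indicator C x"
proof (cases "x \<in> C")
  case True
  obtain k0 where k0: "real k0 \<ge> norm x + 1" using real_arch_simple by blast
  have "eventually (\<lambda>k. cutoff C k x = 1) sequentially"
    using eventually_ge_at_top[of k0]
  proof eventually_elim
    case (elim k)
    hence "real k \<ge> norm x + 1" using k0 by (meson of_nat_mono order_trans)
    thus ?case using True by (simp add: cutoff_def)
  qed
  thus ?thesis using True by (simp add: tendsto_eventually)
next
  case False
  hence pos: "infdist x C > 0" using assms infdist_pos_not_in_closed by blast
  obtain k0 where k0: "real k0 \<ge> 1 / infdist x C" using real_arch_simple by blast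
  have "eventually (\<lambda>k. cutoff C k x = 0) sequentially"
    using eventually_ge_at_top[of k0]
  proof eventually_elim
    case (elim k)
    hence "real k \<ge> 1 / infdist x C" using k0 by (meson of_nat_mono order_trans)
    hence "real k * infdist x C \<ge> 1" using pos by (simp add: field_simps)
    thus ?case by (simp add: cutoff_def)
  qed
  thus ?thesis using False by (simp add: tendsto_eventually)
qed

lemma signed_integral_cutoff_tendsto:
  fixes \<nu> :: "'a::euclidean_space set \<Rightarrow> real"
  assumes \<nu>: "finite_vector_measure \<nu>" and C: "closed C" "C \<noteq> {}"
  shows "(\<lambda>k. signed_integral (cutoff C k) \<nu>) \<longlonglongrightarrow> \<nu> C"
proof -
  have L: "(\<lambda>k. \<integral>x. cutoff C k x \<partial>M) \<longlonglongrightarrow> measure M C"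
    if M: "sets M = sets borel" "finite_measure M" for M
  proof -
    interpret finite_measure M by fact
    have [simp]: "C \<in> sets M" using C M by simp
    have meas: "cutoff C k \<in> borel_measurable M" for k
      using borel_measurable_continuous_onI[OF cutoff_continuous] measurable_cong_sets[OF M(1) refl] by blast
    have measC: "indicat_real C \<in> borel_measurable M" by (rule borel_measurable_indicator) simp
    have "(\<lambda>k. \<integral>x. cutoff C k x \<partial>M) \<longlonglongrightarrow> (\<integral>x. indicator C x \<partial>M)"
      by (rule integral_dominated_convergence[where w="\<lambda>_. 1"])
         (auto simp: meas measC cutoff_tendsto[OF C] cutoff_bounds abs_le_iff intro: order_trans[OF _ cutoff_bounds(1)])
    thus ?thesis by simp
  qed
  have Cb: "C \<in> sets borel" using C by simp
  show ?thesis unfolding signed_integral_def jordan_decomposition[OF \<nu> Cb]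
    by (intro tendsto_diff L sets_pos_part sets_neg_part finite_pos_part finite_neg_part \<nu>)
qed

lemma fvm_component:
  fixes \<mu> :: "'a::topological_space set \<Rightarrow> real ^ 'n"
  assumes "finite_vector_measure \<mu>"
  shows "finite_vector_measure (\<lambda>A. \<mu> A $ i)"
  using assms unfolding finite_vector_measure_def
  by (auto intro!: bounded_linear.sums[OF bounded_linear_vec_nth])

lemma signed_integral_zero [simp]: "signed_integral (\<lambda>x. 0) \<nu> = 0"
  by (simp add: signed_integral_def)

lemma vector_integral_axis:
  "vector_integral (\<lambda>x. h x *\<^sub>R axis i 1) \<mu> = signed_integral h (\<lambda>A. \<mu> A $ i)"
proof -
  have "vector_integral (\<lambda>x. h x *\<^sub>R axis i 1) \<mu>
      = (\<Sum>j\<in>UNIV. if j = i then signed_integral h (\<lambda>A. \<mu> A $ j) else 0)"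
    unfolding vector_integral_def by (intro sum.cong) (auto simp: axis_def)
  thus ?thesis by simp
qed

lemma Lip_cI:
  assumes "\<And>x y. norm (\<phi> x - \<phi> y) \<le> L * norm (x - y)" "\<And>x. norm x \<ge> R \<Longrightarrow> \<phi> x = 0"
  shows "\<phi> \<in> Lip_c"
proof -
  have "(max 0 L)-lipschitz_on UNIV \<phi>"
  proof (rule lipschitz_onI)
    fix x y
    have "norm (\<phi> x - \<phi> y) \<le> L * norm (x - y)" by (rule assms)
    also have "\<dots> \<le> max 0 L * norm (x - y)" by (intro mult_right_mono) auto
    finally show "dist (\<phi> x) (\<phi> y) \<le> max 0 L * dist x y" by (simp add: dist_norm)
  qed simp
  moreover have "compact (fun_supp \<phi>)"
    unfolding fun_supp_def
  proof (rule compact_closure[THEN iffD2], rule bounded_subset[OF bounded_ball[of 0 R]])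
    show "{x. \<phi> x \<noteq> 0} \<subseteq> ball 0 R" using assms(2) by (force simp: not_le[symmetric])
  qed
  ultimately show ?thesis unfolding Lip_c_def by blast
qed

text \<open>The fields \<open>cutoff C k x *\<^sub>R axis i 1\<close> recover component i of the
  measure of a closed set \<open>C\<close> as k tends to infinity, and closed sets are an
  intersection-stable generator of the Borel sets.\<close>

lemma fvm_eqI_vector_integral:
  fixes \<mu> \<mu>' :: "(real ^ 'n) set \<Rightarrow> real ^ 'n"
  assumes 1: "finite_vector_measure \<mu>" and 2: "finite_vector_measure \<mu>'"
    and eq: "\<And>\<phi>. \<phi> \<in> Lip_c \<Longrightarrow> vector_integral \<phi> \<mu> = vector_integral \<phi> \<mu>'"
  shows "\<mu> = \<mu>'"
proof (rule fvm_eqI_closed[OF 1 2])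
  fix C :: "(real ^ 'n) set" assume C: "closed C"
  show "\<mu> C = \<mu>' C"
  proof (cases "C = {}")
    case False
    show ?thesis
    proof (rule vec_eq_iff[THEN iffD2], rule allI)
      fix i
      have "(\<lambda>x. cutoff C k x *\<^sub>R axis i 1) \<in> Lip_c" for k
        by (rule Lip_cI[where L="real k + 1" and R="real k"])
           (use cutoff_lipschitz in \<open>auto simp: cutoff_eq_0 norm_axis_1 simp flip: scaleR_left_diff_distrib\<close>)
      from eq[OF this] have "signed_integral (cutoff C k) (\<lambda>A. \<mu> A $ i) = signed_integral (cutoff C k) (\<lambda>A. \<mu>' A $ i)" for k
        by (simp add: vector_integral_axis)
      with signed_integral_cutoff_tendsto[OF fvm_component[OF 1] C False, of i]
        signed_integral_cutoff_tendsto[OF fvm_component[OF 2] C False, of i]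
      show "\<mu> C $ i = \<mu>' C $ i" using LIMSEQ_unique by simp
    qed
  qed (simp add: fvm_empty 1 2)
qed

lemma frac_grad_eqI:
  assumes "finite_vector_measure \<mu>"
    and "\<And>\<phi>. \<phi> \<in> Lip_c \<Longrightarrow> (LINT x|lebesgue. f x * frac_div \<alpha> \<phi> x) = - vector_integral \<phi> \<mu>"
  shows "frac_grad \<alpha> f = \<mu>"
  unfolding frac_grad_def
proof (rule the_equality)
  fix \<mu>' assume *: "finite_vector_measure \<mu>' \<and>
    (\<forall>\<phi>\<in>Lip_c. (LINT x|lebesgue. f x * frac_div \<alpha> \<phi> x) = - vector_integral \<phi> \<mu>')"
  show "\<mu>' = \<mu>"
    using * assms by (intro fvm_eqI_vector_integral) auto
qed (use assms in auto)

section \<open>Vector measures with an integrable density\<close>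

definition density_vm :: "('a::euclidean_space \<Rightarrow> 'b::euclidean_space) \<Rightarrow> 'a set \<Rightarrow> 'b" where
  "density_vm F A = (if A \<in> sets borel then \<integral>x. indicator A x *\<^sub>R F x \<partial>lborel else 0)"

lemma fvm_density_vm:
  assumes F: "integrable lborel F"
  shows "finite_vector_measure (density_vm F)"
  unfolding finite_vector_measure_def
proof (intro conjI allI impI)
  fix E :: "nat \<Rightarrow> 'a set"
  assume E: "range E \<subseteq> sets borel" "disjoint_family E"
  have [measurable]: "F \<in> borel_measurable borel" "E i \<in> sets borel" for i using F E by auto
  have intE: "integrable lborel (\<lambda>x. indicator A x *\<^sub>R F x)" if "A \<in> sets borel" for A
    using that F by (intro integrable_mult_indicator) auto
  have s: "(\<Sum>i<n. indicator (E i) x *\<^sub>R F x) = indicator (\<Union>i<n. E i) x *\<^sub>R F x" for n x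
  proof -
    have "indicat_real (\<Union>i<n. E i) x = (\<Sum>i<n. indicator (E i) x)"
      using E(2) by (intro indicator_UN_disjoint) (auto simp: disjoint_family_on_def)
    thus ?thesis by (simp add: scaleR_left.sum)
  qed
  have "(\<lambda>n. \<integral>x. (\<Sum>i<n. indicator (E i) x *\<^sub>R F x) \<partial>lborel) \<longlonglongrightarrow> (\<integral>x. indicator (\<Union>i. E i) x *\<^sub>R F x \<partial>lborel)"
  proof (rule integral_dominated_convergence[where w="\<lambda>x. norm (F x)"])
    show "AE x in lborel. (\<lambda>n. \<Sum>i<n. indicator (E i) x *\<^sub>R F x) \<longlonglongrightarrow> indicator (\<Union>i. E i) x *\<^sub>R F x"
      unfolding s by (intro always_eventually allI tendsto_scaleR LIMSEQ_indicator_UN tendsto_const)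
    show "AE x in lborel. norm (\<Sum>i<n. indicator (E i) x *\<^sub>R F x) \<le> norm (F x)" for n
      unfolding s by (intro always_eventually allI) (auto simp: indicator_def)
    show "(\<lambda>x. \<Sum>i<n. indicator (E i) x *\<^sub>R F x) \<in> borel_measurable lborel" for n
      by measurable
    show "(\<lambda>x. indicator (\<Union>i. E i) x *\<^sub>R F x) \<in> borel_measurable lborel"
      by measurable
    show "integrable lborel (\<lambda>x. norm (F x))" using F by simp
  qed
  also have "(\<lambda>n. \<integral>x. (\<Sum>i<n. indicator (E i) x *\<^sub>R F x) \<partial>lborel) = (\<lambda>n. \<Sum>i<n. \<integral>x. indicator (E i) x *\<^sub>R F x \<partial>lborel)"
    by (intro ext Bochner_Integration.integral_sum intE) measurable
  finally show "(\<lambda>i. density_vm F (E i)) sums density_vm F (\<Union>i. E i)"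
    unfolding sums_def density_vm_def by (simp add: countable_Un_Int)
qed (simp add: density_vm_def)

text \<open>The positive and negative parts of the component \<open>F x $ i\<close> are densities of
  two finite measures with the right difference. By \<open>signed_integral_eq\<close> they may
  replace the Jordan parts, which therefore need not be identified.\<close>

lemma vector_integral_density_vm:
  fixes F :: "real ^ 'n \<Rightarrow> real ^ 'n"
  assumes F: "integrable lborel F" and \<phi>: "\<phi> \<in> borel_measurable borel" "\<And>x. norm (\<phi> x) \<le> B"
  shows "vector_integral \<phi> (density_vm F) = (\<integral>x. \<phi> x \<bullet> F x \<partial>lborel)"
proof -
  have [measurable]: "F \<in> borel_measurable borel" using F by auto
  note [measurable] = \<phi>(1)
  have Fi: "integrable lborel (\<lambda>x. F x $ i)" for i
    using F by (rule integrable_bounded_linear[OF bounded_linear_vec_nth])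
  have [measurable]: "(\<lambda>x. \<phi> x $ i) \<in> borel_measurable borel" for i
    using measurable_compose[OF \<phi>(1) borel_measurable_continuous_onI[OF continuous_on_component[OF continuous_on_id]]]
    by simp
  have \<phi>i: "\<bar>\<phi> x $ i\<bar> \<le> B" for x i using \<phi>(2)[of x] component_le_norm_cart[of "\<phi> x" i] by linarith
  have B: "B \<ge> 0" using \<phi>(2)[of 0] norm_ge_zero order_trans by blast
  have int: "integrable lborel (\<lambda>x. g x * k x)" if [measurable]: "g \<in> borel_measurable borel" and g: "\<And>x. \<bar>g x\<bar> \<le> B"
      and k: "integrable lborel k" for g k :: "real ^ 'n \<Rightarrow> real"
  proof (rule Bochner_Integration.integrable_bound)
    show "integrable lborel (\<lambda>x. B * k x)" using k by simp
    show "(\<lambda>x. g x * k x) \<in> borel_measurable lborel" using k by measurable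
    show "AE x in lborel. norm (g x * k x) \<le> norm (B * k x)"
      using g B by (auto simp: abs_mult intro!: mult_right_mono)
  qed
  have "signed_integral (\<lambda>x. \<phi> x $ i) (\<lambda>A. density_vm F A $ i) = (\<integral>x. \<phi> x $ i * F x $ i \<partial>lborel)" for i
  proof -
    define p n where "p = (\<lambda>x. max 0 (F x $ i))" and "n = (\<lambda>x. max 0 (- F x $ i))"
    have pi: "integrable lborel p" and ni: "integrable lborel n"
      unfolding p_def n_def using Fi by (auto intro!: Bochner_Integration.integrable_bound[OF Fi[of i]])
    have [measurable]: "p \<in> borel_measurable borel" "n \<in> borel_measurable borel" using pi ni by auto
    have p0: "p x \<ge> 0" "n x \<ge> 0" for x by (auto simp: p_def n_def)
    have Fpn: "F x $ i = p x - n x" for x by (auto simp: p_def n_def)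
    have fm: "finite_measure (density lborel (\<lambda>x. ennreal (k x)))" if "integrable lborel k" "\<And>x. k x \<ge> 0" for k :: "real ^ 'n \<Rightarrow> real"
      using that by (intro finite_measureI) (simp add: emeasure_density nn_integral_eq_integral)
    have m: "measure (density lborel (\<lambda>x. ennreal (k x))) A = (\<integral>x. indicator A x * k x \<partial>lborel)"
      if k: "integrable lborel k" "\<And>x. k x \<ge> 0" and A: "A \<in> sets borel" for k :: "real ^ 'n \<Rightarrow> real" and A
    proof -
      have "integrable lborel (\<lambda>x. indicator A x * k x)"
        using integrable_mult_indicator[of A lborel k] k A by simp
      hence "(\<integral>\<^sup>+x. ennreal (indicator A x * k x) \<partial>lborel) = ennreal (\<integral>x. indicator A x * k x \<partial>lborel)"
        using k by (intro nn_integral_eq_integral) auto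
      moreover have "emeasure (density lborel (\<lambda>x. ennreal (k x))) A = (\<integral>\<^sup>+x. ennreal (indicator A x * k x) \<partial>lborel)"
        using k A by (subst emeasure_density) (auto intro!: nn_integral_cong simp: indicator_def)
      ultimately show ?thesis using k by (simp add: measure_def integral_nonneg_AE)
    qed
    have "signed_integral (\<lambda>x. \<phi> x $ i) (\<lambda>A. density_vm F A $ i)
       = (\<integral>x. \<phi> x $ i \<partial>density lborel (\<lambda>x. ennreal (p x))) - (\<integral>x. \<phi> x $ i \<partial>density lborel (\<lambda>x. ennreal (n x)))"
    proof (rule signed_integral_eq[where B=B])
      fix A :: "(real ^ 'n) set" assume A: "A \<in> sets borel"
      have "integrable lborel (\<lambda>x. indicator A x *\<^sub>R F x)"
        using A F by (intro integrable_mult_indicator) auto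
      hence "density_vm F A $ i = (\<integral>x. (indicator A x *\<^sub>R F x) $ i \<partial>lborel)"
        using A by (simp add: density_vm_def integral_bounded_linear[OF bounded_linear_vec_nth, symmetric])
      also have "\<dots> = (\<integral>x. indicator A x * p x - indicator A x * n x \<partial>lborel)"
        by (simp add: Fpn algebra_simps)
      also have "\<dots> = (\<integral>x. indicator A x * p x \<partial>lborel) - (\<integral>x. indicator A x * n x \<partial>lborel)"
        using integrable_mult_indicator[of A lborel p] integrable_mult_indicator[of A lborel n] A pi ni
        by (intro Bochner_Integration.integral_diff) auto
      finally show "density_vm F A $ i = measure (density lborel (\<lambda>x. ennreal (p x))) A - measure (density lborel (\<lambda>x. ennreal (n x))) A"
        using A by (simp add: m pi ni p0)
    qed (use fm pi ni p0 \<phi>i fvm_component[OF fvm_density_vm[OF F]] in auto)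
    also have "\<dots> = (\<integral>x. \<phi> x $ i * p x \<partial>lborel) - (\<integral>x. \<phi> x $ i * n x \<partial>lborel)"
      by (simp add: integral_density p0 mult.commute)
    also have "\<dots> = (\<integral>x. \<phi> x $ i * p x - \<phi> x $ i * n x \<partial>lborel)"
      using pi ni \<phi>i by (intro Bochner_Integration.integral_diff[symmetric] int) auto
    finally show ?thesis by (simp add: Fpn algebra_simps)
  qed
  hence "vector_integral \<phi> (density_vm F) = (\<Sum>i\<in>UNIV. (\<integral>x. \<phi> x $ i * F x $ i \<partial>lborel))"
    by (simp add: vector_integral_def)
  also have "\<dots> = (\<integral>x. (\<Sum>i\<in>UNIV. \<phi> x $ i * F x $ i) \<partial>lborel)"
    using \<phi>i Fi by (intro Bochner_Integration.integral_sum[symmetric] int) auto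
  finally show ?thesis by (simp add: inner_vec_def)
qed

lemma measure_supp_density_vm_subset:
  fixes F :: "real ^ 'n \<Rightarrow> real ^ 'n"
  assumes "closed K" "\<And>x. x \<notin> K \<Longrightarrow> F x = 0"
  shows "measure_supp (total_variation (density_vm F)) \<subseteq> K"
proof
  fix x assume x: "x \<in> measure_supp (total_variation (density_vm F))"
  show "x \<in> K"
  proof (rule ccontr)
    assume "x \<notin> K"
    have "density_vm F A = 0" if "A \<subseteq> - K" for A
    proof -
      have "(\<lambda>y. indicator A y *\<^sub>R F y) = (\<lambda>y. 0)" using that assms(2) by (auto simp: indicator_def fun_eq_iff)
      thus ?thesis by (simp add: density_vm_def del: scaleR_eq_0_iff)
    qed
    note zero = this
    have "variation (density_vm F) (- K) \<le> 0"
      unfolding variation_def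
    proof (intro SUP_least)
      fix E :: "nat \<Rightarrow> (real ^ 'n) set"
      assume "E \<in> {E. range E \<subseteq> sets borel \<and> disjoint_family E \<and> (\<Union>i. E i) = - K}"
      hence "E i \<subseteq> - K" for i by blast
      hence "density_vm F (E i) = 0" for i by (rule zero)
      thus "(\<Sum>i. ennreal (norm (density_vm F (E i)))) \<le> 0" by simp
    qed
    \<comment> \<open>Both possible values of \<open>emeasure\<close> on a \<open>measure_of\<close>
      are 0 here: the variation itself, or the default 0 in case the set function is not a
      measure.\<close>
    hence "emeasure (total_variation (density_vm F)) (- K) = 0"
      by (simp add: total_variation_def emeasure_measure_of_conv)
    moreover have "open (- K)" using assms(1) by auto
    ultimately show False using x \<open>x \<notin> K\<close> unfolding measure_supp_def by force
  qed
qed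

lemma density_eq_0_outside_supp:
  fixes F :: "real ^ 'n \<Rightarrow> real ^ 'n"
  assumes F: "integrable lborel F" "continuous_on UNIV F"
    and x: "x \<notin> measure_supp (total_variation (density_vm F))"
  shows "F x = 0"
proof (rule ccontr)
  assume nz: "F x \<noteq> 0"
  let ?\<mu> = "density_vm F"
  have fvm: "finite_vector_measure ?\<mu>" by (rule fvm_density_vm[OF F(1)])
  obtain U where U: "open U" "x \<in> U" "emeasure (total_variation ?\<mu>) U = 0"
    using x unfolding measure_supp_def by (auto simp: not_gr_zero)
  have zero: "?\<mu> A = 0" if "A \<in> sets borel" "A \<subseteq> U" for A
  proof -
    have Ub: "U \<in> sets borel" using U by simp
    have "ennreal (norm (?\<mu> A)) \<le> variation ?\<mu> A" by (rule norm_le_variation[OF fvm that(1)])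
    also have "\<dots> \<le> variation ?\<mu> U" by (rule variation_mono[OF fvm that(1) Ub that(2)])
    also have "\<dots> = 0" using U(3) by (simp add: emeasure_total_variation[OF fvm Ub])
    finally show ?thesis by simp
  qed
  \<comment> \<open>Restricting to points where \<open>F\<close> has positive component along
    \<open>F x\<close> excludes cancellation: the measure of \<open>V\<close> is 0 and its component
    along \<open>F x\<close> is the integral of a positive function over \<open>V\<close>, so the
    open set \<open>V\<close> would be null.\<close>
  define V where "V = U \<inter> {y. F y \<bullet> F x > 0}"
  have op: "open {y. F y \<bullet> F x > 0}"
    by (intro open_Collect_less continuous_intros F(2))
  have V: "open V" "x \<in> V" using U op nz by (auto simp: V_def)
  have Vb: "V \<in> sets borel" using V by simp
  have int: "integrable lborel (\<lambda>y. indicator V y *\<^sub>R F y)"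
    using F(1) Vb by (intro integrable_mult_indicator) auto
  have int': "integrable lborel (\<lambda>y. (indicator V y *\<^sub>R F y) \<bullet> F x)"
    by (rule integrable_inner_left) (rule int)
  have "(\<integral>y. (indicator V y *\<^sub>R F y) \<bullet> F x \<partial>lborel) = ?\<mu> V \<bullet> F x"
    using int Vb by (simp add: density_vm_def del: inner_scaleR_left)
  also have "\<dots> = 0" using zero[OF Vb] by (simp add: V_def)
  finally have "(\<integral>y. (indicator V y *\<^sub>R F y) \<bullet> F x \<partial>lborel) = 0" .
  hence "AE y in lborel. (indicator V y *\<^sub>R F y) \<bullet> F x = 0"
    using integral_nonneg_eq_0_iff_AE[OF int'] by (auto simp: V_def indicator_def)
  hence "AE y in lborel. y \<notin> V" by eventually_elim (auto simp: V_def indicator_def split: if_splits)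
  hence "emeasure lborel V = 0"
    using AE_iff_measurable[of V lborel "\<lambda>y. y \<notin> V"] Vb by auto
  hence "V \<in> null_sets lebesgue" using Vb by (intro null_sets_completionI) auto
  hence "negligible V" by (simp add: negligible_iff_null_sets)
  thus False using open_not_negligible[OF V(1)] V(2) by blast
qed

section \<open>The fractional gradient\<close>

lemma integrable_pair_lborelI:
  fixes f :: "'a::euclidean_space \<Rightarrow> 'b::euclidean_space \<Rightarrow> 'c::{banach, second_countable_topology}"
  assumes [measurable]: "case_prod f \<in> borel_measurable (borel \<Otimes>\<^sub>M borel)"
    and f: "\<And>z. integrable lborel (f z)"
    and g: "integrable lborel g" "\<And>z. (\<integral>x. norm (f z x) \<partial>lborel) \<le> g z"
  shows "integrable (lborel \<Otimes>\<^sub>M lborel) (case_prod f)"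
proof (rule lborel_pair.Fubini_integrable)
  have nn: "(\<integral>x. norm (f z x) \<partial>lborel) \<ge> 0" for z by (intro integral_nonneg_AE) auto
  show "integrable lborel (\<lambda>z. \<integral>x. norm (case (z, x) of (z, x) \<Rightarrow> f z x) \<partial>lborel)"
    using g nn by (intro Bochner_Integration.integrable_bound[OF g(1)]) (auto intro: order_trans[OF _ abs_ge_self])
qed (use f in auto)

text \<open>Away from 0 and up to the factor - (n + \<alpha> - 1), this is the gradient of |z| ^ (-
  (n + \<alpha> - 1)), the kernel of the Riesz potential of order 1 - \<alpha>. It is not integrable
  at 0, so it only ever acts on increments.\<close>

definition riesz_kernel :: "real \<Rightarrow> 'a::euclidean_space \<Rightarrow> 'a" where
  "riesz_kernel \<alpha> z = norm z powr - (real DIM('a) + \<alpha> + 1) *\<^sub>R z"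

lemma riesz_kernel_measurable [measurable]: "riesz_kernel \<alpha> \<in> borel_measurable borel"
  unfolding riesz_kernel_def by measurable

lemma norm_riesz_kernel:
  "norm (riesz_kernel \<alpha> z) = norm z powr - (real DIM('a) + \<alpha>)" for z :: "'a::euclidean_space"
proof (cases "z = 0")
  case False
  have "norm z powr - (real DIM('a) + \<alpha> + 1) * norm z = norm z powr (- (real DIM('a) + \<alpha> + 1) + 1)"
    unfolding powr_add using False by simp
  also have "\<dots> = norm z powr - (real DIM('a) + \<alpha>)" by simp
  finally show ?thesis by (simp add: riesz_kernel_def)
qed (simp add: riesz_kernel_def)

lemma riesz_kernel_uminus [simp]: "riesz_kernel \<alpha> (- z) = - riesz_kernel \<alpha> z"
  by (simp add: riesz_kernel_def)

text \<open>The fractional gradient without its normalising factor \<open>frac_const\<close>, which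
  returns in \<open>frac_grad_eq_density\<close>.\<close>

definition frac_nabla :: "real \<Rightarrow> ('a::euclidean_space \<Rightarrow> real) \<Rightarrow> 'a \<Rightarrow> 'a" where
  "frac_nabla \<alpha> f x = (\<integral>z. (f (x + z) - f x) *\<^sub>R riesz_kernel \<alpha> z \<partial>lborel)"

text \<open>
  The bound on the mean increments puts these functions into \<open>W\<^sup>\<alpha>\<^sup>,\<^sup>1\<close> for all \<open>\<alpha> \<in> (0,1)\<close>,
  and the class is stable under composition with Lipschitz functions fixing \<open>0\<close>.
\<close>

definition lipschitz_L1 :: "('a::euclidean_space \<Rightarrow> real) \<Rightarrow> real \<Rightarrow> bool" where
  "lipschitz_L1 f B \<longleftrightarrow> integrable lborel f \<and> (\<forall>x. \<bar>f x\<bar> \<le> B) \<and>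
     (\<forall>x y. \<bar>f x - f y\<bar> \<le> B * norm (x - y)) \<and>
     (\<forall>z. (\<integral>x. \<bar>f (x + z) - f x\<bar> \<partial>lborel) \<le> B * min 1 (norm z))"

lemma lipschitz_L1D:
  assumes "lipschitz_L1 f B"
  shows "integrable lborel f" "\<bar>f x\<bar> \<le> B" "\<bar>f x - f y\<bar> \<le> B * norm (x - y)"
    "(\<integral>x. \<bar>f (x + z) - f x\<bar> \<partial>lborel) \<le> B * min 1 (norm z)" "B \<ge> 0"
    "f \<in> borel_measurable borel" "continuous_on UNIV f"
    "integrable lborel (\<lambda>x. f (x + z) - f x)"
    "\<bar>f (x + z) - f x\<bar> \<le> 2 * B * min 1 (norm z)"
proof -
  show 1: "integrable lborel f" and 2: "\<And>x. \<bar>f x\<bar> \<le> B" and 3: "\<And>x y. \<bar>f x - f y\<bar> \<le> B * norm (x - y)"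
    and "(\<integral>x. \<bar>f (x + z) - f x\<bar> \<partial>lborel) \<le> B * min 1 (norm z)"
    using assms by (auto simp: lipschitz_L1_def)
  show 4: "B \<ge> 0" using 2[of 0] by linarith
  show "f \<in> borel_measurable borel" using 1 by auto
  have "B-lipschitz_on UNIV f" using 3 4 by (intro lipschitz_onI) (auto simp: dist_norm)
  thus "continuous_on UNIV f" by (rule lipschitz_on_continuous_on)
  show "integrable lborel (\<lambda>x. f (x + z) - f x)"
    using integrable_lborel_translate[OF 1, of z] 1 by (simp add: add.commute)
  have "\<bar>f (x + z) - f x\<bar> \<le> B * norm z" using 3[of "x + z" x] by simp
  moreover have "\<bar>f (x + z) - f x\<bar> \<le> 2 * B" using 2[of "x + z"] 2[of x] by linarith
  moreover have "0 \<le> B * norm z" using 4 by simp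
  ultimately show "\<bar>f (x + z) - f x\<bar> \<le> 2 * B * min 1 (norm z)" by (auto simp: min_def mult.assoc)
qed

lemma lipschitz_L1_compose:
  assumes f: "lipschitz_L1 f B" and \<Phi>: "\<And>s t. \<bar>\<Phi> s - \<Phi> t\<bar> \<le> L * \<bar>s - t\<bar>" "\<Phi> 0 = 0"
  shows "lipschitz_L1 (\<Phi> \<circ> f) (L * B)"
proof -
  note F = lipschitz_L1D[OF f]
  have L: "L \<ge> 0" using order_trans[OF abs_ge_zero \<Phi>(1)[of 0 1]] by simp
  have \<Phi>0: "\<bar>\<Phi> t\<bar> \<le> L * \<bar>t\<bar>" for t using \<Phi>(1)[of t 0] \<Phi>(2) by simp
  have "L-lipschitz_on UNIV \<Phi>" using \<Phi>(1) L by (intro lipschitz_onI) (auto simp: dist_real_def)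
  hence "continuous_on UNIV \<Phi>" by (rule lipschitz_on_continuous_on)
  hence [measurable]: "\<Phi> \<in> borel_measurable borel" by (rule borel_measurable_continuous_onI)
  have [measurable]: "f \<in> borel_measurable borel" by (rule F)
  show ?thesis unfolding lipschitz_L1_def comp_def
  proof (intro conjI allI)
    show "integrable lborel (\<lambda>x. \<Phi> (f x))"
    proof (rule Bochner_Integration.integrable_bound)
      show "integrable lborel (\<lambda>x. L * f x)" using F(1) by simp
      show "AE x in lborel. norm (\<Phi> (f x)) \<le> norm (L * f x)"
        using \<Phi>0 L by (auto simp: abs_mult)
    qed measurable
    fix x y z
    show "\<bar>\<Phi> (f x)\<bar> \<le> L * B" using \<Phi>0[of "f x"] mult_left_mono[OF F(2)[of x] L] by linarith
    show "\<bar>\<Phi> (f x) - \<Phi> (f y)\<bar> \<le> L * B * norm (x - y)"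
      using \<Phi>(1)[of "f x" "f y"] mult_left_mono[OF F(3)[of x y] L] by (simp add: mult.assoc)
    have i1: "integrable lborel (\<lambda>x. L * \<bar>f (x + z) - f x\<bar>)" using F(8)[of z] by simp
    have i2: "integrable lborel (\<lambda>x. \<Phi> (f (x + z)) - \<Phi> (f x))"
      by (rule Bochner_Integration.integrable_bound[OF i1])
         (use \<Phi>(1) L in \<open>auto simp: abs_mult\<close>)
    have "(\<integral>x. \<bar>\<Phi> (f (x + z)) - \<Phi> (f x)\<bar> \<partial>lborel) \<le> (\<integral>x. L * \<bar>f (x + z) - f x\<bar> \<partial>lborel)"
      using i1 i2 \<Phi>(1) by (intro integral_mono integrable_abs) auto
    also have "\<dots> = L * (\<integral>x. \<bar>f (x + z) - f x\<bar> \<partial>lborel)" by simp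
    also have "\<dots> \<le> L * (B * min 1 (norm z))" by (intro mult_left_mono F(4) L)
    finally show "(\<integral>x. \<bar>\<Phi> (f (x + z)) - \<Phi> (f x)\<bar> \<partial>lborel) \<le> L * B * min 1 (norm z)" by (simp add: mult.assoc)
  qed
qed

lemma trunc_kernel_eq: "min 1 (norm z) * norm (riesz_kernel \<alpha> z) = trunc_kernel \<alpha> z"
  by (simp add: norm_riesz_kernel trunc_kernel_def)

lemma norm_increment_riesz_kernel:
  assumes "\<bar>s\<bar> \<le> C * min 1 (norm z)"
  shows "norm (s *\<^sub>R riesz_kernel \<alpha> z) \<le> C * trunc_kernel \<alpha> z"
  using mult_right_mono[OF assms norm_ge_zero[of "riesz_kernel \<alpha> z"]]
  by (simp add: mult.assoc trunc_kernel_eq)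

lemma integrable_frac_nabla_integrand:
  fixes f :: "'a::euclidean_space \<Rightarrow> real"
  assumes f: "lipschitz_L1 f B" and \<alpha>: "0 < \<alpha>" "\<alpha> < 1"
  shows "integrable lborel (\<lambda>z. (f (x + z) - f x) *\<^sub>R riesz_kernel \<alpha> z)"
proof (rule Bochner_Integration.integrable_bound)
  have [measurable]: "f \<in> borel_measurable borel" by (rule lipschitz_L1D[OF f])
  show "integrable lborel (\<lambda>z::'a. 2 * B * trunc_kernel \<alpha> z)"
    using integrable_trunc_kernel[OF \<alpha>] by (intro integrable_mult_right)
  show "(\<lambda>z. (f (x + z) - f x) *\<^sub>R riesz_kernel \<alpha> z) \<in> borel_measurable lborel" by measurable
  show "AE z in lborel. norm ((f (x + z) - f x) *\<^sub>R riesz_kernel \<alpha> z) \<le> norm (2 * B * trunc_kernel \<alpha> z)"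
    using norm_increment_riesz_kernel[OF lipschitz_L1D(9)[OF f], where \<alpha>=\<alpha>]
    by (intro always_eventually allI) (auto intro: order_trans[OF _ abs_ge_self])
qed

lemma continuous_on_frac_nabla:
  fixes f :: "'a::euclidean_space \<Rightarrow> real"
  assumes f: "lipschitz_L1 f B" and \<alpha>: "0 < \<alpha>" "\<alpha> < 1"
  shows "continuous_on UNIV (frac_nabla \<alpha> f)"
proof (rule continuous_on_sequentiallyI)
  have [measurable]: "f \<in> borel_measurable borel" by (rule lipschitz_L1D[OF f])
  have cont: "continuous_on UNIV f" by (rule lipschitz_L1D[OF f])
  fix u :: "nat \<Rightarrow> 'a" and a assume u: "u \<longlonglongrightarrow> a"
  show "(\<lambda>n. frac_nabla \<alpha> f (u n)) \<longlonglongrightarrow> frac_nabla \<alpha> f a"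
    unfolding frac_nabla_def
  proof (rule integral_dominated_convergence[where w="\<lambda>z. 2 * B * trunc_kernel \<alpha> z"])
    show "integrable lborel (\<lambda>z::'a. 2 * B * trunc_kernel \<alpha> z)"
      using integrable_trunc_kernel[OF \<alpha>] by (intro integrable_mult_right)
    show "AE z in lborel. norm ((f (u n + z) - f (u n)) *\<^sub>R riesz_kernel \<alpha> z) \<le> 2 * B * trunc_kernel \<alpha> z" for n
      using norm_increment_riesz_kernel[OF lipschitz_L1D(9)[OF f], where \<alpha>=\<alpha>] by blast
    show "AE z in lborel. (\<lambda>n. (f (u n + z) - f (u n)) *\<^sub>R riesz_kernel \<alpha> z) \<longlonglongrightarrow> (f (a + z) - f a) *\<^sub>R riesz_kernel \<alpha> z"
      by (intro always_eventually allI tendsto_intros u continuous_on_tendsto_compose[OF cont]) auto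
  qed measurable
qed

text \<open>Integration over x comes first: the mean increment of \<open>f\<close> supplies the
  factor min 1 |z| that turns the kernel into \<open>trunc_kernel\<close>. The function \<psi>
  stands for the kernel itself or for its inner product with a bounded field.\<close>

lemma integrable_pair_increment:
  fixes f :: "'a::euclidean_space \<Rightarrow> real" and \<psi> :: "'a \<Rightarrow> 'a \<Rightarrow> 'b::{banach, second_countable_topology}"
  assumes f: "lipschitz_L1 f B" and \<alpha>: "0 < \<alpha>" "\<alpha> < 1"
    and \<psi>: "case_prod \<psi> \<in> borel_measurable (borel \<Otimes>\<^sub>M borel)"
    and P: "\<And>z x. norm (\<psi> z x) \<le> P * norm (riesz_kernel \<alpha> z)" "P \<ge> 0"
  shows "integrable (lborel \<Otimes>\<^sub>M lborel) (\<lambda>(z, x). (f (x + z) - f x) *\<^sub>R \<psi> z x)"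
proof (rule integrable_pair_lborelI)
  have [measurable]: "f \<in> borel_measurable borel" by (rule lipschitz_L1D[OF f])
  have \<psi>1: "(\<lambda>x. \<psi> z x) \<in> borel_measurable borel" for z
    using measurable_Pair2[OF \<psi>, of z] by simp
  have \<psi>2: "(\<lambda>p. \<psi> (fst p) (snd p)) \<in> borel_measurable (borel \<Otimes>\<^sub>M borel)"
    using \<psi> by (simp add: case_prod_beta')
  show "(\<lambda>(z, x). (f (x + z) - f x) *\<^sub>R \<psi> z x) \<in> borel_measurable (borel \<Otimes>\<^sub>M borel)"
    unfolding case_prod_beta' by (intro borel_measurable_scaleR \<psi>2) measurable
  fix z :: 'a
  let ?K = "norm (riesz_kernel \<alpha> z)"
  have i: "integrable lborel (\<lambda>x. (P * ?K) * (f (x + z) - f x))"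
    by (intro integrable_mult_right lipschitz_L1D(8)[OF f])
  have b: "norm ((f (x + z) - f x) *\<^sub>R \<psi> z x) \<le> P * ?K * \<bar>f (x + z) - f x\<bar>" for x
    using mult_left_mono[OF P(1)[of z x] abs_ge_zero[of "f (x + z) - f x"]] by (simp add: mult_ac)
  show i2: "integrable lborel (\<lambda>x. (f (x + z) - f x) *\<^sub>R \<psi> z x)"
  proof (rule Bochner_Integration.integrable_bound[OF i])
    show "(\<lambda>x. (f (x + z) - f x) *\<^sub>R \<psi> z x) \<in> borel_measurable lborel"
      using \<psi>1[of z] by (intro borel_measurable_scaleR) simp_all
    show "AE x in lborel. norm ((f (x + z) - f x) *\<^sub>R \<psi> z x) \<le> norm ((P * ?K) * (f (x + z) - f x))"
      using b P(2) by (intro always_eventually allI) (simp add: abs_mult)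
  qed
  have "(\<integral>x. norm ((f (x + z) - f x) *\<^sub>R \<psi> z x) \<partial>lborel) \<le> (\<integral>x. P * ?K * \<bar>f (x + z) - f x\<bar> \<partial>lborel)"
    using i2 lipschitz_L1D(8)[OF f, of z] b
    by (intro integral_mono integrable_norm integrable_mult_right integrable_abs) auto
  also have "\<dots> = P * ?K * (\<integral>x. \<bar>f (x + z) - f x\<bar> \<partial>lborel)" by simp
  also have "\<dots> \<le> P * ?K * (B * min 1 (norm z))"
    using P(2) by (intro mult_left_mono lipschitz_L1D(4)[OF f]) auto
  also have "\<dots> = P * B * trunc_kernel \<alpha> z" by (simp flip: trunc_kernel_eq)
  finally show "(\<integral>x. norm ((f (x + z) - f x) *\<^sub>R \<psi> z x) \<partial>lborel) \<le> P * B * trunc_kernel \<alpha> z" .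
next
  show "integrable lborel (\<lambda>z::'a. P * B * trunc_kernel \<alpha> z)"
    using integrable_trunc_kernel[OF \<alpha>] by (intro integrable_mult_right)
qed

lemma integrable_frac_nabla:
  fixes f :: "'a::euclidean_space \<Rightarrow> real"
  assumes f: "lipschitz_L1 f B" and \<alpha>: "0 < \<alpha>" "\<alpha> < 1"
  shows "integrable lborel (frac_nabla \<alpha> f)"
proof -
  have "integrable (lborel \<Otimes>\<^sub>M lborel) (\<lambda>(z, x). (f (x + z) - f x) *\<^sub>R riesz_kernel \<alpha> z)"
    by (rule integrable_pair_increment[OF f \<alpha>, where P=1]) auto
  from lborel_pair.integrable_snd[OF this] show ?thesis
    unfolding frac_nabla_def[abs_def] .
qed

text \<open>
  With \<open>\<Delta>h = h (x + z) - h x\<close> the product rule reads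
  \<open>f \<Delta>\<phi> + \<Delta>f \<phi> = \<Delta>(f \<phi>) - \<Delta>f \<Delta>\<phi>\<close>.  Integrated against the kernel over all \<open>(z, x)\<close>,
  the first term on the right vanishes by translation invariance and the second
  one because exchanging the two points \<open>x\<close> and \<open>x + z\<close> changes its sign.
\<close>

lemma frac_nabla_duality:
  fixes f :: "'a::euclidean_space \<Rightarrow> real" and \<phi> :: "'a \<Rightarrow> 'a"
  assumes f: "lipschitz_L1 f B" and \<alpha>: "0 < \<alpha>" "\<alpha> < 1"
    and \<phi>: "\<And>x. norm (\<phi> x) \<le> P" "\<And>x y. norm (\<phi> x - \<phi> y) \<le> P * norm (x - y)"
  shows "(\<integral>x. f x * (\<integral>z. riesz_kernel \<alpha> z \<bullet> (\<phi> (x + z) - \<phi> x) \<partial>lborel) \<partial>lborel)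
       = - (\<integral>x. \<phi> x \<bullet> frac_nabla \<alpha> f x \<partial>lborel)"
proof -
  define K where "K = (riesz_kernel \<alpha> :: 'a \<Rightarrow> 'a)"
  define a where "a = (\<lambda>z x. f x * (K z \<bullet> (\<phi> (x + z) - \<phi> x)))"
  define b where "b = (\<lambda>z x. (f (x + z) - f x) *\<^sub>R (K z \<bullet> \<phi> x))"
  define d where "d = (\<lambda>z x. (f (x + z) - f x) *\<^sub>R (K z \<bullet> (\<phi> (x + z) - \<phi> x)))"
  have P: "P \<ge> 0" using \<phi>(1)[of 0] norm_ge_zero order_trans by blast
  have [measurable]: "f \<in> borel_measurable borel" by (rule lipschitz_L1D[OF f])
  have [measurable]: "K \<in> borel_measurable borel" by (simp add: K_def)
  have "P-lipschitz_on UNIV \<phi>" using \<phi>(2) P by (intro lipschitz_onI) (auto simp: dist_norm)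
  hence "continuous_on UNIV \<phi>" by (rule lipschitz_on_continuous_on)
  hence [measurable]: "\<phi> \<in> borel_measurable borel" by (rule borel_measurable_continuous_onI)
  have \<Delta>2: "norm (\<phi> (x + z) - \<phi> x) \<le> 2 * P" for x z
    using norm_triangle_ineq4[of "\<phi> (x + z)" "\<phi> x"] \<phi>(1)[of "x + z"] \<phi>(1)[of x] by linarith
  have \<Delta>: "norm (\<phi> (x + z) - \<phi> x) \<le> 2 * P * min 1 (norm z)" for x z
  proof -
    have "norm (\<phi> (x + z) - \<phi> x) \<le> P * norm z" using \<phi>(2)[of "x + z" x] by simp
    moreover have "0 \<le> P * norm z" using P by simp
    ultimately show ?thesis using \<Delta>2[of x z] by (simp add: min_def)
  qed
  have Kt: "min 1 (norm z) * norm (K z) = trunc_kernel \<alpha> z" for z by (simp add: K_def trunc_kernel_eq)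
  have ib: "integrable (lborel \<Otimes>\<^sub>M lborel) (case_prod b)"
    unfolding b_def
  proof (rule integrable_pair_increment[OF f \<alpha> _ _ P])
    show "norm (K z \<bullet> \<phi> x) \<le> P * norm (riesz_kernel \<alpha> z)" for z x
      using Cauchy_Schwarz_ineq2[of "K z" "\<phi> x"] mult_left_mono[OF \<phi>(1)[of x] norm_ge_zero[of "K z"]]
      by (simp add: K_def mult.commute)
  qed measurable
  have id: "integrable (lborel \<Otimes>\<^sub>M lborel) (case_prod d)"
    unfolding d_def
  proof (rule integrable_pair_increment[OF f \<alpha>, where P="2 * P"])
    show "norm (K z \<bullet> (\<phi> (x + z) - \<phi> x)) \<le> 2 * P * norm (riesz_kernel \<alpha> z)" for z x
      using Cauchy_Schwarz_ineq2[of "K z" "\<phi> (x + z) - \<phi> x"] mult_left_mono[OF \<Delta>2[of x z] norm_ge_zero[of "K z"]]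
      by (simp add: K_def mult.commute)
    show "2 * P \<ge> 0" using P by simp
  qed measurable
  \<comment> \<open>Here the roles are exchanged: the increment of \<phi> tames the kernel, while
    \<open>f\<close> provides integrability in x.\<close>
  have ia: "integrable (lborel \<Otimes>\<^sub>M lborel) (case_prod a)"
  proof (rule integrable_pair_lborelI)
    show "case_prod a \<in> borel_measurable (borel \<Otimes>\<^sub>M borel)" unfolding a_def by measurable
    show "integrable lborel (\<lambda>z::'a. 2 * P * (\<integral>x. \<bar>f x\<bar> \<partial>lborel) * trunc_kernel \<alpha> z)"
      using integrable_trunc_kernel[OF \<alpha>] by (intro integrable_mult_right)
    fix z
    have C: "\<bar>K z \<bullet> (\<phi> (x + z) - \<phi> x)\<bar> \<le> 2 * P * trunc_kernel \<alpha> z" for x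
      using Cauchy_Schwarz_ineq2[of "K z" "\<phi> (x + z) - \<phi> x"] mult_left_mono[OF \<Delta>[of x z] norm_ge_zero[of "K z"]]
      by (simp add: mult_ac Kt[symmetric])
    have bd: "norm (a z x) \<le> 2 * P * trunc_kernel \<alpha> z * \<bar>f x\<bar>" for x
      using mult_right_mono[OF C[of x] abs_ge_zero[of "f x"]] by (simp add: a_def abs_mult mult_ac)
    have i: "integrable lborel (\<lambda>x. 2 * P * trunc_kernel \<alpha> z * \<bar>f x\<bar>)"
      by (intro integrable_mult_right integrable_abs lipschitz_L1D(1)[OF f])
    show i2: "integrable lborel (a z)"
      by (rule Bochner_Integration.integrable_bound[OF i])
         (use bd in \<open>auto simp: a_def intro: order_trans[OF _ abs_ge_self]\<close>)
    have "(\<integral>x. norm (a z x) \<partial>lborel) \<le> (\<integral>x. 2 * P * trunc_kernel \<alpha> z * \<bar>f x\<bar> \<partial>lborel)"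
      using i i2 bd by (intro integral_mono integrable_norm) auto
    thus "(\<integral>x. norm (a z x) \<partial>lborel) \<le> 2 * P * (\<integral>x. \<bar>f x\<bar> \<partial>lborel) * trunc_kernel \<alpha> z"
      by (simp add: mult_ac)
  qed
  define H where "H = (\<lambda>x. f x *\<^sub>R \<phi> x)"
  have H: "integrable lborel H"
  proof (rule Bochner_Integration.integrable_bound)
    show "integrable lborel (\<lambda>x. P * f x)" using lipschitz_L1D(1)[OF f] by simp
    show "AE x in lborel. norm (H x) \<le> norm (P * f x)"
    proof (intro always_eventually allI)
      fix x
      show "norm (H x) \<le> norm (P * f x)"
        using mult_right_mono[OF \<phi>(1)[of x] abs_ge_zero[of "f x"]] P
        by (simp add: H_def abs_mult mult.commute)
    qed
  qed (simp add: H_def)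
  have sum: "a z x + b z x + d z x = K z \<bullet> (H (x + z) - H x)" for z x
    by (simp add: a_def b_def d_def H_def algebra_simps inner_diff_right)
  have iH: "integrable (lborel \<Otimes>\<^sub>M lborel) (\<lambda>(z, x). K z \<bullet> (H (x + z) - H x))"
    using Bochner_Integration.integrable_add[OF Bochner_Integration.integrable_add[OF ia ib] id]
    by (simp add: case_prod_beta' sum)
  have zero1: "integral\<^sup>L (lborel \<Otimes>\<^sub>M lborel) (\<lambda>(z, x). K z \<bullet> (H (x + z) - H x)) = 0"
  proof -
    have "(\<integral>x. K z \<bullet> (H (x + z) - H x) \<partial>lborel) = 0" for z
    proof -
      have Hz: "integrable lborel (\<lambda>x. H (x + z))"
        using integrable_lborel_translate[OF H, of z] by (simp add: add.commute)
      have "(\<integral>x. K z \<bullet> (H (x + z) - H x) \<partial>lborel) = K z \<bullet> (\<integral>x. H (x + z) - H x \<partial>lborel)"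
        using H Hz by (intro integral_inner_right) auto
      also have "(\<integral>x. H (x + z) - H x \<partial>lborel) = (\<integral>x. H (x + z) \<partial>lborel) - (\<integral>x. H x \<partial>lborel)"
        using H Hz by (intro Bochner_Integration.integral_diff)
      also have "(\<integral>x. H (x + z) \<partial>lborel) = (\<integral>x. H x \<partial>lborel)"
        using integral_lborel_translate[of H z] H by (simp add: add.commute)
      finally show ?thesis by simp
    qed
    thus ?thesis using lborel_pair.integral_fst[OF iH] by simp
  qed
  have zero2: "integral\<^sup>L (lborel \<Otimes>\<^sub>M lborel) (case_prod d) = 0"
  proof -
    have [measurable]: "(\<lambda>x. d z x) \<in> borel_measurable borel" for z unfolding d_def by measurable
    have "(\<integral>x. d (- z) x \<partial>lborel) = - (\<integral>x. d z x \<partial>lborel)" for z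
    proof -
      have "(\<integral>x. d (- z) x \<partial>lborel) = (\<integral>x. d (- z) (z + x) \<partial>lborel)"
        by (intro integral_lborel_translate[symmetric]) measurable
      also have "(\<lambda>x. d (- z) (z + x)) = (\<lambda>x. - d z x)"
        by (auto simp: d_def K_def algebra_simps fun_eq_iff inner_diff_right)
      finally show ?thesis by simp
    qed
    moreover have "(\<lambda>z. \<integral>x. d z x \<partial>lborel) \<in> borel_measurable borel"
      using borel_measurable_integrable[OF lborel_pair.integrable_fst[OF id]] by simp
    ultimately have "(\<integral>z. (\<integral>x. d z x \<partial>lborel) \<partial>lborel) = 0"
      by (intro integral_lborel_odd)
    thus ?thesis using lborel_pair.integral_fst[OF id] by simp
  qed
  have "integral\<^sup>L (lborel \<Otimes>\<^sub>M lborel) (case_prod a) + integral\<^sup>L (lborel \<Otimes>\<^sub>M lborel) (case_prod b)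
      + integral\<^sup>L (lborel \<Otimes>\<^sub>M lborel) (case_prod d) = 0"
    unfolding zero1[symmetric] sum[symmetric]
    using ia ib id by (simp add: case_prod_beta')
  hence ab: "integral\<^sup>L (lborel \<Otimes>\<^sub>M lborel) (case_prod a) = - integral\<^sup>L (lborel \<Otimes>\<^sub>M lborel) (case_prod b)"
    using zero2 by simp
  have "(\<integral>x. f x * (\<integral>z. riesz_kernel \<alpha> z \<bullet> (\<phi> (x + z) - \<phi> x) \<partial>lborel) \<partial>lborel) = (\<integral>x. (\<integral>z. a z x \<partial>lborel) \<partial>lborel)"
    by (simp add: a_def K_def)
  also have "\<dots> = - (\<integral>x. (\<integral>z. b z x \<partial>lborel) \<partial>lborel)"
    using ab lborel_pair.integral_snd[OF ia] lborel_pair.integral_snd[OF ib] by simp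
  finally have main: "(\<integral>x. f x * (\<integral>z. riesz_kernel \<alpha> z \<bullet> (\<phi> (x + z) - \<phi> x) \<partial>lborel) \<partial>lborel)
    = - (\<integral>x. (\<integral>z. b z x \<partial>lborel) \<partial>lborel)" .
  have eq: "(\<integral>z. b z x \<partial>lborel) = \<phi> x \<bullet> frac_nabla \<alpha> f x" for x
  proof -
    have "b z x = \<phi> x \<bullet> ((f (x + z) - f x) *\<^sub>R riesz_kernel \<alpha> z)" for z
      by (simp add: b_def K_def inner_commute)
    thus ?thesis unfolding frac_nabla_def
      using integrable_frac_nabla_integrand[OF f \<alpha>, of x]
      by (simp del: inner_scaleR_right)
  qed
  show ?thesis using main by (simp only: eq)
qed

section \<open>The density of the fractional variation measure\<close>

lemma Lip_cE:
  assumes "\<phi> \<in> Lip_c"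
  obtains P where "\<And>x. norm (\<phi> x) \<le> P" "\<And>x y. norm (\<phi> x - \<phi> y) \<le> P * norm (x - y)"
proof -
  obtain L where L: "L-lipschitz_on UNIV \<phi>" and c: "compact (fun_supp \<phi>)"
    using assms by (auto simp: Lip_c_def)
  have "compact (\<phi> ` fun_supp \<phi>)"
    using lipschitz_on_continuous_on[OF L] c by (intro compact_continuous_image) (auto intro: continuous_on_subset)
  then obtain C where C: "\<And>x. x \<in> fun_supp \<phi> \<Longrightarrow> norm (\<phi> x) \<le> C"
    using compact_imp_bounded bounded_iff by (metis imageI)
  have "norm (\<phi> x) \<le> max (max C 0) L" for x
  proof (cases "x \<in> fun_supp \<phi>")
    case False
    hence "\<phi> x = 0" using closure_subset[of "{x. \<phi> x \<noteq> 0}"] unfolding fun_supp_def by blast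
    thus ?thesis by simp
  qed (use C in force)
  moreover have "norm (\<phi> x - \<phi> y) \<le> max (max C 0) L * norm (x - y)" for x y
    using lipschitz_onD[OF L, of x y] mult_right_mono[of L "max (max C 0) L" "norm (x - y)"]
    by (simp add: dist_norm)
  ultimately show ?thesis by (rule that)
qed

lemma frac_div_eq:
  fixes \<phi> :: "real ^ 'n \<Rightarrow> real ^ 'n"
  assumes [measurable]: "\<phi> \<in> borel_measurable borel"
  shows "frac_div \<alpha> \<phi> x = frac_const CARD('n) \<alpha> * (\<integral>z. riesz_kernel \<alpha> z \<bullet> (\<phi> (x + z) - \<phi> x) \<partial>lborel)"
proof -
  let ?g = "\<lambda>y. ((y - x) \<bullet> (\<phi> y - \<phi> x)) / norm (y - x) powr (real CARD('n) + \<alpha> + 1)"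
  have "(LINT y|lebesgue. ?g y) = (LINT y|lborel. ?g y)"
    by (intro integral_completion) measurable
  also have "\<dots> = (LINT z|lborel. ?g (x + z))"
    by (intro integral_lborel_translate[symmetric]) measurable
  also have "\<dots> = (\<integral>z. riesz_kernel \<alpha> z \<bullet> (\<phi> (x + z) - \<phi> x) \<partial>lborel)"
    unfolding riesz_kernel_def powr_minus by (simp add: field_simps)
  finally show ?thesis by (simp add: frac_div_def)
qed

lemma frac_div_duality:
  fixes f :: "real ^ 'n \<Rightarrow> real"
  assumes f: "lipschitz_L1 f B" and \<alpha>: "0 < \<alpha>" "\<alpha> < 1" and \<phi>: "\<phi> \<in> Lip_c"
  shows "(LINT x|lebesgue. f x * frac_div \<alpha> \<phi> x)
       = - (\<integral>x. \<phi> x \<bullet> (frac_const CARD('n) \<alpha> *\<^sub>R frac_nabla \<alpha> f x) \<partial>lborel)"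
proof -
  obtain P where P: "\<And>x. norm (\<phi> x) \<le> P" "\<And>x y. norm (\<phi> x - \<phi> y) \<le> P * norm (x - y)"
    using Lip_cE[OF \<phi>] by blast
  have [measurable]: "\<phi> \<in> borel_measurable borel"
    using \<phi> lipschitz_on_continuous_on borel_measurable_continuous_onI unfolding Lip_c_def by blast
  have [measurable]: "f \<in> borel_measurable borel" by (rule lipschitz_L1D[OF f])
  have "(LINT x|lebesgue. f x * frac_div \<alpha> \<phi> x) = (LINT x|lborel. f x * frac_div \<alpha> \<phi> x)"
    unfolding frac_div_eq[OF \<open>\<phi> \<in> borel_measurable borel\<close>]
    by (intro integral_completion) measurable
  also have "\<dots> = frac_const CARD('n) \<alpha> * (\<integral>x. f x * (\<integral>z. riesz_kernel \<alpha> z \<bullet> (\<phi> (x + z) - \<phi> x) \<partial>lborel) \<partial>lborel)"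
  proof -
    have "f x * frac_div \<alpha> \<phi> x = frac_const CARD('n) \<alpha> * (f x * (\<integral>z. riesz_kernel \<alpha> z \<bullet> (\<phi> (x + z) - \<phi> x) \<partial>lborel))" for x
      by (simp add: frac_div_eq)
    thus ?thesis by (simp only: integral_mult_right_zero)
  qed
  also have "\<dots> = - (frac_const CARD('n) \<alpha> * (\<integral>x. \<phi> x \<bullet> frac_nabla \<alpha> f x \<partial>lborel))"
    by (subst frac_nabla_duality[OF f \<alpha> P]) simp_all
  finally show ?thesis by simp
qed

lemma frac_grad_eq_density:
  fixes f :: "real ^ 'n \<Rightarrow> real"
  assumes f: "lipschitz_L1 f B" and \<alpha>: "0 < \<alpha>" "\<alpha> < 1"
  shows "frac_grad \<alpha> f = density_vm (\<lambda>x. frac_const CARD('n) \<alpha> *\<^sub>R frac_nabla \<alpha> f x)"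
proof (rule frac_grad_eqI)
  have i: "integrable lborel (\<lambda>x. frac_const CARD('n) \<alpha> *\<^sub>R frac_nabla \<alpha> f x)"
    by (intro integrable_scaleR_right integrable_frac_nabla[OF f \<alpha>])
  thus "finite_vector_measure (density_vm (\<lambda>x. frac_const CARD('n) \<alpha> *\<^sub>R frac_nabla \<alpha> f x))"
    by (rule fvm_density_vm)
  fix \<phi> :: "real ^ 'n \<Rightarrow> real ^ 'n" assume \<phi>: "\<phi> \<in> Lip_c"
  obtain P where P: "\<And>x. norm (\<phi> x) \<le> P" "\<And>x y. norm (\<phi> x - \<phi> y) \<le> P * norm (x - y)"
    using Lip_cE[OF \<phi>] by blast
  have m: "\<phi> \<in> borel_measurable borel"
    using \<phi> lipschitz_on_continuous_on borel_measurable_continuous_onI unfolding Lip_c_def by blast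
  show "(LINT x|lebesgue. f x * frac_div \<alpha> \<phi> x) = - vector_integral \<phi> (density_vm (\<lambda>x. frac_const CARD('n) \<alpha> *\<^sub>R frac_nabla \<alpha> f x))"
    unfolding vector_integral_density_vm[OF i m P(1)] by (rule frac_div_duality[OF f \<alpha> \<phi>])
qed

text \<open>\<open>is_Ck\<close> gives continuity of each directional derivative. Such a derivative
  vanishes off the compact support, hence is bounded, and the bounds for the basis vectors add up to
  a bound for the operator norm of the derivative.\<close>

lemma C_inf_c_subset_Lip_c: "C_inf_c \<subseteq> Lip_c"
proof
  fix \<phi> :: "real ^ 'n \<Rightarrow> real ^ 'n" assume \<phi>: "\<phi> \<in> C_inf_c"
  hence c: "compact (fun_supp \<phi>)" by (simp add: C_inf_c_def)
  have "is_Ck (Suc 0) \<phi>" using \<phi> unfolding C_inf_c_def by blast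
  hence d: "\<And>x. \<phi> differentiable (at x)"
    and cont: "\<And>v. continuous_on UNIV (\<lambda>x. frechet_derivative \<phi> (at x) v)" by auto
  let ?D = "\<lambda>x. frechet_derivative \<phi> (at x)"
  have D: "(\<phi> has_derivative ?D x) (at x)" for x using d frechet_derivative_works by blast
  have D0: "?D x v = 0" if "x \<notin> fun_supp \<phi>" for x v
  proof -
    have "open (- fun_supp \<phi>)" unfolding fun_supp_def by (intro open_Compl closed_closure)
    moreover have "\<phi> y = 0" if "y \<in> - fun_supp \<phi>" for y
      using that closure_subset[of "{x. \<phi> x \<noteq> 0}"] unfolding fun_supp_def by blast
    ultimately have "(\<phi> has_derivative (\<lambda>_. 0)) (at x)"
      using \<open>x \<notin> fun_supp \<phi>\<close>
      by (intro has_derivative_transform_within_open[of "\<lambda>_. 0" "\<lambda>_. 0" x UNIV "- fun_supp \<phi>" \<phi>]) auto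
    thus ?thesis using has_derivative_unique[OF D] by metis
  qed
  have "\<exists>C. \<forall>x. norm (?D x v) \<le> C" for v
  proof -
    have "compact ((\<lambda>x. ?D x v) ` fun_supp \<phi>)"
      using cont c by (intro compact_continuous_image) (auto intro: continuous_on_subset)
    hence "bounded ((\<lambda>x. ?D x v) ` fun_supp \<phi>)" by (rule compact_imp_bounded)
    then obtain C where C: "\<And>x. x \<in> fun_supp \<phi> \<Longrightarrow> norm (?D x v) \<le> C"
      by (auto simp: bounded_iff)
    have "norm (?D x v) \<le> max C 0" for x
    proof (cases "x \<in> fun_supp \<phi>")
      case True
      show ?thesis using C[OF True] by linarith
    next
      case False
      show ?thesis using D0[OF False, of v] by simp
    qed
    thus ?thesis by blast
  qed
  then obtain C where C: "\<And>v x. norm (?D x v) \<le> C v" by metis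
  have "onorm (?D x) \<le> (\<Sum>b\<in>Basis. C b)" for x
  proof (rule onorm_le)
    fix h :: "real ^ 'n"
    interpret linear "?D x" using D has_derivative_linear by blast
    have "?D x h = ?D x (\<Sum>b\<in>Basis. (h \<bullet> b) *\<^sub>R b)" by (simp add: euclidean_representation)
    also have "\<dots> = (\<Sum>b\<in>Basis. (h \<bullet> b) *\<^sub>R ?D x b)" by (simp add: sum scale)
    finally have "norm (?D x h) \<le> (\<Sum>b\<in>Basis. norm ((h \<bullet> b) *\<^sub>R ?D x b))"
      using norm_sum[of "\<lambda>b. (h \<bullet> b) *\<^sub>R ?D x b" Basis] by (simp only:)
    also have "\<dots> \<le> (\<Sum>b\<in>Basis. C b * norm h)"
    proof (intro sum_mono)
      fix b :: "real ^ 'n" assume "b \<in> Basis"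
      hence "\<bar>h \<bullet> b\<bar> * norm (?D x b) \<le> norm h * C b"
        by (intro mult_mono Basis_le_norm C) auto
      thus "norm ((h \<bullet> b) *\<^sub>R ?D x b) \<le> C b * norm h" by (simp add: mult.commute)
    qed
    finally show "norm (?D x h) \<le> (\<Sum>b\<in>Basis. C b) * norm h" by (simp add: sum_distrib_right)
  qed
  moreover have "0 \<le> (\<Sum>b\<in>Basis. C b)"
    using C norm_ge_zero order_trans by (intro sum_nonneg) blast
  ultimately have "(\<Sum>b\<in>Basis. C b)-lipschitz_on UNIV \<phi>"
    using D by (intro bounded_derivative_imp_lipschitz) auto
  thus "\<phi> \<in> Lip_c" using c unfolding Lip_c_def by blast
qed

text \<open>Membership in L^p follows from |f| ^ p \<le> B ^ (p - 1) |f|. The fractional variation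
  is at most the L^1 norm of the density, by duality and the Cauchy-Schwarz inequality.\<close>

lemma lipschitz_L1_in_BV_frac:
  fixes f :: "real ^ 'n \<Rightarrow> real"
  assumes f: "lipschitz_L1 f B" and \<alpha>: "0 < \<alpha>" "\<alpha> < 1" and p: "1 \<le> p"
  shows "f \<in> BV_frac \<alpha> p"
proof -
  note F = lipschitz_L1D[OF f]
  have [measurable]: "f \<in> borel_measurable borel" by (rule F)
  have "f \<in> Lp p"
  proof -
    have "integrable lborel (\<lambda>x. \<bar>f x\<bar> powr p)"
    proof (rule Bochner_Integration.integrable_bound)
      show "integrable lborel (\<lambda>x. B powr (p - 1) * f x)" using F(1) by simp
      have "\<bar>f x\<bar> powr p \<le> B powr (p - 1) * \<bar>f x\<bar>" for x
      proof (cases "f x = 0")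
        case False
        have "\<bar>f x\<bar> powr p = \<bar>f x\<bar> powr (p - 1 + 1)" by simp
        also have "\<dots> = \<bar>f x\<bar> powr (p - 1) * \<bar>f x\<bar>" unfolding powr_add using False by simp
        also have "\<dots> \<le> B powr (p - 1) * \<bar>f x\<bar>"
          using F(2) p by (intro mult_right_mono powr_mono2) auto
        finally show ?thesis .
      qed (use p in simp)
      thus "AE x in lborel. norm (\<bar>f x\<bar> powr p) \<le> norm (B powr (p - 1) * f x)"
        by (auto simp: abs_mult)
    qed measurable
    hence "integrable lebesgue (\<lambda>x. \<bar>f x\<bar> powr p)" by (simp add: integrable_completion)
    thus ?thesis by (simp add: Lp_def measurable_completion)
  qed
  moreover have "frac_var \<alpha> f \<le> ereal (\<integral>x. norm (frac_const CARD('n) \<alpha> *\<^sub>R frac_nabla \<alpha> f x) \<partial>lborel)"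
    unfolding frac_var_def
  proof (intro SUP_least, clarify)
    fix \<phi> :: "real ^ 'n \<Rightarrow> real ^ 'n" assume "\<phi> \<in> C_inf_c" and 1: "AE x in lebesgue. norm (\<phi> x) \<le> 1"
    hence \<phi>: "\<phi> \<in> Lip_c" using C_inf_c_subset_Lip_c by blast
    have [measurable]: "\<phi> \<in> borel_measurable borel"
      using \<phi> lipschitz_on_continuous_on borel_measurable_continuous_onI unfolding Lip_c_def by blast
    let ?F = "\<lambda>x. frac_const CARD('n) \<alpha> *\<^sub>R frac_nabla \<alpha> f x"
    have F: "integrable lborel ?F"
      by (intro integrable_scaleR_right integrable_frac_nabla[OF f \<alpha>])
    have 1: "AE x in lborel. norm (\<phi> x) \<le> 1" using 1 by (simp add: AE_completion_iff)
    have bd: "AE x in lborel. \<bar>\<phi> x \<bullet> ?F x\<bar> \<le> norm (?F x)"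
      using 1
    proof eventually_elim
      case (elim x)
      show ?case using Cauchy_Schwarz_ineq2[of "\<phi> x" "?F x"] mult_right_mono[OF elim norm_ge_zero[of "?F x"]]
        by linarith
    qed
    have [measurable]: "?F \<in> borel_measurable borel" using F by auto
    have i: "integrable lborel (\<lambda>x. \<phi> x \<bullet> ?F x)"
      by (rule Bochner_Integration.integrable_bound[OF integrable_norm[OF F]])
         (use bd in \<open>auto simp del: inner_scaleR_right norm_scaleR\<close>)
    have "- (\<integral>x. \<phi> x \<bullet> ?F x \<partial>lborel) = (\<integral>x. - (\<phi> x \<bullet> ?F x) \<partial>lborel)" by simp
    also have "\<dots> \<le> (\<integral>x. norm (?F x) \<partial>lborel)"
    proof (rule integral_mono_AE)
      show "AE x in lborel. - (\<phi> x \<bullet> ?F x) \<le> norm (?F x)" using bd by eventually_elim linarith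
    qed (use i F in \<open>auto simp del: inner_scaleR_right norm_scaleR\<close>)
    finally show "ereal (LINT x|lebesgue. f x * frac_div \<alpha> \<phi> x) \<le> ereal (\<integral>x. norm (?F x) \<partial>lborel)"
      by (simp only: frac_div_duality[OF f \<alpha> \<phi>] ereal_less_eq)
  qed
  hence "frac_var \<alpha> f < \<infinity>" by (rule order_le_less_trans) simp
  ultimately show ?thesis by (simp add: BV_frac_def)
qed

section \<open>Positivity of Riesz potentials\<close>

text \<open>The Riesz kernel with |z| replaced by the square root of |z|^2 + \<delta>^2. For
  \<delta> > 0 it is bounded and smooth and, up to the factor - (n + \<alpha> - 1), the gradient of
  \<open>reg_potential\<close>, so that line integrals and Fubini apply to it.\<close>

definition reg_kernel :: "real \<Rightarrow> real \<Rightarrow> 'a::euclidean_space \<Rightarrow> 'a" where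
  "reg_kernel \<alpha> \<delta> z = ((norm z)\<^sup>2 + \<delta>\<^sup>2) powr (- (real DIM('a) + \<alpha> + 1) / 2) *\<^sub>R z"

definition reg_potential :: "real \<Rightarrow> real \<Rightarrow> 'a::euclidean_space \<Rightarrow> real" where
  "reg_potential \<alpha> \<delta> z = ((norm z)\<^sup>2 + \<delta>\<^sup>2) powr (- (real DIM('a) + \<alpha> - 1) / 2)"

lemma reg_kernel_measurable [measurable]: "reg_kernel \<alpha> \<delta> \<in> borel_measurable borel"
  unfolding reg_kernel_def by measurable

lemma reg_potential_measurable [measurable]: "reg_potential \<alpha> \<delta> \<in> borel_measurable borel"
  unfolding reg_potential_def by measurable

lemma reg_kernel_uminus [simp]: "reg_kernel \<alpha> \<delta> (- z) = - reg_kernel \<alpha> \<delta> z"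
  by (simp add: reg_kernel_def)

lemma power2_powr_half: "x \<ge> 0 \<Longrightarrow> (x\<^sup>2) powr (a / 2) = x powr a" for x :: real
  by (cases "x = 0") (simp_all add: powr_powr flip: powr_numeral)

lemma DIM_ge_1_real: "real DIM('a::euclidean_space) \<ge> 1"
  using DIM_positive[where 'a='a] by (metis One_nat_def Suc_leI of_nat_1 of_nat_le_iff)

lemma DIM_plus_ge_1: "0 < \<alpha> \<Longrightarrow> 1 \<le> real DIM('a::euclidean_space) + \<alpha>"
  using DIM_ge_1_real[where 'a='a] by linarith

lemma norm_reg_kernel_le:
  fixes z :: "'a::euclidean_space"
  assumes "\<alpha> > 0"
  shows "norm (reg_kernel \<alpha> \<delta> z) \<le> norm (riesz_kernel \<alpha> z)"
proof (cases "z = 0")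
  case False
  have "((norm z)\<^sup>2 + \<delta>\<^sup>2) powr (- (real DIM('a) + \<alpha> + 1) / 2) \<le> ((norm z)\<^sup>2) powr (- (real DIM('a) + \<alpha> + 1) / 2)"
    using False assms DIM_ge_1_real[where 'a='a] by (intro powr_mono2') auto
  also have "\<dots> = norm z powr (- (real DIM('a) + \<alpha> + 1))"
    by (rule power2_powr_half) simp
  finally show ?thesis unfolding reg_kernel_def riesz_kernel_def
    by (simp add: mult_right_mono)
qed (simp add: reg_kernel_def)

lemma norm_reg_kernel_bounded:
  fixes z :: "'a::euclidean_space"
  assumes "\<alpha> > 0" "\<delta> > 0"
  shows "norm (reg_kernel \<alpha> \<delta> z) \<le> \<delta> powr - (real DIM('a) + \<alpha>)"
proof -
  define s where "s = (norm z)\<^sup>2 + \<delta>\<^sup>2"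
  have s: "s > 0" "s \<ge> \<delta>\<^sup>2" using assms by (auto simp: s_def add_nonneg_pos)
  have "norm z = ((norm z)\<^sup>2) powr (1/2)" using power2_powr_half[of "norm z" 1] by simp
  also have "\<dots> \<le> s powr (1/2)" by (intro powr_mono2) (auto simp: s_def)
  finally have "norm (reg_kernel \<alpha> \<delta> z) \<le> s powr (- (real DIM('a) + \<alpha> + 1) / 2) * s powr (1/2)"
    unfolding reg_kernel_def s_def[symmetric] by (simp add: mult_left_mono)
  also have "\<dots> = s powr (- (real DIM('a) + \<alpha> + 1) / 2 + 1 / 2)" by (rule powr_add[symmetric])
  also have "- (real DIM('a) + \<alpha> + 1) / 2 + 1 / 2 = - (real DIM('a) + \<alpha>) / 2" by (simp add: field_simps)
  also have "s powr (- (real DIM('a) + \<alpha>) / 2) \<le> (\<delta>\<^sup>2) powr (- (real DIM('a) + \<alpha>) / 2)"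
    using s assms DIM_ge_1_real[where 'a='a] by (intro powr_mono2') auto
  also have "\<dots> = \<delta> powr - (real DIM('a) + \<alpha>)" using assms by (intro power2_powr_half) simp
  finally show ?thesis .
qed

lemma reg_potential_pos:
  assumes "\<delta> > 0" shows "reg_potential \<alpha> \<delta> z > 0"
proof -
  have "(norm z)\<^sup>2 + \<delta>\<^sup>2 > 0" using assms by (simp add: add_nonneg_pos)
  thus ?thesis unfolding reg_potential_def
    by (subst powr_gt_zero) (rule less_imp_neq[THEN not_sym])
qed

lemma reg_potential_antimono:
  fixes z :: "'a::euclidean_space"
  assumes "0 < \<delta>" "\<delta> \<le> \<epsilon>" "\<alpha> > 0"
  shows "reg_potential \<alpha> \<epsilon> z \<le> reg_potential \<alpha> \<delta> z"
  unfolding reg_potential_def using assms DIM_plus_ge_1[where 'a='a, OF assms(3)]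
  by (intro powr_mono2') (auto simp: add_nonneg_pos power_mono)

lemma reg_potential_bounded:
  fixes z :: "'a::euclidean_space"
  assumes "\<delta> > 0" "\<alpha> > 0"
  shows "reg_potential \<alpha> \<delta> z \<le> \<delta> powr - (real DIM('a) + \<alpha> - 1)"
proof -
  have "reg_potential \<alpha> \<delta> z \<le> (\<delta>\<^sup>2) powr (- (real DIM('a) + \<alpha> - 1) / 2)"
    unfolding reg_potential_def using assms DIM_plus_ge_1[where 'a='a, OF assms(2)]
    by (intro powr_mono2') auto
  also have "\<dots> = \<delta> powr - (real DIM('a) + \<alpha> - 1)" using assms by (intro power2_powr_half) simp
  finally show ?thesis .
qed

lemma reg_potential_le:
  fixes z :: "'a::euclidean_space"
  assumes "z \<noteq> 0" "\<alpha> > 0"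
  shows "reg_potential \<alpha> \<delta> z \<le> norm z powr - (real DIM('a) + \<alpha> - 1)"
proof -
  have "reg_potential \<alpha> \<delta> z \<le> ((norm z)\<^sup>2) powr (- (real DIM('a) + \<alpha> - 1) / 2)"
    unfolding reg_potential_def using assms DIM_plus_ge_1[where 'a='a, OF assms(2)]
    by (intro powr_mono2') auto
  also have "\<dots> = norm z powr - (real DIM('a) + \<alpha> - 1)" by (intro power2_powr_half) simp
  finally show ?thesis .
qed

text \<open>The fundamental theorem of calculus on a ray: since |e| = 1, the expression |y - l e|^2
  + \<delta>^2 is the quadratic polynomial \<open>s l\<close>, which stays positive.\<close>

lemma reg_potential_line_integral:
  fixes y e :: "'a::euclidean_space"
  assumes e: "norm e = 1" and \<delta>: "\<delta> > 0" and N: "N \<ge> 0"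
  shows "(\<integral>l. (real DIM('a) + \<alpha> - 1) * (reg_kernel \<alpha> \<delta> (y - l *\<^sub>R e) \<bullet> e) * indicator {0..N} l \<partial>lborel)
       = reg_potential \<alpha> \<delta> (y - N *\<^sub>R e) - reg_potential \<alpha> \<delta> y"
proof -
  define m where "m = real DIM('a) + \<alpha> - 1"
  define s where "s = (\<lambda>l. y \<bullet> y - 2 * l * (y \<bullet> e) + l\<^sup>2 + \<delta>\<^sup>2)"
  have ee: "e \<bullet> e = 1" using e by (simp add: norm_eq_1)
  have s: "(norm (y - l *\<^sub>R e))\<^sup>2 + \<delta>\<^sup>2 = s l" for l
    unfolding power2_norm_eq_inner s_def
    by (simp add: inner_diff_left inner_diff_right ee inner_commute[of e y] power2_eq_square algebra_simps)
  have spos: "s l > 0" for l using s[of l] \<delta> by (metis add_nonneg_pos zero_le_power2 zero_less_power)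
  have pot: "reg_potential \<alpha> \<delta> (y - l *\<^sub>R e) = s l powr (- m / 2)" for l
    by (simp add: reg_potential_def s m_def)
  have ker: "m * (reg_kernel \<alpha> \<delta> (y - l *\<^sub>R e) \<bullet> e) = m * (s l powr (- m / 2 - 1) * (y \<bullet> e - l))" for l
  proof -
    have ex: "- (real DIM('a) + \<alpha> + 1) / 2 = - m / 2 - 1" by (simp add: m_def field_simps)
    show ?thesis unfolding reg_kernel_def ex s by (simp add: inner_diff_left ee)
  qed
  have D: "((\<lambda>l. s l powr (- m / 2)) has_real_derivative m * (s l powr (- m / 2 - 1) * (y \<bullet> e - l))) (at l)" for l
  proof -
    have D1: "(s has_real_derivative (2 * l - 2 * (y \<bullet> e))) (at l)"
      unfolding s_def by (auto intro!: derivative_eq_intros)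
    show ?thesis
      by (rule DERIV_cong[OF DERIV_fun_powr[OF D1 spos, of "- m / 2"]]) (simp add: field_simps)
  qed
  have cont: "isCont (\<lambda>l. m * (s l powr (- m / 2 - 1) * (y \<bullet> e - l))) l" for l
    using spos[of l] unfolding s_def by (intro continuous_intros) auto
  have "(\<integral>l. m * (s l powr (- m / 2 - 1) * (y \<bullet> e - l)) * indicator {0..N} l \<partial>lborel)
      = s N powr (- m / 2) - s 0 powr (- m / 2)"
    by (rule integral_FTC_Icc_real[OF N D cont])
  thus ?thesis
    unfolding m_def[symmetric] ker pot[of N] using pot[of 0] by simp
qed

text \<open>The weight min 1 |z| makes the Riesz kernel integrable; in the application it comes from
  the increments of a bounded Lipschitz function. Regularising only decreases the norm of the
  kernel, hence the majorant \<open>2 * trunc_kernel \<alpha> z\<close>.\<close>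

lemma reg_kernel_L1_tendsto:
  assumes \<alpha>: "0 < \<alpha>" "\<alpha> < 1"
  shows "(\<lambda>k. \<integral>z. norm (reg_kernel \<alpha> (1 / real (Suc k)) z - riesz_kernel \<alpha> (z::'a::euclidean_space)) * min 1 (norm z) \<partial>lborel) \<longlonglongrightarrow> 0"
proof -
  have "(\<lambda>k. \<integral>z. norm (reg_kernel \<alpha> (1 / real (Suc k)) z - riesz_kernel \<alpha> (z::'a)) * min 1 (norm z) \<partial>lborel)
      \<longlonglongrightarrow> (\<integral>z. 0 \<partial>(lborel :: 'a measure))"
  proof (rule integral_dominated_convergence[where w="\<lambda>z. 2 * trunc_kernel \<alpha> z"])
    show "integrable lborel (\<lambda>z::'a. 2 * trunc_kernel \<alpha> z)"
      using integrable_trunc_kernel[OF \<alpha>] by simp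
    have "norm (reg_kernel \<alpha> \<delta> z - riesz_kernel \<alpha> z) * min 1 (norm z) \<le> 2 * trunc_kernel \<alpha> z" for \<delta> and z :: 'a
    proof -
      have "norm (reg_kernel \<alpha> \<delta> z - riesz_kernel \<alpha> z) \<le> 2 * norm (riesz_kernel \<alpha> z)"
        using norm_triangle_ineq4[of "reg_kernel \<alpha> \<delta> z" "riesz_kernel \<alpha> z"] norm_reg_kernel_le[OF \<alpha>(1), of \<delta> z]
        by linarith
      hence "norm (reg_kernel \<alpha> \<delta> z - riesz_kernel \<alpha> z) * min 1 (norm z) \<le> 2 * norm (riesz_kernel \<alpha> z) * min 1 (norm z)"
        by (intro mult_right_mono) auto
      thus ?thesis by (simp add: mult_ac flip: trunc_kernel_eq)
    qed
    thus "AE z in lborel. norm (norm (reg_kernel \<alpha> (1 / real (Suc k)) z - riesz_kernel \<alpha> z) * min 1 (norm z)) \<le> 2 * trunc_kernel \<alpha> (z::'a)" for k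
      by simp
    show "AE z in lborel. (\<lambda>k. norm (reg_kernel \<alpha> (1 / real (Suc k)) z - riesz_kernel \<alpha> (z::'a)) * min 1 (norm z)) \<longlonglongrightarrow> 0"
    proof (intro always_eventually allI)
      fix z :: 'a
      show "(\<lambda>k. norm (reg_kernel \<alpha> (1 / real (Suc k)) z - riesz_kernel \<alpha> z) * min 1 (norm z)) \<longlonglongrightarrow> 0"
      proof (cases "z = 0")
        case False
        have d: "(\<lambda>k. 1 / real (Suc k)) \<longlonglongrightarrow> 0"
          using LIMSEQ_inverse_real_of_nat by (simp add: inverse_eq_divide)
        have "(\<lambda>k. reg_kernel \<alpha> (1 / real (Suc k)) z) \<longlonglongrightarrow>
            ((norm z)\<^sup>2 + 0\<^sup>2) powr (- (real DIM('a) + \<alpha> + 1) / 2) *\<^sub>R z"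
          unfolding reg_kernel_def using False
          by (intro tendsto_intros d) auto
        also have "((norm z)\<^sup>2 + 0\<^sup>2) powr (- (real DIM('a) + \<alpha> + 1) / 2) *\<^sub>R z = riesz_kernel \<alpha> z"
          unfolding riesz_kernel_def using power2_powr_half[of "norm z" "- (real DIM('a) + \<alpha> + 1)"] by simp
        finally have "(\<lambda>k. norm (reg_kernel \<alpha> (1 / real (Suc k)) z - riesz_kernel \<alpha> z) * min 1 (norm z))
            \<longlonglongrightarrow> norm (riesz_kernel \<alpha> z - riesz_kernel \<alpha> z) * min 1 (norm z)"
          by (intro tendsto_intros)
        thus ?thesis by simp
      qed simp
    qed
  qed measurable
  thus ?thesis by simp
qed

text \<open>The regularised kernel is odd and integrable, so \<open>g (x + z)\<close> may be
  replaced by its increment from \<open>g x\<close>. Subtracting the integral that defines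
  \<open>frac_nabla \<alpha> g x\<close>, which is 0, leaves the difference of the kernels acting on
  increments.\<close>

lemma reg_kernel_convolution_bound:
  fixes g :: "'a::euclidean_space \<Rightarrow> real"
  assumes g: "lipschitz_L1 g B" and \<alpha>: "0 < \<alpha>" "\<alpha> < 1" and \<delta>: "\<delta> > 0" and e: "norm e = 1"
    and 0: "frac_nabla \<alpha> g x = 0"
  shows "\<bar>\<integral>z. (reg_kernel \<alpha> \<delta> z \<bullet> e) * g (x + z) \<partial>lborel\<bar>
    \<le> 2 * B * (\<integral>z. norm (reg_kernel \<alpha> \<delta> z - riesz_kernel \<alpha> (z::'a)) * min 1 (norm z) \<partial>lborel)"
proof -
  let ?K = "riesz_kernel \<alpha> :: 'a \<Rightarrow> 'a" and ?Kd = "reg_kernel \<alpha> \<delta> :: 'a \<Rightarrow> 'a"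
  note G = lipschitz_L1D[OF g]
  have [measurable]: "g \<in> borel_measurable borel" by (rule G)
  have inc: "\<bar>g (x + z) - g x\<bar> \<le> 2 * B * min 1 (norm z)" for z by (rule G(9))
  have i1: "integrable lborel (\<lambda>z. (g (x + z) - g x) *\<^sub>R ?K z)"
    by (rule integrable_frac_nabla_integrand[OF g \<alpha>])
  have i2: "integrable lborel (\<lambda>z. (g (x + z) - g x) *\<^sub>R ?Kd z)"
    by (rule Bochner_Integration.integrable_bound[OF i1])
       (auto intro!: mult_left_mono norm_reg_kernel_le[OF \<alpha>(1)])
  have i3: "integrable lborel (\<lambda>z. g (x + z) *\<^sub>R ?Kd z)"
  proof (rule Bochner_Integration.integrable_bound)
    show "integrable lborel (\<lambda>z. \<delta> powr - (real DIM('a) + \<alpha>) * g (x + z))"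
      by (intro integrable_mult_right integrable_lborel_translate G(1))
    show "AE z in lborel. norm (g (x + z) *\<^sub>R ?Kd z) \<le> norm (\<delta> powr - (real DIM('a) + \<alpha>) * g (x + z))"
    proof (intro always_eventually allI)
      fix z
      show "norm (g (x + z) *\<^sub>R ?Kd z) \<le> norm (\<delta> powr - (real DIM('a) + \<alpha>) * g (x + z))"
        using mult_left_mono[OF norm_reg_kernel_bounded[OF \<alpha>(1) \<delta>, of z] abs_ge_zero[of "g (x + z)"]]
        by (simp add: abs_mult mult.commute)
    qed
  qed measurable
  have i4: "integrable lborel (\<lambda>z. g x *\<^sub>R ?Kd z)"
    using Bochner_Integration.integrable_diff[OF i3 i2] by (simp add: algebra_simps)
  have odd: "(\<integral>z. g x *\<^sub>R ?Kd z \<partial>lborel) = 0"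
    by (intro integral_lborel_odd) auto
  have "(\<integral>z. g (x + z) *\<^sub>R ?Kd z \<partial>lborel) = (\<integral>z. (g (x + z) - g x) *\<^sub>R ?Kd z \<partial>lborel)"
    unfolding scaleR_diff_left Bochner_Integration.integral_diff[OF i3 i4] odd by simp
  also have "\<dots> = (\<integral>z. (g (x + z) - g x) *\<^sub>R ?Kd z \<partial>lborel) - (\<integral>z. (g (x + z) - g x) *\<^sub>R ?K z \<partial>lborel)"
    using 0 by (simp add: frac_nabla_def)
  also have "\<dots> = (\<integral>z. (g (x + z) - g x) *\<^sub>R ?Kd z - (g (x + z) - g x) *\<^sub>R ?K z \<partial>lborel)"
    by (rule Bochner_Integration.integral_diff[OF i2 i1, symmetric])
  also have "\<dots> = (\<integral>z. (g (x + z) - g x) *\<^sub>R (?Kd z - ?K z) \<partial>lborel)"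
    by (simp add: scaleR_diff_right)
  finally have eq: "(\<integral>z. g (x + z) *\<^sub>R ?Kd z \<partial>lborel) = (\<integral>z. (g (x + z) - g x) *\<^sub>R (?Kd z - ?K z) \<partial>lborel)" .
  have i5: "integrable lborel (\<lambda>z. (g (x + z) - g x) *\<^sub>R (?Kd z - ?K z))"
    using Bochner_Integration.integrable_diff[OF i2 i1] by (simp add: scaleR_diff_right)
  have i6: "integrable lborel (\<lambda>z. norm (?Kd z - ?K z) * min 1 (norm z))"
  proof (rule Bochner_Integration.integrable_bound)
    show "integrable lborel (\<lambda>z::'a. 2 * trunc_kernel \<alpha> z)"
      using integrable_trunc_kernel[OF \<alpha>] by simp
    show "AE z in lborel. norm (norm (?Kd z - ?K z) * min 1 (norm z)) \<le> norm (2 * trunc_kernel \<alpha> z)"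
    proof (intro always_eventually allI)
      fix z :: 'a
      have "norm (?Kd z - ?K z) \<le> 2 * norm (?K z)"
        using norm_triangle_ineq4[of "?Kd z" "?K z"] norm_reg_kernel_le[OF \<alpha>(1), of \<delta> z] by linarith
      hence "norm (?Kd z - ?K z) * min 1 (norm z) \<le> 2 * norm (?K z) * min 1 (norm z)"
        by (intro mult_right_mono) auto
      thus "norm (norm (?Kd z - ?K z) * min 1 (norm z)) \<le> norm (2 * trunc_kernel \<alpha> z)"
        by (simp add: mult_ac abs_mult flip: trunc_kernel_eq)
    qed
  qed measurable
  have "(\<integral>z. (?Kd z \<bullet> e) * g (x + z) \<partial>lborel) = (\<integral>z. g (x + z) *\<^sub>R ?Kd z \<partial>lborel) \<bullet> e"
    using i3 by (subst integral_inner_left[symmetric]) (simp_all add: mult.commute)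
  also have "\<bar>\<dots>\<bar> \<le> norm (\<integral>z. g (x + z) *\<^sub>R ?Kd z \<partial>lborel)"
    using Cauchy_Schwarz_ineq2[of "\<integral>z. g (x + z) *\<^sub>R ?Kd z \<partial>lborel" e] e by simp
  also have "\<dots> \<le> (\<integral>z. norm ((g (x + z) - g x) *\<^sub>R (?Kd z - ?K z)) \<partial>lborel)"
    unfolding eq by (rule integral_norm_bound)
  also have "\<dots> \<le> (\<integral>z. 2 * B * (norm (?Kd z - ?K z) * min 1 (norm z)) \<partial>lborel)"
  proof (rule integral_mono)
    fix z
    show "norm ((g (x + z) - g x) *\<^sub>R (?Kd z - ?K z)) \<le> 2 * B * (norm (?Kd z - ?K z) * min 1 (norm z))"
      using mult_right_mono[OF inc[of z] norm_ge_zero[of "?Kd z - ?K z"]] by (simp add: mult_ac)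
  qed (intro integrable_norm i5, intro integrable_mult_right i6)
  finally show ?thesis by simp
qed

lemma integrable_times_reg_potential:
  fixes g :: "'a::euclidean_space \<Rightarrow> real"
  assumes g: "integrable lborel g" and \<delta>: "\<delta> > 0" and \<alpha>: "\<alpha> > 0"
  shows "integrable lborel (\<lambda>y. g y * reg_potential \<alpha> \<delta> (y - v))"
proof (rule Bochner_Integration.integrable_bound)
  show "integrable lborel (\<lambda>y. \<delta> powr - (real DIM('a) + \<alpha> - 1) * g y)"
    by (intro integrable_mult_right g)
  show "(\<lambda>y. g y * reg_potential \<alpha> \<delta> (y - v)) \<in> borel_measurable lborel"
    using g by measurable
  show "AE y in lborel. norm (g y * reg_potential \<alpha> \<delta> (y - v)) \<le> norm (\<delta> powr - (real DIM('a) + \<alpha> - 1) * g y)"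
  proof (intro always_eventually allI)
    fix y
    show "norm (g y * reg_potential \<alpha> \<delta> (y - v)) \<le> norm (\<delta> powr - (real DIM('a) + \<alpha> - 1) * g y)"
      using mult_right_mono[OF reg_potential_bounded[OF \<delta> \<alpha>, of "y - v"] abs_ge_zero[of "g y"]]
        reg_potential_pos[OF \<delta>, of \<alpha> "y - v"]
      by (simp add: abs_mult mult.commute)
  qed
qed

text \<open>Integrates the preceding bound along the ray. For a fixed length \<open>N\<close> the
  right-hand side tends to 0 with \<delta>, so in the limit the potential does not change along the
  ray.\<close>

lemma reg_potential_convolution_increment:
  fixes g :: "'a::euclidean_space \<Rightarrow> real"
  assumes g: "lipschitz_L1 g B" and \<alpha>: "0 < \<alpha>" "\<alpha> < 1" and \<delta>: "\<delta> > 0" and e: "norm e = 1"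
    and 0: "\<And>l. l \<ge> 0 \<Longrightarrow> frac_nabla \<alpha> g (x + l *\<^sub>R e) = 0" and N: "N \<ge> 0"
  shows "\<bar>(\<integral>y. g y * reg_potential \<alpha> \<delta> (y - x - N *\<^sub>R e) \<partial>lborel) - (\<integral>y. g y * reg_potential \<alpha> \<delta> (y - x) \<partial>lborel)\<bar>
    \<le> (real DIM('a) + \<alpha> - 1) * (2 * B * (\<integral>z. norm (reg_kernel \<alpha> \<delta> z - riesz_kernel \<alpha> (z::'a)) * min 1 (norm z) \<partial>lborel)) * N"
proof -
  define m where "m = real DIM('a) + \<alpha> - 1"
  define \<eta> where "\<eta> = (\<integral>z. norm (reg_kernel \<alpha> \<delta> z - riesz_kernel \<alpha> (z::'a)) * min 1 (norm z) \<partial>lborel)"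
  have m: "m > 0" using DIM_ge_1_real[where 'a='a] \<alpha> unfolding m_def by linarith
  note G = lipschitz_L1D[OF g]
  have [measurable]: "g \<in> borel_measurable borel" by (rule G)
  define F where "F = (\<lambda>l y. g y * (m * (reg_kernel \<alpha> \<delta> (y - x - l *\<^sub>R e) \<bullet> e) * indicator {0..N} l))"
  define C where "C = \<delta> powr - (real DIM('a) + \<alpha>)"
  have K: "\<bar>reg_kernel \<alpha> \<delta> z \<bullet> e\<bar> \<le> C" for z
    using Cauchy_Schwarz_ineq2[of "reg_kernel \<alpha> \<delta> z" e] norm_reg_kernel_bounded[OF \<alpha>(1) \<delta>, of z] e
    by (simp add: C_def)
  have FB: "norm (F l y) \<le> m * C * indicator {0..N} l * \<bar>g y\<bar>" for l y
    using mult_right_mono[OF K[of "y - x - l *\<^sub>R e"] abs_ge_zero[of "g y"]] m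
    by (simp add: F_def abs_mult indicator_def mult_ac)
  have ig: "integrable lborel (\<lambda>y. c * \<bar>g y\<bar>)" for c :: real
    by (intro integrable_mult_right integrable_abs G(1))
  have iF1: "integrable lborel (F l)" for l
    by (rule Bochner_Integration.integrable_bound[OF ig[of "m * C * indicator {0..N} l"]])
       (use FB in \<open>auto simp: F_def intro: order_trans[OF _ abs_ge_self]\<close>)
  have ind: "integrable lborel (indicat_real {0..N})"
    using N by (intro integrable_real_indicator) auto
  have iF: "integrable (lborel \<Otimes>\<^sub>M lborel) (case_prod F)"
  proof (rule integrable_pair_lborelI[OF _ iF1])
    show "case_prod F \<in> borel_measurable (borel \<Otimes>\<^sub>M borel)" unfolding F_def by measurable
    show "integrable lborel (\<lambda>l. m * C * (\<integral>y. \<bar>g y\<bar> \<partial>lborel) * indicator {0..N} l)"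
      by (intro integrable_mult_right ind)
    fix l
    have "(\<integral>y. norm (F l y) \<partial>lborel) \<le> (\<integral>y. m * C * indicator {0..N} l * \<bar>g y\<bar> \<partial>lborel)"
      by (intro integral_mono integrable_norm iF1 ig FB)
    thus "(\<integral>y. norm (F l y) \<partial>lborel) \<le> m * C * (\<integral>y. \<bar>g y\<bar> \<partial>lborel) * indicator {0..N} l"
      by (simp add: mult_ac)
  qed
  note ipot = integrable_times_reg_potential[OF G(1) \<delta> \<alpha>(1)]
  have "(\<integral>y. g y * reg_potential \<alpha> \<delta> (y - x - N *\<^sub>R e) \<partial>lborel) - (\<integral>y. g y * reg_potential \<alpha> \<delta> (y - x) \<partial>lborel)
      = (\<integral>y. g y * reg_potential \<alpha> \<delta> (y - x - N *\<^sub>R e) - g y * reg_potential \<alpha> \<delta> (y - x) \<partial>lborel)"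
    using ipot[of "x + N *\<^sub>R e"] ipot[of x]
    by (intro Bochner_Integration.integral_diff[symmetric]) (simp_all add: diff_diff_eq)
  also have "\<dots> = (\<integral>y. (\<integral>l. F l y \<partial>lborel) \<partial>lborel)"
  proof (intro Bochner_Integration.integral_cong refl)
    fix y
    show "g y * reg_potential \<alpha> \<delta> (y - x - N *\<^sub>R e) - g y * reg_potential \<alpha> \<delta> (y - x) = (\<integral>l. F l y \<partial>lborel)"
      using reg_potential_line_integral[OF e \<delta> N, of \<alpha> "y - x"]
      unfolding F_def m_def by (simp add: right_diff_distrib)
  qed
  also have "\<dots> = (\<integral>l. (\<integral>y. F l y \<partial>lborel) \<partial>lborel)"
    using lborel_pair.integral_snd[OF iF] lborel_pair.integral_fst[OF iF] by simp
  finally have eq: "(\<integral>y. g y * reg_potential \<alpha> \<delta> (y - x - N *\<^sub>R e) \<partial>lborel) - (\<integral>y. g y * reg_potential \<alpha> \<delta> (y - x) \<partial>lborel)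
      = (\<integral>l. (\<integral>y. F l y \<partial>lborel) \<partial>lborel)" .
  have bd: "\<bar>\<integral>y. F l y \<partial>lborel\<bar> \<le> m * (2 * B * \<eta>) * indicator {0..N} l" for l
  proof (cases "l \<in> {0..N}")
    case True
    have "(\<integral>y. F l y \<partial>lborel) = (\<integral>z. F l ((x + l *\<^sub>R e) + z) \<partial>lborel)"
      using iF1[of l] by (intro integral_lborel_translate[symmetric]) auto
    also have "\<dots> = (\<integral>z. m * ((reg_kernel \<alpha> \<delta> z \<bullet> e) * g ((x + l *\<^sub>R e) + z)) \<partial>lborel)"
      using True by (intro Bochner_Integration.integral_cong refl) (simp add: F_def)
    also have "\<dots> = m * (\<integral>z. (reg_kernel \<alpha> \<delta> z \<bullet> e) * g ((x + l *\<^sub>R e) + z) \<partial>lborel)" by simp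
    finally have "\<bar>\<integral>y. F l y \<partial>lborel\<bar> = m * \<bar>\<integral>z. (reg_kernel \<alpha> \<delta> z \<bullet> e) * g ((x + l *\<^sub>R e) + z) \<partial>lborel\<bar>"
      using m by (simp add: abs_mult)
    also have "\<dots> \<le> m * (2 * B * \<eta>)"
      unfolding \<eta>_def using m True by (intro mult_left_mono reg_kernel_convolution_bound[OF g \<alpha> \<delta> e 0]) auto
    finally show ?thesis using True by simp
  qed (simp add: F_def)
  have iO: "integrable lborel (\<lambda>l. \<integral>y. F l y \<partial>lborel)" by (rule lborel_pair.integrable_fst[OF iF])
  have "\<bar>\<integral>l. (\<integral>y. F l y \<partial>lborel) \<partial>lborel\<bar> \<le> (\<integral>l. \<bar>\<integral>y. F l y \<partial>lborel\<bar> \<partial>lborel)"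
    using integral_norm_bound[of lborel "\<lambda>l. \<integral>y. F l y \<partial>lborel"] by simp
  also have "\<dots> \<le> (\<integral>l. m * (2 * B * \<eta>) * indicator {0..N} l \<partial>lborel)"
    by (intro integral_mono integrable_abs iO bd integrable_mult_right ind)
  also have "\<dots> = m * (2 * B * \<eta>) * N" using N by simp
  finally show ?thesis unfolding eq m_def \<eta>_def .
qed

text \<open>
  Where \<open>\<nabla>\<^sup>\<alpha> g\<close> vanishes along a half-line, the Riesz potential of \<open>g\<close> is constant there.
  It is positive if \<open>g \<ge> 0\<close> does not vanish, but it tends to \<open>0\<close> at infinity.
\<close>

theorem nonneg_eq_0_if_frac_nabla_eq_0_outside_ball:
  fixes g :: "'a::euclidean_space \<Rightarrow> real"
  assumes g: "lipschitz_L1 g B" and \<alpha>: "0 < \<alpha>" "\<alpha> < 1"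
    and nonneg: "\<And>x. g x \<ge> 0" and 0: "\<And>x. norm x > 1 \<Longrightarrow> frac_nabla \<alpha> g x = 0"
  shows "g x = 0"
proof (rule ccontr)
  assume gx: "g x \<noteq> 0"
  define n where "n = real DIM('a)"
  define m where "m = n + \<alpha> - 1"
  have m: "m > 0" using DIM_ge_1_real[where 'a='a] \<alpha> unfolding m_def n_def by linarith
  obtain e :: 'a where e: "norm e = 1" using norm_Basis[OF SOME_Basis] by blast
  note G = lipschitz_L1D[OF g]
  have [measurable]: "g \<in> borel_measurable borel" by (rule G)
  \<comment> \<open>The ray starts at distance 2 from the origin and moves away from it, hence never
    meets the unit ball.\<close>
  define a where "a = 2 *\<^sub>R e"
  define X where "X = (\<lambda>N::nat. a + real N *\<^sub>R e)"
  have nX: "norm (a + l *\<^sub>R e) = 2 + l" if "l \<ge> 0" for l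
  proof -
    have "a + l *\<^sub>R e = (2 + l) *\<^sub>R e" by (simp add: a_def scaleR_add_left)
    thus ?thesis using e that by simp
  qed
  have van: "frac_nabla \<alpha> g (a + l *\<^sub>R e) = 0" if "l \<ge> 0" for l
    using nX[OF that] that by (intro 0) simp
  define \<delta> where "\<delta> = (\<lambda>k::nat. 1 / real (Suc k))"
  have \<delta>: "\<delta> k > 0" "\<delta> k \<le> 1" for k by (auto simp: \<delta>_def)
  define H where "H = (\<lambda>\<delta> v. \<integral>y. g y * reg_potential \<alpha> \<delta> (y - v) \<partial>lborel)"
  have iH: "integrable lborel (\<lambda>y. g y * reg_potential \<alpha> \<delta> (y - v))" if "\<delta> > 0" for \<delta> v
    by (rule integrable_times_reg_potential[OF G(1) that \<alpha>(1)])
  \<comment> \<open>The potential regularised with \<delta> = 1 bounds from below those for all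
    smaller \<delta>; so \<open>h\<close> is a positive lower bound at \<open>a\<close> that does
    not depend on \<delta>.\<close>
  define h where "h = H 1 a"
  have h: "h > 0"
  proof -
    have nn: "g y * reg_potential \<alpha> 1 (y - a) \<ge> 0" for y
      using nonneg[of y] reg_potential_pos[of 1 \<alpha> "y - a"] by simp
    have "h \<noteq> 0"
    proof
      assume "h = 0"
      hence "AE y in lborel. g y * reg_potential \<alpha> 1 (y - a) = 0"
        using integral_nonneg_eq_0_iff_AE[OF iH[of 1 a]] nn by (simp add: h_def H_def)
      hence "AE y in lborel. g y = 0"
      proof eventually_elim
        case (elim y)
        thus ?case using reg_potential_pos[of 1 \<alpha> "y - a"] by simp
      qed
      thus False using AE_zero_continuous_imp_zero[OF G(7)] gx by blast
    qed
    moreover have "h \<ge> 0" unfolding h_def H_def by (intro integral_nonneg_AE) (simp add: nn)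
    ultimately show ?thesis by simp
  qed
  have lower: "h \<le> H (\<delta> k) a" for k
    unfolding h_def H_def using iH[OF zero_less_one] iH[OF \<delta>(1)]
    by (intro integral_mono mult_left_mono nonneg reg_potential_antimono \<delta> \<alpha>)
  \<comment> \<open>The potential at \<open>X N\<close> is split at distance r = 1 / (k + 1) from
    that point. Since g \<le> B, the near part is at most \<open>B * R k\<close> for all N and
    \<delta>; \<open>T N\<close> below bounds the far part.\<close>
  define R where "R = (\<lambda>k::nat. \<integral>z. indicator (ball 0 (1 / real (Suc k))) z * trunc_kernel \<alpha> (z::'a) \<partial>lborel)"
  have "R \<longlonglongrightarrow> (\<integral>z. 0 \<partial>(lborel :: 'a measure))"
    unfolding R_def
  proof (rule integral_dominated_convergence[where w="trunc_kernel \<alpha>"])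
    show "AE z in lborel. (\<lambda>k. indicator (ball 0 (1 / real (Suc k))) z * trunc_kernel \<alpha> (z::'a)) \<longlonglongrightarrow> 0"
    proof (intro always_eventually allI)
      fix z :: 'a
      show "(\<lambda>k. indicator (ball 0 (1 / real (Suc k))) z * trunc_kernel \<alpha> z) \<longlonglongrightarrow> 0"
      proof (cases "z = 0")
        case False
        obtain k0 where k0: "1 / real (Suc k0) < norm z"
          using False nat_approx_posE[of "norm z"] by auto
        have "eventually (\<lambda>k. indicator (ball 0 (1 / real (Suc k))) z * trunc_kernel \<alpha> z = 0) sequentially"
          using eventually_ge_at_top[of k0]
        proof eventually_elim
          case (elim k)
          have "1 / real (Suc k) \<le> 1 / real (Suc k0)" using elim by (simp add: frac_le)
          hence "z \<notin> ball 0 (1 / real (Suc k))" using k0 by simp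
          thus ?case by simp
        qed
        thus ?thesis by (rule tendsto_eventually)
      qed (simp add: trunc_kernel_def)
    qed
    show "AE z in lborel. norm (indicator (ball 0 (1 / real (Suc k))) z * trunc_kernel \<alpha> (z::'a)) \<le> trunc_kernel \<alpha> z" for k
      by (auto simp: indicator_def trunc_kernel_nonneg)
    show "(\<lambda>z. indicator (ball 0 (1 / real (Suc k))) z * trunc_kernel \<alpha> (z::'a)) \<in> borel_measurable lborel" for k
      by (intro borel_measurable_times borel_measurable_indicator) (simp_all add: trunc_kernel_measurable)
  qed (use integrable_trunc_kernel[OF \<alpha>] in auto)
  hence "(\<lambda>k. B * R k) \<longlonglongrightarrow> B * 0" by (intro tendsto_intros) simp
  hence "eventually (\<lambda>k. B * R k < h / 4) sequentially" using h by (intro order_tendstoD(2)) auto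
  then obtain k where k: "B * R k < h / 4" by (auto simp: eventually_sequentially)
  define r where "r = 1 / real (Suc k)"
  have r: "0 < r" "r \<le> 1" by (auto simp: r_def)
  \<comment> \<open>Beyond distance r the kernel is at most r ^ (- m), so dominated convergence with
    the integrable function \<open>g\<close> sends the far part to 0 as N grows, although
    \<open>g\<close> need not have compact support.\<close>
  define T where "T = (\<lambda>N::nat. \<integral>y. g y * (indicator (- ball 0 r) (y - X N) * norm (y - X N) powr - m) \<partial>lborel)"
  have Tb: "\<bar>indicator (- ball 0 r) z * norm z powr - m\<bar> \<le> r powr - m" for z :: 'a
    using r m by (auto simp: indicator_def intro!: powr_mono2')
  have iT: "integrable lborel (\<lambda>y. g y * (indicator (- ball 0 r) (y - v) * norm (y - v) powr - m))" for v
  proof (rule Bochner_Integration.integrable_bound)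
    show "integrable lborel (\<lambda>y. r powr - m * g y)" by (intro integrable_mult_right G(1))
    show "AE y in lborel. norm (g y * (indicator (- ball 0 r) (y - v) * norm (y - v) powr - m)) \<le> norm (r powr - m * g y)"
    proof (intro always_eventually allI)
      fix y
      show "norm (g y * (indicator (- ball 0 r) (y - v) * norm (y - v) powr - m)) \<le> norm (r powr - m * g y)"
        using mult_left_mono[OF Tb[of "y - v"] abs_ge_zero[of "g y"]] by (simp add: abs_mult mult.commute)
    qed
  qed measurable
  have "T \<longlonglongrightarrow> (\<integral>y. 0 \<partial>(lborel :: 'a measure))"
    unfolding T_def
  proof (rule integral_dominated_convergence[where w="\<lambda>y. r powr - m * g y"])
    show "integrable lborel (\<lambda>y. r powr - m * g y)" by (intro integrable_mult_right G(1))
    show "AE y in lborel. norm (g y * (indicator (- ball 0 r) (y - X N) * norm (y - X N) powr - m)) \<le> r powr - m * g y" for N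
    proof (intro always_eventually allI)
      fix y
      show "norm (g y * (indicator (- ball 0 r) (y - X N) * norm (y - X N) powr - m)) \<le> r powr - m * g y"
        using mult_left_mono[OF Tb[of "y - X N"] nonneg[of y]] nonneg[of y] by (simp add: abs_mult mult.commute)
    qed
    show "AE y in lborel. (\<lambda>N. g y * (indicator (- ball 0 r) (y - X N) * norm (y - X N) powr - m)) \<longlonglongrightarrow> 0"
    proof (intro always_eventually allI)
      fix y :: 'a
      have "filterlim (\<lambda>N. real N) at_top sequentially" by (rule filterlim_real_sequentially)
      hence F1: "filterlim (\<lambda>N. (2 - norm y) + real N) at_top sequentially"
        by (rule filterlim_tendsto_add_at_top[OF tendsto_const])
      have F2: "(2 - norm y) + real N \<le> norm (y - X N)" for N
        using norm_triangle_ineq2[of "X N" y] nX[of "real N"] by (simp add: X_def norm_minus_commute)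
      have "filterlim (\<lambda>N. norm (y - X N)) at_top sequentially"
        by (rule filterlim_at_top_mono[OF F1 always_eventually[OF allI[OF F2]]])
      hence "(\<lambda>N. norm (y - X N) powr - m) \<longlonglongrightarrow> 0"
        using m by (intro tendsto_neg_powr) auto
      hence "(\<lambda>N. indicator (- ball 0 r) (y - X N) * norm (y - X N) powr - m) \<longlonglongrightarrow> 0"
        by (rule Lim_null_comparison[rotated]) (auto simp: indicator_def)
      thus "(\<lambda>N. g y * (indicator (- ball 0 r) (y - X N) * norm (y - X N) powr - m)) \<longlonglongrightarrow> 0"
        by (rule tendsto_mult_right_zero)
    qed
  qed measurable
  hence "eventually (\<lambda>N. T N < h / 4) sequentially" using h by (intro order_tendstoD(2)) auto
  then obtain N where N: "T N < h / 4" by (auto simp: eventually_sequentially)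
  have upper: "H \<delta> (X N) \<le> B * R k + T N" if \<delta>: "\<delta> > 0" for \<delta>
  proof -
    have iR: "integrable lborel (\<lambda>z::'a. indicator (ball 0 r) z * trunc_kernel \<alpha> z)"
      by (rule Bochner_Integration.integrable_bound[OF integrable_trunc_kernel[OF \<alpha>]])
         (auto simp: indicator_def trunc_kernel_nonneg)
    have i1: "integrable lborel (\<lambda>y. B * (indicator (ball 0 r) (y - X N) * trunc_kernel \<alpha> (y - X N)))"
      using integrable_lborel_translate[OF iR, of "- X N"] by (intro integrable_mult_right) simp
    have "H \<delta> (X N) \<le> (\<integral>y. B * (indicator (ball 0 r) (y - X N) * trunc_kernel \<alpha> (y - X N))
        + g y * (indicator (- ball 0 r) (y - X N) * norm (y - X N) powr - m) \<partial>lborel)"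
      unfolding H_def
    proof (rule integral_mono_AE)
      \<comment> \<open>At \<open>y = X N\<close> the majorant is 0, because
        \<open>0 powr a = 0\<close>, and the inequality can fail; one point is negligible.\<close>
      have "AE y in lborel. y \<noteq> X N" by (rule AE_lborel_singleton)
      thus "AE y in lborel. g y * reg_potential \<alpha> \<delta> (y - X N)
          \<le> B * (indicator (ball 0 r) (y - X N) * trunc_kernel \<alpha> (y - X N))
          + g y * (indicator (- ball 0 r) (y - X N) * norm (y - X N) powr - m)"
      proof eventually_elim
        case (elim y)
        define z where "z = y - X N"
        have z: "z \<noteq> 0" using elim by (simp add: z_def)
        have le: "reg_potential \<alpha> \<delta> z \<le> norm z powr - m"
          using reg_potential_le[OF z \<alpha>(1)] by (simp add: m_def n_def)
        have "norm z powr - m = trunc_kernel \<alpha> z" if "norm z < r"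
        proof -
          have "norm z powr - m = norm z powr (1 + - (real DIM('a) + \<alpha>))" by (simp add: m_def n_def algebra_simps)
          also have "\<dots> = norm z * norm z powr - (real DIM('a) + \<alpha>)"
            unfolding powr_add using z by simp
          finally show ?thesis using that r by (simp add: trunc_kernel_def min_def)
        qed
        moreover have "g y * reg_potential \<alpha> \<delta> z \<le> g y * norm z powr - m"
          using le nonneg by (rule mult_left_mono)
        moreover have "g y * norm z powr - m \<le> B * norm z powr - m"
          using G(2)[of y] by (intro mult_right_mono) auto
        ultimately show ?case unfolding z_def[symmetric]
          by (cases "norm z < r") auto
      qed
    qed (use iH[OF \<delta>] i1 iT in auto)
    also have "\<dots> = (\<integral>y. B * (indicator (ball 0 r) (y - X N) * trunc_kernel \<alpha> (y - X N)) \<partial>lborel) + T N"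
      unfolding T_def by (rule Bochner_Integration.integral_add[OF i1 iT])
    also have "(\<integral>y. B * (indicator (ball 0 r) (y - X N) * trunc_kernel \<alpha> (y - X N)) \<partial>lborel) = B * R k"
    proof -
      have "(\<lambda>z::'a. indicator (ball 0 r) z * trunc_kernel \<alpha> z) \<in> borel_measurable borel"
        using borel_measurable_integrable[OF iR] by simp
      from integral_lborel_translate[OF this, of "- X N"] show ?thesis
        by (simp add: R_def r_def)
    qed
    finally show ?thesis .
  qed
  \<comment> \<open>The order of choices matters: r first, then N, and only now \<delta>, since the
    error grows linearly in N. Near part, far part and error are below h / 4, h / 4 and h / 2, so
    the potential at \<open>a\<close> would be less than h.\<close>
  define \<eta> where "\<eta> = (\<lambda>k. \<integral>z. norm (reg_kernel \<alpha> (\<delta> k) z - riesz_kernel \<alpha> (z::'a)) * min 1 (norm z) \<partial>lborel)"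
  have "\<eta> \<longlonglongrightarrow> 0" unfolding \<eta>_def \<delta>_def by (rule reg_kernel_L1_tendsto[OF \<alpha>])
  hence "(\<lambda>k. m * (2 * B * \<eta> k) * real N) \<longlonglongrightarrow> m * (2 * B * 0) * real N" by (intro tendsto_intros)
  hence "eventually (\<lambda>k. m * (2 * B * \<eta> k) * real N < h / 2) sequentially"
    using h by (intro order_tendstoD(2)) auto
  then obtain j where j: "m * (2 * B * \<eta> j) * real N < h / 2" by (auto simp: eventually_sequentially)
  have "\<bar>H (\<delta> j) (X N) - H (\<delta> j) a\<bar> \<le> m * (2 * B * \<eta> j) * real N"
    using reg_potential_convolution_increment[OF g \<alpha> \<delta>(1)[of j] e van, of "real N"]
    unfolding H_def X_def \<eta>_def m_def n_def by (simp add: diff_diff_eq)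
  thus False using lower[of j] upper[OF \<delta>(1), of j] k N j by linarith
qed

section \<open>The fractional Laplacian of a bump function\<close>

lemma has_real_derivative_pos_part_square:
  "((\<lambda>a::real. (max 0 a)\<^sup>2) has_real_derivative 2 * max 0 a) (at a)"
proof -
  consider "a > 0" | "a < 0" | "a = 0" by linarith
  thus ?thesis
  proof cases
    case 1
    have "((\<lambda>a. a\<^sup>2) has_real_derivative 2 * a) (at a)"
      by (auto intro!: derivative_eq_intros)
    hence "((\<lambda>a. (max 0 a)\<^sup>2) has_real_derivative 2 * a) (at a)"
      by (rule has_field_derivative_transform_within_open[of _ _ _ "{0<..}"]) (use 1 in auto)
    thus ?thesis using 1 by simp
  next
    case 2
    have "((\<lambda>a. 0) has_real_derivative 0) (at a)" by simp
    hence "((\<lambda>a. (max 0 a)\<^sup>2) has_real_derivative 0) (at a)"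
      by (rule has_field_derivative_transform_within_open[of _ _ _ "{..<0}"]) (use 2 in auto)
    thus ?thesis using 2 by simp
  next
    case 3
    have "(\<lambda>h. ((max 0 (0 + h))\<^sup>2 - (max 0 0)\<^sup>2) / h) \<midarrow>0\<rightarrow> (0::real)"
    proof (rule Lim_null_comparison)
      show "\<forall>\<^sub>F h in at 0. norm (((max 0 (0 + h))\<^sup>2 - (max 0 0)\<^sup>2) / h) \<le> \<bar>h :: real\<bar>"
        by (intro always_eventually allI) (auto simp: max_def power2_eq_square)
    qed (auto intro!: tendsto_eq_intros)
    thus ?thesis using 3 by (simp add: DERIV_def)
  qed
qed

text \<open>A function with Lipschitz gradient is enough, because only second differences are
  estimated. Squaring the positive part achieves this with a polynomial inside the ball and with
  explicit constants.\<close>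

definition bump :: "'a::euclidean_space \<Rightarrow> real" where
  "bump x = (max 0 (1 - (norm x)\<^sup>2))\<^sup>2"

lemma bump_nonneg: "bump x \<ge> 0" and bump_le_1: "bump x \<le> 1"
proof -
  show "bump x \<ge> 0" by (simp add: bump_def)
  have "(max 0 (1 - (norm x)\<^sup>2))\<^sup>2 \<le> 1\<^sup>2" by (intro power_mono) auto
  thus "bump x \<le> 1" by (simp add: bump_def)
qed

lemma bump_eq_0: "norm x \<ge> 1 \<Longrightarrow> bump x = 0"
  using power_mono[of 1 "norm x" 2] by (simp add: bump_def)

definition bump_gradient :: "'a::euclidean_space \<Rightarrow> 'a" where
  "bump_gradient x = (- 4 * max 0 (1 - (norm x)\<^sup>2)) *\<^sub>R x"

lemma has_derivative_bump:
  "(bump has_derivative (\<lambda>h. bump_gradient x \<bullet> h)) (at x)"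
proof -
  have 1: "((\<lambda>x::'a. 1 - (norm x)\<^sup>2) has_derivative (\<lambda>h. - 2 * (x \<bullet> h))) (at x)"
    unfolding power2_norm_eq_inner
    by (auto intro!: derivative_eq_intros simp: inner_commute)
  have "(bump has_derivative (\<lambda>h. (- 2 * (x \<bullet> h)) * (2 * max 0 (1 - (norm x)\<^sup>2)))) (at x)"
    unfolding bump_def[abs_def]
    using has_derivative_compose[OF 1 has_real_derivative_pos_part_square[THEN has_field_derivative_imp_has_derivative]]
    by (simp add: mult.commute)
  moreover have "(- 2 * (x \<bullet> h)) * (2 * max 0 (1 - (norm x)\<^sup>2)) = bump_gradient x \<bullet> h" for h
    by (simp add: bump_gradient_def)
  ultimately show ?thesis by simp
qed

lemma norm_bump_gradient_le: "norm (bump_gradient x) \<le> 4"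
proof (cases "norm x \<le> 1")
  case True
  have "\<bar>max 0 (1 - (norm x)\<^sup>2)\<bar> * norm x \<le> 1 * 1"
    using True by (intro mult_mono) auto
  thus ?thesis by (simp add: bump_gradient_def abs_mult)
next
  case False
  hence "(norm x)\<^sup>2 \<ge> 1" using power_mono[of 1 "norm x" 2] by simp
  thus ?thesis by (simp add: bump_gradient_def)
qed

text \<open>The constant is 4 (2 + 1). The factor \<open>m\<close> is Lipschitz with constant 2, as
  it equals 1 - (min 1 |x|)^2; multiplied by a vector in the unit ball this gives 2, and m \<le> 1
  gives the remaining 1. By symmetry the vector in the ball may be either point, and if both lie
  outside there is nothing to show.\<close>

lemma bump_gradient_lipschitz:
  "norm (bump_gradient x - bump_gradient y) \<le> 12 * norm (x - y)"
  for x y :: "'a::euclidean_space"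
proof -
  define m where "m = (\<lambda>x::'a. max 0 (1 - (norm x)\<^sup>2))"
  have m0: "m x = 0" if "norm x \<ge> 1" for x
    using power_mono[of 1 "norm x" 2] that by (simp add: m_def)
  have m1: "0 \<le> m x" "m x \<le> 1" for x by (auto simp: m_def)
  have m2: "m x = 1 - (min 1 (norm x))\<^sup>2" for x
    using m0[of x] power_le_one[of "norm x" 2] by (auto simp: m_def min_def)
  have ml: "\<bar>m x - m y\<bar> \<le> 2 * norm (x - y)" for x y
  proof -
    define a b where "a = min 1 (norm x)" and "b = min 1 (norm y)"
    have "\<bar>a - b\<bar> \<le> \<bar>norm x - norm y\<bar>" by (auto simp: a_def b_def min_def)
    hence ab: "\<bar>a - b\<bar> \<le> norm (x - y)" using norm_triangle_ineq3[of x y] by linarith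
    have "m x - m y = (b - a) * (b + a)" by (simp add: m2 a_def b_def power2_eq_square algebra_simps)
    hence "\<bar>m x - m y\<bar> = \<bar>a - b\<bar> * \<bar>b + a\<bar>" by (simp add: abs_mult abs_minus_commute)
    also have "\<dots> \<le> norm (x - y) * 2"
      using ab by (intro mult_mono) (auto simp: a_def b_def min_def)
    finally show ?thesis by simp
  qed
  have main: "norm (m x *\<^sub>R x - m y *\<^sub>R y) \<le> 3 * norm (x - y)" if "norm x \<le> 1" for x y
  proof -
    have "m x *\<^sub>R x - m y *\<^sub>R y = (m x - m y) *\<^sub>R x + m y *\<^sub>R (x - y)" by (simp add: algebra_simps)
    hence "norm (m x *\<^sub>R x - m y *\<^sub>R y) \<le> \<bar>m x - m y\<bar> * norm x + m y * norm (x - y)"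
      using norm_triangle_ineq[of "(m x - m y) *\<^sub>R x" "m y *\<^sub>R (x - y)"] m1[of y] by simp
    moreover have "\<bar>m x - m y\<bar> * norm x \<le> (2 * norm (x - y)) * 1"
      using ml[of x y] that by (intro mult_mono) auto
    moreover have "m y * norm (x - y) \<le> 1 * norm (x - y)" using m1[of y] by (intro mult_right_mono) auto
    ultimately show ?thesis by linarith
  qed
  have "norm (m x *\<^sub>R x - m y *\<^sub>R y) \<le> 3 * norm (x - y)"
  proof (cases "norm x \<le> 1")
    case False
    show ?thesis
    proof (cases "norm y \<le> 1")
      case True
      thus ?thesis using main[OF True, of x] by (simp add: norm_minus_commute)
    qed (use False m0 in auto)
  qed (rule main)
  moreover have "bump_gradient x - bump_gradient y = (- 4) *\<^sub>R (m x *\<^sub>R x - m y *\<^sub>R y)"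
    by (simp add: bump_gradient_def m_def algebra_simps)
  ultimately show ?thesis by (simp only: norm_scaleR)
qed

lemma bump_lipschitz: "\<bar>bump x - bump y\<bar> \<le> 4 * norm (x - y)" for x y :: "'a::euclidean_space"
proof -
  have "norm (bump x - bump y) \<le> 4 * norm (x - y)"
  proof (rule differentiable_bound[of UNIV])
    fix x :: 'a
    show "(bump has_derivative (\<lambda>h. bump_gradient x \<bullet> h)) (at x within UNIV)"
      by (rule has_derivative_bump)
    show "onorm (\<lambda>h. bump_gradient x \<bullet> h) \<le> 4"
    proof (rule onorm_le)
      fix h
      show "norm (bump_gradient x \<bullet> h) \<le> 4 * norm h"
        using Cauchy_Schwarz_ineq2[of "bump_gradient x" h] mult_right_mono[OF norm_bump_gradient_le[of x] norm_ge_zero[of h]]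
        by simp
    qed
  qed auto
  thus ?thesis by simp
qed

text \<open>Mean value inequality for x -> \<open>bump (x + y) - bump x\<close>, whose gradient is
  at most 12 |y| because the gradient of the bump is Lipschitz.\<close>

lemma bump_second_difference:
  "\<bar>(bump (a + y) - bump a) - (bump (b + y) - bump b)\<bar> \<le> 12 * norm y * norm (a - b)"
  for y a b :: "'a::euclidean_space"
proof -
  have "norm ((bump (a + y) - bump a) - (bump (b + y) - bump b)) \<le> (12 * norm y) * norm (a - b)"
  proof (rule differentiable_bound[of UNIV "\<lambda>x. bump (x + y) - bump x"])
    fix x :: 'a
    have "((\<lambda>x. bump (x + y)) has_derivative (\<lambda>h. bump_gradient (x + y) \<bullet> h)) (at x)"
      by (rule has_derivative_compose[OF _ has_derivative_bump]) (auto intro!: derivative_eq_intros)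
    hence "((\<lambda>x. bump (x + y) - bump x) has_derivative (\<lambda>h. bump_gradient (x + y) \<bullet> h - bump_gradient x \<bullet> h)) (at x)"
      by (intro has_derivative_diff has_derivative_bump)
    thus "((\<lambda>x. bump (x + y) - bump x) has_derivative (\<lambda>h. (bump_gradient (x + y) - bump_gradient x) \<bullet> h)) (at x within UNIV)"
      by (simp add: inner_diff_left)
    show "onorm (\<lambda>h. (bump_gradient (x + y) - bump_gradient x) \<bullet> h) \<le> 12 * norm y"
    proof (rule onorm_le)
      fix h
      show "norm ((bump_gradient (x + y) - bump_gradient x) \<bullet> h) \<le> 12 * norm y * norm h"
        using Cauchy_Schwarz_ineq2[of "bump_gradient (x + y) - bump_gradient x" h]
          mult_right_mono[OF bump_gradient_lipschitz[of "x + y" x] norm_ge_zero[of h]]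
        by simp
    qed
  qed auto
  thus ?thesis by simp
qed

lemma continuous_on_bump: "continuous_on S bump"
  unfolding bump_def[abs_def] by (intro continuous_intros)

lemma bump_measurable [measurable]: "bump \<in> borel_measurable borel"
  by (intro borel_measurable_continuous_onI continuous_on_bump)

definition bump_increment :: "'a::euclidean_space \<Rightarrow> 'a \<Rightarrow> real" where
  "bump_increment w x = bump (x + w) - bump x"

lemma bump_increment_measurable [measurable (raw)]:
  assumes [measurable]: "f \<in> borel_measurable M" "g \<in> borel_measurable M"
  shows "(\<lambda>x. bump_increment (f x) (g x)) \<in> borel_measurable M"
  unfolding bump_increment_def by measurable

lemma bump_increment_le: "\<bar>bump_increment w x\<bar> \<le> 4 * min 1 (norm w)"
proof -
  have "\<bar>bump_increment w x\<bar> \<le> 4 * norm w"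
    using bump_lipschitz[of "x + w" x] by (simp add: bump_increment_def)
  moreover have "\<bar>bump_increment w x\<bar> \<le> 1"
    using bump_nonneg[of x] bump_nonneg[of "x + w"] bump_le_1[of x] bump_le_1[of "x + w"]
    by (simp add: bump_increment_def abs_le_iff)
  ultimately show ?thesis by (simp add: min_def)
qed

text \<open>The product form is the point: one factor tames each of the two singular kernels, so
  that the double integral over \<open>w\<close> and the second shift converges absolutely. The
  second difference bound handles small shifts, the cruder ones the shifts of length above
  1.\<close>

lemma bump_increment_lipschitz:
  "\<bar>bump_increment w x - bump_increment w y\<bar> \<le> 12 * min 1 (norm w) * min 1 (norm (x - y))"
proof -
  let ?D = "\<bar>bump_increment w x - bump_increment w y\<bar>"
  have 1: "?D \<le> 12 * norm w * norm (x - y)"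
    using bump_second_difference[of x w y] by (simp add: bump_increment_def)
  have 2: "?D \<le> 8 * min 1 (norm w)"
    using bump_increment_le[of w x] bump_increment_le[of w y] by linarith
  have 3: "?D \<le> 8 * norm (x - y)"
    using bump_lipschitz[of "x + w" "y + w"] bump_lipschitz[of x y]
    by (simp add: bump_increment_def abs_le_iff)
  have 4: "0 \<le> norm w" "0 \<le> norm (x - y)" by auto
  show ?thesis
    using 1 2 3 4 by (cases "norm w \<le> 1"; cases "norm (x - y) \<le> 1") (auto simp: min_def)
qed

text \<open>Both bounds hold because the functions vanish outside a union of two respectively four unit balls.\<close>

lemma bump_increment_L1:
  fixes w z :: "'a::euclidean_space"
  defines "\<omega> \<equiv> measure lborel (ball (0::'a) 1)"
  shows integrable_bump_increment: "integrable lborel (bump_increment w)"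
    and "(\<integral>x. \<bar>bump_increment w x\<bar> \<partial>lborel) \<le> 8 * \<omega> * min 1 (norm w)"
    and "(\<integral>x. \<bar>bump_increment w (x + z) - bump_increment w x\<bar> \<partial>lborel) \<le> 48 * \<omega> * min 1 (norm w) * min 1 (norm z)"
proof -
  have i: "integrable lborel (indicat_real (ball c 1))" for c :: 'a
    by (intro integrable_real_indicator) (auto simp: emeasure_ball)
  have I: "(\<integral>x. indicat_real (ball (- c) 1) x \<partial>lborel) = \<omega>" for c :: 'a
  proof -
    have "(\<integral>x. indicat_real (ball (- c) 1) x \<partial>lborel) = (\<integral>x. indicat_real (ball (- c) 1) (- c + x) \<partial>lborel)"
      by (intro integral_lborel_translate[symmetric] borel_measurable_indicator) simp
    also have "(\<lambda>x. indicat_real (ball (- c) 1) (- c + x)) = indicat_real (ball 0 1)"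
      by (auto simp: indicator_def dist_norm fun_eq_iff)
    finally show ?thesis by (simp add: \<omega>_def)
  qed
  have out: "bump (x + c) = 0" if "x \<notin> ball (- c) 1" for x c :: 'a
    using that by (intro bump_eq_0) (simp add: dist_norm norm_minus_commute add.commute)
  \<comment> \<open>The indicators of the balls that carry x -> \<open>bump (x + w)\<close> and the
    bump itself. Writing the second centre as \<open>- 0\<close> makes \<open>I\<close> and
    \<open>out\<close> apply to both; the four balls arise below by adding the translate by
    \<open>z\<close>.\<close>
  define b where "b = (\<lambda>w x::'a. indicat_real (ball (- w) 1) x + indicat_real (ball (- 0) 1) x)"
  have b0: "bump_increment w x = 0" if "b w x = 0" for w x
  proof -
    have "x \<notin> ball (- w) 1" "x \<notin> ball (- 0) 1" using that
      by (auto simp: b_def indicator_def add_nonneg_eq_0_iff simp del: of_bool_eq_0_iff split: if_splits)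
    thus ?thesis using out[of x w] out[of x 0] by (simp add: bump_increment_def)
  qed
  have b1: "b w x \<ge> 1" if "b w x \<noteq> 0" for w x
    using that by (auto simp: b_def indicator_def)
  have bn: "b w x \<ge> 0" for w x by (simp add: b_def)
  have ib: "integrable lborel (b w)" for w unfolding b_def by (intro Bochner_Integration.integrable_add i)
  have Ib: "(\<integral>x. b w x \<partial>lborel) = 2 * \<omega>" for w
    unfolding b_def using I[of w] I[of 0] by (subst Bochner_Integration.integral_add) (simp_all add: i del: minus_zero)
  have le1: "\<bar>bump_increment w x\<bar> \<le> 4 * min 1 (norm w) * b w x" for x
  proof (cases "b w x = 0")
    case False
    have "4 * min 1 (norm w) * 1 \<le> 4 * min 1 (norm w) * b w x"
      using b1[OF False] by (intro mult_left_mono) auto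
    thus ?thesis using bump_increment_le[of w x] by linarith
  qed (simp add: b0)
  show int: "integrable lborel (bump_increment w)"
    by (rule Bochner_Integration.integrable_bound[OF integrable_mult_right[OF ib[of w], of "4 * min 1 (norm w)"]])
       (use le1 bn in \<open>auto simp: abs_mult\<close>)
  have "(\<integral>x. \<bar>bump_increment w x\<bar> \<partial>lborel) \<le> (\<integral>x. 4 * min 1 (norm w) * b w x \<partial>lborel)"
    by (intro integral_mono integrable_abs int integrable_mult_right ib le1)
  thus "(\<integral>x. \<bar>bump_increment w x\<bar> \<partial>lborel) \<le> 8 * \<omega> * min 1 (norm w)" by (simp add: Ib mult_ac)
  define d where "d = (\<lambda>x. b w (z + x) + b w x)"
  have id: "integrable lborel d"
    unfolding d_def by (intro Bochner_Integration.integrable_add ib integrable_lborel_translate)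
  have [measurable]: "b w \<in> borel_measurable borel" using ib by auto
  have Id: "(\<integral>x. d x \<partial>lborel) = 4 * \<omega>"
    unfolding d_def using integral_lborel_translate[of "b w" z]
    by (subst Bochner_Integration.integral_add) (simp_all add: ib Ib integrable_lborel_translate)
  have le2: "\<bar>bump_increment w (x + z) - bump_increment w x\<bar> \<le> 12 * min 1 (norm w) * min 1 (norm z) * d x" for x
  proof (cases "d x \<ge> 1")
    case True
    have "12 * min 1 (norm w) * min 1 (norm z) * 1 \<le> 12 * min 1 (norm w) * min 1 (norm z) * d x"
      using True by (intro mult_left_mono) auto
    thus ?thesis using bump_increment_lipschitz[of w "x + z" x] by simp
  next
    case False
    hence "b w (z + x) = 0" "b w x = 0"
      using b1[of w "z + x"] b1[of w x] bn[of w "z + x"] bn[of w x] unfolding d_def by linarith+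
    thus ?thesis using b0[of w "x + z"] b0[of w x] by (simp add: add.commute d_def)
  qed
  have int2: "integrable lborel (\<lambda>x. bump_increment w (x + z) - bump_increment w x)"
    using integrable_lborel_translate[OF int, of z] int by (simp add: add.commute)
  have "(\<integral>x. \<bar>bump_increment w (x + z) - bump_increment w x\<bar> \<partial>lborel) \<le> (\<integral>x. 12 * min 1 (norm w) * min 1 (norm z) * d x \<partial>lborel)"
    by (intro integral_mono integrable_abs int2 integrable_mult_right id le2)
  thus "(\<integral>x. \<bar>bump_increment w (x + z) - bump_increment w x\<bar> \<partial>lborel) \<le> 48 * \<omega> * min 1 (norm w) * min 1 (norm z)"
    by (simp add: Id mult_ac)
qed

text \<open>Up to a constant factor, \<open>- (- \<Delta>) ^ (s / 2)\<close> applied to the bump function.\<close>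

definition frac_bump :: "real \<Rightarrow> 'a::euclidean_space \<Rightarrow> real" where
  "frac_bump s x = (\<integral>w. bump_increment w x * norm w powr - (real DIM('a) + s) \<partial>lborel)"

lemma min_norm_powr_eq_trunc_kernel:
  "min 1 (norm w) * norm w powr - (real DIM('a) + s) = trunc_kernel s w" for w :: "'a::euclidean_space"
  by (simp add: trunc_kernel_def)

lemma integrable_frac_bump_integrand:
  fixes x :: "'a::euclidean_space"
  assumes s: "0 < s" "s < 1"
  shows "integrable lborel (\<lambda>w. bump_increment w x * norm w powr - (real DIM('a) + s))"
proof (rule Bochner_Integration.integrable_bound)
  show "integrable lborel (\<lambda>w::'a. 4 * trunc_kernel s w)"
    using integrable_trunc_kernel[OF s] by simp
  show "AE w in lborel. norm (bump_increment w x * norm w powr - (real DIM('a) + s)) \<le> norm (4 * trunc_kernel s w)"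
  proof (intro always_eventually allI)
    fix w :: 'a
    show "norm (bump_increment w x * norm w powr - (real DIM('a) + s)) \<le> norm (4 * trunc_kernel s w)"
      using mult_right_mono[OF bump_increment_le[of w x], of "norm w powr - (real DIM('a) + s)"]
      by (simp add: abs_mult trunc_kernel_def)
  qed
qed measurable

lemma frac_bump_diff:
  fixes x y :: "'a::euclidean_space"
  assumes s: "0 < s" "s < 1"
  shows "frac_bump s x - frac_bump s y = (\<integral>w. (bump_increment w x - bump_increment w y) * norm w powr - (real DIM('a) + s) \<partial>lborel)"
    and "integrable lborel (\<lambda>w. (bump_increment w x - bump_increment w y) * norm w powr - (real DIM('a) + s))"
  using integrable_frac_bump_integrand[OF s, of x] integrable_frac_bump_integrand[OF s, of y]
  by (simp_all add: frac_bump_def left_diff_distrib)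

text \<open>Each condition is inherited from the corresponding bound on
  \<open>bump_increment w\<close>: all of these carry a factor min 1 |w|, which turns the kernel in
  \<open>w\<close> into the integrable \<open>trunc_kernel s\<close>.\<close>

lemma lipschitz_L1_frac_bump:
  assumes s: "0 < s" "s < 1"
  shows "\<exists>B. lipschitz_L1 (frac_bump s :: 'a::euclidean_space \<Rightarrow> real) B"
proof -
  define I where "I = (\<integral>w. trunc_kernel s (w::'a) \<partial>lborel)"
  define \<omega> where "\<omega> = measure lborel (ball (0::'a) 1)"
  define k where "k = (\<lambda>w::'a. norm w powr - (real DIM('a) + s))"
  have [measurable]: "k \<in> borel_measurable borel" unfolding k_def by measurable
  have kt: "min 1 (norm w) * k w = trunc_kernel s w" for w by (simp add: k_def trunc_kernel_def)
  have k0: "k w \<ge> 0" for w by (simp add: k_def)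
  have it: "integrable lborel (\<lambda>w::'a. c * trunc_kernel s w)" for c
    by (intro integrable_mult_right integrable_trunc_kernel[OF s])
  have I0: "I \<ge> 0" unfolding I_def by (intro integral_nonneg_AE) (simp add: trunc_kernel_nonneg)
  have \<omega>0: "\<omega> \<ge> 0" by (simp add: \<omega>_def)
  have abs_le: "\<bar>\<integral>w. q w * k w \<partial>lborel\<bar> \<le> c * I"
    if "integrable lborel (\<lambda>w. q w * k w)" "\<And>w. \<bar>q w\<bar> \<le> c * min 1 (norm w)" for q c
  proof -
    have "\<bar>\<integral>w. q w * k w \<partial>lborel\<bar> \<le> (\<integral>w. \<bar>q w * k w\<bar> \<partial>lborel)"
      using integral_norm_bound[of lborel "\<lambda>w. q w * k w"] by simp
    also have "\<dots> \<le> (\<integral>w. c * trunc_kernel s (w::'a) \<partial>lborel)"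
    proof (rule integral_mono)
      show "integrable lborel (\<lambda>w. \<bar>q w * k w\<bar>)" by (intro integrable_abs that)
      show "integrable lborel (\<lambda>w::'a. c * trunc_kernel s w)" by (rule it)
      fix w
      show "\<bar>q w * k w\<bar> \<le> c * trunc_kernel s w"
        using mult_right_mono[OF that(2)[of w] k0[of w]] k0[of w] by (simp add: abs_mult mult.assoc kt)
    qed
    finally show ?thesis by (simp add: I_def)
  qed
  have fb: "frac_bump s x = (\<integral>w. bump_increment w x * k w \<partial>lborel)" for x :: 'a
    by (simp add: frac_bump_def k_def)
  have fbd: "frac_bump s x - frac_bump s y = (\<integral>w. (bump_increment w x - bump_increment w y) * k w \<partial>lborel)"
    "integrable lborel (\<lambda>w. (bump_increment w x - bump_increment w y) * k w)" for x y :: 'a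
    using frac_bump_diff[OF s, of x y] by (simp_all add: k_def)
  \<comment> \<open>One constant for all conditions: 12 I covers the supremum bound 4 I and the
    Lipschitz bound 12 I, and 48 \<omega> I the bound on the mean increments.\<close>
  define B where "B = (12 + 48 * \<omega>) * I"
  have B: "4 * I \<le> B" "12 * I \<le> B" "48 * \<omega> * I \<le> B"
    using I0 \<omega>0 by (simp_all add: B_def algebra_simps)
  have ip: "integrable (lborel \<Otimes>\<^sub>M lborel) (\<lambda>(w, x). bump_increment w x * k w)"
  proof (rule integrable_pair_lborelI)
    show "(\<lambda>(w, x). bump_increment w x * k w) \<in> borel_measurable (borel \<Otimes>\<^sub>M borel)" by measurable
    show "integrable lborel (\<lambda>w::'a. 8 * \<omega> * trunc_kernel s w)" by (rule it)
    fix w :: 'a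
    show "integrable lborel (\<lambda>x. bump_increment w x * k w)"
      by (intro integrable_mult_left integrable_bump_increment)
    show "(\<integral>x. norm (bump_increment w x * k w) \<partial>lborel) \<le> 8 * \<omega> * trunc_kernel s w"
      using mult_right_mono[OF bump_increment_L1(2)[of w] k0[of w]] k0[of w]
      by (simp add: abs_mult \<omega>_def mult.assoc kt)
  qed
  have ip2: "integrable (lborel \<Otimes>\<^sub>M lborel) (\<lambda>(w, x). (bump_increment w (x + z) - bump_increment w x) * k w)"
    and I2: "(\<integral>w. (\<integral>x. \<bar>(bump_increment w (x + z) - bump_increment w x) * k w\<bar> \<partial>lborel) \<partial>lborel) \<le> 48 * \<omega> * I * min 1 (norm z)"
    for z :: 'a
  proof -
    have i1: "integrable lborel (\<lambda>x. (bump_increment w (x + z) - bump_increment w x) * k w)" for w :: 'a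
      using integrable_lborel_translate[OF integrable_bump_increment[of w], of z] integrable_bump_increment[of w]
      by (intro integrable_mult_left) (simp add: add.commute)
    have le: "(\<integral>x. \<bar>(bump_increment w (x + z) - bump_increment w x) * k w\<bar> \<partial>lborel) \<le> 48 * \<omega> * min 1 (norm z) * trunc_kernel s w" for w :: 'a
    proof -
      have "(\<integral>x. \<bar>(bump_increment w (x + z) - bump_increment w x) * k w\<bar> \<partial>lborel) = (\<integral>x. \<bar>bump_increment w (x + z) - bump_increment w x\<bar> \<partial>lborel) * k w"
        using k0[of w] by (simp add: abs_mult)
      also have "\<dots> \<le> 48 * \<omega> * min 1 (norm w) * min 1 (norm z) * k w"
        unfolding \<omega>_def by (intro mult_right_mono bump_increment_L1(3) k0)
      also have "\<dots> = 48 * \<omega> * min 1 (norm z) * trunc_kernel s w" by (simp add: kt[symmetric] mult_ac)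
      finally show ?thesis .
    qed
    show ip: "integrable (lborel \<Otimes>\<^sub>M lborel) (\<lambda>(w, x). (bump_increment w (x + z) - bump_increment w x) * k w)"
      by (rule integrable_pair_lborelI[OF _ i1 it]) (use le in auto)
    have "integrable (lborel \<Otimes>\<^sub>M lborel) (\<lambda>(w, x). \<bar>(bump_increment w (x + z) - bump_increment w x) * k w\<bar>)"
      using integrable_abs[OF ip] by (simp add: case_prod_beta')
    from lborel_pair.integrable_fst[OF this]
    have "(\<integral>w. (\<integral>x. \<bar>(bump_increment w (x + z) - bump_increment w x) * k w\<bar> \<partial>lborel) \<partial>lborel) \<le> (\<integral>w. 48 * \<omega> * min 1 (norm z) * trunc_kernel s (w::'a) \<partial>lborel)"
      by (intro integral_mono it le) simp
    thus "(\<integral>w. (\<integral>x. \<bar>(bump_increment w (x + z) - bump_increment w x) * k w\<bar> \<partial>lborel) \<partial>lborel) \<le> 48 * \<omega> * I * min 1 (norm z)"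
      by (simp add: I_def mult_ac)
  qed
  have "lipschitz_L1 (frac_bump s :: 'a \<Rightarrow> real) B"
    unfolding lipschitz_L1_def
  proof (intro conjI allI)
    show "integrable lborel (frac_bump s :: 'a \<Rightarrow> real)"
      unfolding fb[abs_def] using lborel_pair.integrable_snd[OF ip] .
    fix x y z :: 'a
    have "\<bar>frac_bump s x\<bar> \<le> 4 * I"
      unfolding fb using integrable_frac_bump_integrand[OF s, of x] bump_increment_le
      by (intro abs_le) (auto simp: k_def)
    thus "\<bar>frac_bump s x\<bar> \<le> B" using B by linarith
    have "\<bar>frac_bump s x - frac_bump s y\<bar> \<le> (12 * norm (x - y)) * I"
      unfolding fbd(1)
    proof (intro abs_le fbd(2))
      fix w :: 'a
      have "12 * min 1 (norm w) * min 1 (norm (x - y)) \<le> 12 * min 1 (norm w) * norm (x - y)"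
        by (intro mult_left_mono) auto
      thus "\<bar>bump_increment w x - bump_increment w y\<bar> \<le> 12 * norm (x - y) * min 1 (norm w)"
        using bump_increment_lipschitz[of w x y] by (simp add: mult_ac)
    qed
    also have "\<dots> \<le> B * norm (x - y)"
      using mult_right_mono[OF B(2) norm_ge_zero[of "x - y"]] by (simp add: mult_ac)
    finally show "\<bar>frac_bump s x - frac_bump s y\<bar> \<le> B * norm (x - y)" .
    let ?P = "\<lambda>w x. (bump_increment w (x + z) - bump_increment w x) * k w"
    have ipa: "integrable (lborel \<Otimes>\<^sub>M lborel) (\<lambda>(w, x). \<bar>?P w x\<bar>)"
      using integrable_abs[OF ip2[of z]] by (simp add: case_prod_beta')
    have "(\<integral>x. \<bar>frac_bump s (x + z) - frac_bump s x\<bar> \<partial>lborel) = (\<integral>x. \<bar>\<integral>w. ?P w x \<partial>lborel\<bar> \<partial>lborel)"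
      by (simp add: fbd(1))
    also have "\<dots> \<le> (\<integral>x. (\<integral>w. \<bar>?P w x\<bar> \<partial>lborel) \<partial>lborel)"
    proof (rule integral_mono)
      show "integrable lborel (\<lambda>x. \<bar>\<integral>w. ?P w x \<partial>lborel\<bar>)"
        by (intro integrable_abs lborel_pair.integrable_snd[OF ip2[of z]])
      show "integrable lborel (\<lambda>x. \<integral>w. \<bar>?P w x\<bar> \<partial>lborel)"
        by (rule lborel_pair.integrable_snd[OF ipa])
      show "\<bar>\<integral>w. ?P w x \<partial>lborel\<bar> \<le> (\<integral>w. \<bar>?P w x\<bar> \<partial>lborel)" for x
        using integral_norm_bound[of lborel "\<lambda>w. ?P w x"] by simp
    qed
    also have "\<dots> = (\<integral>w. (\<integral>x. \<bar>?P w x\<bar> \<partial>lborel) \<partial>lborel)"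
      using lborel_pair.integral_fst[OF ipa] lborel_pair.integral_snd[OF ipa] by simp
    also have "\<dots> \<le> 48 * \<omega> * I * min 1 (norm z)" by (rule I2)
    also have "\<dots> \<le> B * min 1 (norm z)" using B(3) by (intro mult_right_mono) auto
    finally show "(\<integral>x. \<bar>frac_bump s (x + z) - frac_bump s x\<bar> \<partial>lborel) \<le> B * min 1 (norm z)" .
  qed
  thus ?thesis ..
qed

text \<open>Outside the ball the subtracted value \<open>bump x\<close> is 0, so the integrand is
  non-negative. The factor \<open>bump (x + w)\<close> is continuous in \<open>w\<close> and equals
  1 at w = - x, so the integral cannot be 0.\<close>

lemma frac_bump_pos:
  fixes x :: "'a::euclidean_space"
  assumes s: "0 < s" "s < 1" and x: "norm x > 1"
  shows "frac_bump s x > 0"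
proof -
  define k where "k = (\<lambda>w::'a. norm w powr - (real DIM('a) + s))"
  have bx: "bump_increment w x = bump (x + w)" for w
    using bump_eq_0[of x] x by (simp add: bump_increment_def)
  have i: "integrable lborel (\<lambda>w. bump (x + w) * k w)"
    using integrable_frac_bump_integrand[OF s, of x] by (simp add: bx k_def)
  have nn: "bump (x + w) * k w \<ge> 0" for w by (simp add: bump_nonneg k_def)
  have eq: "frac_bump s x = (\<integral>w. bump (x + w) * k w \<partial>lborel)"
    by (simp add: frac_bump_def bx k_def)
  have "frac_bump s x \<noteq> 0"
  proof
    assume "frac_bump s x = 0"
    hence "AE w in lborel. bump (x + w) * k w = 0"
      unfolding eq using integral_nonneg_eq_0_iff_AE[OF i] nn by simp
    moreover have "AE w in lborel. w \<noteq> (0::'a)" by (rule AE_lborel_singleton)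
    ultimately have "AE w in lborel. bump (x + w) = 0" by eventually_elim (auto simp: k_def)
    moreover have "continuous_on UNIV (\<lambda>w. bump (x + w))"
      by (intro continuous_on_compose2[OF continuous_on_bump] continuous_intros) auto
    ultimately have "bump (x + - x) = 0" using AE_zero_continuous_imp_zero by blast
    thus False by (simp add: bump_def)
  qed
  moreover have "frac_bump s x \<ge> 0" unfolding eq by (intro integral_nonneg_AE) (simp add: nn)
  ultimately show ?thesis by simp
qed

section \<open>Composition of Riesz kernels\<close>

text \<open>Reduction to \<open>trunc_kernel (1/2)\<close>, where 1/2 is just some exponent in
  (0,1): the excess factor |p| ^ (- 1/2) is at most C min 1 |p| as soon as |p| \<ge> d.\<close>

lemma integrable_norm_powr_outside_ball:
  assumes d: "d > 0"
  shows "integrable lborel (\<lambda>p::'a::euclidean_space. indicator {p. d \<le> norm p} p * norm p powr - (real DIM('a) + 1))"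
proof (rule Bochner_Integration.integrable_bound)
  define C where "C = d powr - (1/2) / min 1 d"
  show "integrable lborel (\<lambda>p::'a. C * trunc_kernel (1/2) p)"
    by (intro integrable_mult_right integrable_trunc_kernel) auto
  have C: "C \<ge> 0" using d by (simp add: C_def)
  show "AE p in lborel. norm (indicator {p. d \<le> norm p} p * norm p powr - (real DIM('a) + 1)) \<le> norm (C * trunc_kernel (1/2) (p::'a))"
  proof (intro always_eventually allI)
    fix p :: 'a
    show "norm (indicator {p. d \<le> norm p} p * norm p powr - (real DIM('a) + 1)) \<le> norm (C * trunc_kernel (1/2) p)"
    proof (cases "d \<le> norm p")
      case True
      have "norm p powr - (1/2) \<le> d powr - (1/2)" using True d by (intro powr_mono2') auto
      moreover have "min 1 d \<le> min 1 (norm p)" using True by auto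
      moreover have "min 1 d > 0" using d by auto
      ultimately have "norm p powr - (1/2) * min 1 d \<le> d powr - (1/2) * min 1 (norm p)"
        by (intro mult_mono) auto
      hence le: "norm p powr - (1/2) \<le> C * min 1 (norm p)"
        using \<open>min 1 d > 0\<close> unfolding C_def by (simp add: pos_le_divide_eq)
      have "norm p powr - (real DIM('a) + 1) = norm p powr (- (1/2) + - (real DIM('a) + 1/2))"
        by (rule arg_cong[where f="\<lambda>e. norm p powr e"]) simp
      also have "\<dots> = norm p powr - (1/2) * norm p powr - (real DIM('a) + 1/2)" by (rule powr_add)
      also have "\<dots> \<le> C * min 1 (norm p) * norm p powr - (real DIM('a) + 1/2)"
        by (intro mult_right_mono le) auto
      finally show ?thesis using True C by (simp add: trunc_kernel_def abs_mult mult.assoc)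
    qed simp
  qed
qed measurable

lemma integrable_power2_add_powr:
  fixes r b :: real
  assumes r: "r > 0" and b: "2 * b \<ge> real DIM('a::euclidean_space) + 1 / 2"
  shows "integrable lborel (\<lambda>v::'a. (r\<^sup>2 + (norm v)\<^sup>2) powr - b)"
proof (rule Bochner_Integration.integrable_bound)
  \<comment> \<open>The bound 1 serves |v| \<ge> 1, where the form is at least |v|^2; the other one
    serves |v| < 1, where the form is at least r^2 and \<open>trunc_kernel (1/2) v\<close> is at
    least 1.\<close>
  define C where "C = max 1 (r powr - (2 * b))"
  show "integrable lborel (\<lambda>p::'a. C * trunc_kernel (1/2) p)"
    by (intro integrable_mult_right integrable_trunc_kernel) auto
  have b0: "b \<ge> 0" using b DIM_ge_1_real[where 'a='a] by linarith
  have "AE v in lborel. v \<noteq> (0::'a)" by (rule AE_lborel_singleton)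
  thus "AE v in lborel. norm ((r\<^sup>2 + (norm v)\<^sup>2) powr - b) \<le> norm (C * trunc_kernel (1/2) (v::'a))"
  proof eventually_elim
    case (elim v)
    have sq: "(x\<^sup>2) powr - b = x powr - (2 * b)" if "x \<ge> 0" for x :: real
      using power2_powr_half[OF that, of "- (2 * b)"] by simp
    show ?case
    proof (cases "norm v \<ge> 1")
      case True
      have "(r\<^sup>2 + (norm v)\<^sup>2) powr - b \<le> ((norm v)\<^sup>2) powr - b"
        using elim b0 by (intro powr_mono2') auto
      also have "\<dots> = norm v powr - (2 * b)" by (rule sq) simp
      also have "\<dots> \<le> norm v powr - (real DIM('a) + 1 / 2)" using True b by (intro powr_mono) auto
      also have "\<dots> = 1 * trunc_kernel (1/2) v" using True by (simp add: trunc_kernel_def)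
      also have "\<dots> \<le> C * trunc_kernel (1/2) v"
        by (intro mult_right_mono trunc_kernel_nonneg) (simp add: C_def)
      finally show ?thesis by simp
    next
      case False
      have "1 = norm v powr 0" using elim by simp
      also have "\<dots> \<le> norm v powr (1 + - (real DIM('a) + 1 / 2))"
      proof (rule powr_mono')
        show "1 + - (real DIM('a) + 1 / 2) \<le> 0" using DIM_ge_1_real[where 'a='a] by linarith
      qed (use False in auto)
      also have "\<dots> = norm v * norm v powr - (real DIM('a) + 1 / 2)"
        unfolding powr_add using elim by simp
      also have "\<dots> = trunc_kernel (1/2) v" using False by (simp add: trunc_kernel_def)
      finally have t: "1 \<le> trunc_kernel (1/2) v" .
      have "(r\<^sup>2 + (norm v)\<^sup>2) powr - b \<le> (r\<^sup>2) powr - b"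
        using r b0 by (intro powr_mono2') auto
      also have "\<dots> = r powr - (2 * b)" using r by (intro sq) simp
      also have "\<dots> \<le> C * 1" by (simp add: C_def)
      also have "\<dots> \<le> C * trunc_kernel (1/2) v" using t by (intro mult_left_mono) (auto simp: C_def)
      finally show ?thesis by simp
    qed
  qed
qed measurable

text \<open>The substitution y = z + w at fixed z. Translation invariance of the inner integral,
  first applied to norms with values in \<open>ennreal\<close>, carries integrability over;
  afterwards Fubini carries over the value.\<close>

lemma integrable_pair_shear:
  fixes g :: "'a::euclidean_space \<Rightarrow> 'a \<Rightarrow> 'c::{banach, second_countable_topology}"
  assumes [measurable]: "case_prod g \<in> borel_measurable (borel \<Otimes>\<^sub>M borel)"
    and i: "integrable (lborel \<Otimes>\<^sub>M lborel) (\<lambda>(z, w). g z (z + w))"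
  shows "integrable (lborel \<Otimes>\<^sub>M lborel) (case_prod g)"
    and "integral\<^sup>L (lborel \<Otimes>\<^sub>M lborel) (\<lambda>(z, w). g z (z + w)) = integral\<^sup>L (lborel \<Otimes>\<^sub>M lborel) (case_prod g)"
proof -
  have m1: "g z \<in> borel_measurable borel" for z
    using measurable_Pair2[of "case_prod g" borel borel borel z] by simp
  have "(\<integral>\<^sup>+p. ennreal (norm (case_prod g p)) \<partial>(lborel \<Otimes>\<^sub>M lborel)) = (\<integral>\<^sup>+z. (\<integral>\<^sup>+y. ennreal (norm (g z y)) \<partial>lborel) \<partial>lborel)"
    by (subst lborel.nn_integral_fst[symmetric]) (simp_all)
  also have "\<dots> = (\<integral>\<^sup>+z. (\<integral>\<^sup>+w. ennreal (norm (g z (z + w))) \<partial>lborel) \<partial>lborel)"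
    using m1 by (intro nn_integral_cong nn_integral_lborel_translate[symmetric]) measurable
  also have "\<dots> = (\<integral>\<^sup>+p. ennreal (norm (case p of (z, w) \<Rightarrow> g z (z + w))) \<partial>(lborel \<Otimes>\<^sub>M lborel))"
    using borel_measurable_integrable[OF i] by (subst lborel.nn_integral_fst[symmetric]) (simp_all)
  also have "\<dots> < \<infinity>" using i by (simp add: integrable_iff_bounded)
  finally show ig: "integrable (lborel \<Otimes>\<^sub>M lborel) (case_prod g)"
    by (intro integrableI_bounded) simp_all
  have "(\<integral>z. (\<integral>w. g z (z + w) \<partial>lborel) \<partial>lborel) = (\<integral>z. (\<integral>y. g z y \<partial>lborel) \<partial>lborel)"
    using m1 by (intro Bochner_Integration.integral_cong refl integral_lborel_translate)
  thus "integral\<^sup>L (lborel \<Otimes>\<^sub>M lborel) (\<lambda>(z, w). g z (z + w)) = integral\<^sup>L (lborel \<Otimes>\<^sub>M lborel) (case_prod g)"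
    using lborel_pair.integral_fst[OF i] lborel_pair.integral_fst[OF ig] by simp
qed

text \<open>A power of a quadratic form on pairs. Its degree - (2 n + 2) is that of |z| ^ (- n -
  \<alpha> - 1) |w| ^ (- n - 1 + \<alpha>), in which \<alpha> cancels. A mixture over \<sigma> gives
  this product back, see \<open>integral_joint_kernel_scale\<close>, while a single kernel has
  computable integrals both in the coordinates (z, w) and in (z, z + w).\<close>

definition joint_kernel :: "real \<Rightarrow> 'a::euclidean_space \<Rightarrow> 'a \<Rightarrow> real" where
  "joint_kernel \<sigma> z w = ((norm z)\<^sup>2 + (norm w / \<sigma>)\<^sup>2) powr - (real DIM('a) + 1)"

lemma joint_kernel_measurable [measurable (raw)]:
  assumes [measurable]: "s \<in> borel_measurable M" "f \<in> borel_measurable M" "g \<in> borel_measurable M"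
  shows "(\<lambda>x. joint_kernel (s x) (f x) (g x)) \<in> borel_measurable M"
  unfolding joint_kernel_def by measurable

lemma joint_kernel_uminus [simp]: "joint_kernel \<sigma> (- z) w = joint_kernel \<sigma> z w"
  by (simp add: joint_kernel_def)

text \<open>On the space of pairs, of dimension 2 n, the kernel times |z| is at most a multiple of
  |p| ^ (- 2 n - 1), which is integrable away from the origin; near the origin \<open>q\<close>
  vanishes.\<close>

lemma integrable_joint_kernel:
  fixes q :: "'a::euclidean_space \<Rightarrow> 'a \<Rightarrow> real"
  assumes [measurable]: "case_prod q \<in> borel_measurable (borel \<Otimes>\<^sub>M borel)"
    and q: "\<And>z w. \<bar>q z w\<bar> \<le> 1" "\<And>z w. norm (z, w) < d \<Longrightarrow> q z w = 0"
    and d: "d > 0" and \<sigma>: "\<sigma> > 0"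
  shows "integrable (lborel \<Otimes>\<^sub>M lborel) (\<lambda>(z, w). (q z w * joint_kernel \<sigma> z w) *\<^sub>R z)"
proof (rule Bochner_Integration.integrable_bound)
  define n where "n = real DIM('a)"
  \<comment> \<open>Chosen so that the quadratic form of the kernel is at least \<rho>^2 |p|^2 for p
    = (z, w).\<close>
  define \<rho> where "\<rho> = min 1 (1 / \<sigma>)"
  define C where "C = \<rho> powr - (2 * n + 2)"
  have \<rho>: "\<rho> > 0" using \<sigma> by (simp add: \<rho>_def)
  have "integrable lborel (\<lambda>p::'a\<times>'a. C * (indicator {p. d \<le> norm p} p * norm p powr - (real DIM('a \<times> 'a) + 1)))"
    by (intro integrable_mult_right integrable_norm_powr_outside_ball d)
  thus "integrable (lborel \<Otimes>\<^sub>M lborel) (\<lambda>p::'a\<times>'a. C * (indicator {p. d \<le> norm p} p * norm p powr - (real DIM('a \<times> 'a) + 1)))"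
    by (simp only: lborel_prod)
  have "(\<lambda>p. q (fst p) (snd p)) \<in> borel_measurable (borel \<Otimes>\<^sub>M borel)"
    using assms(1) by (simp add: case_prod_beta')
  note [measurable] = this
  show "(\<lambda>(z, w). (q z w * joint_kernel \<sigma> z w) *\<^sub>R z) \<in> borel_measurable (lborel \<Otimes>\<^sub>M lborel)"
    unfolding case_prod_beta' by measurable
  show "AE p in lborel \<Otimes>\<^sub>M lborel. norm (case p of (z, w) \<Rightarrow> (q z w * joint_kernel \<sigma> z w) *\<^sub>R z)
      \<le> norm (C * (indicator {p. d \<le> norm p} p * norm p powr - (real DIM('a \<times> 'a) + 1)))"
  proof (intro always_eventually allI)
    fix p :: "'a \<times> 'a"
    obtain z w where p: "p = (z, w)" by (cases p)
    show "norm (case p of (z, w) \<Rightarrow> (q z w * joint_kernel \<sigma> z w) *\<^sub>R z)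
      \<le> norm (C * (indicator {p. d \<le> norm p} p * norm p powr - (real DIM('a \<times> 'a) + 1)))"
    proof (cases "d \<le> norm p")
      case True
      hence p0: "norm p > 0" using d by linarith
      have np: "(norm p)\<^sup>2 = (norm z)\<^sup>2 + (norm w)\<^sup>2" by (simp add: p norm_Pair)
      have "\<rho> * norm z \<le> norm z" by (rule mult_left_le_one_le) (use \<rho> in \<open>auto simp: \<rho>_def\<close>)
      hence "(\<rho> * norm z)\<^sup>2 \<le> (norm z)\<^sup>2" using \<rho> by (intro power_mono) auto
      moreover have "\<rho> * norm w \<le> (1 / \<sigma>) * norm w" by (intro mult_right_mono) (auto simp: \<rho>_def)
      hence "(\<rho> * norm w)\<^sup>2 \<le> (norm w / \<sigma>)\<^sup>2" using \<rho> by (intro power_mono) auto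
      ultimately have ge: "(\<rho> * norm p)\<^sup>2 \<le> (norm z)\<^sup>2 + (norm w / \<sigma>)\<^sup>2"
        by (simp add: power_mult_distrib np distrib_left)
      have "joint_kernel \<sigma> z w \<le> ((\<rho> * norm p)\<^sup>2) powr - (n + 1)"
        unfolding joint_kernel_def n_def using ge \<rho> p0 by (intro powr_mono2') auto
      also have "\<dots> = (\<rho> * norm p) powr - (2 * n + 2)"
      proof -
        have e: "- (n + 1) = - (2 * n + 2) / 2" by (simp add: field_simps)
        show ?thesis unfolding e by (rule power2_powr_half) (use \<rho> in simp)
      qed
      also have "\<dots> = C * norm p powr - (2 * n + 2)" using \<rho> by (simp add: powr_mult C_def)
      finally have 1: "joint_kernel \<sigma> z w \<le> C * norm p powr - (2 * n + 2)" .
      have "norm z \<le> norm p" using norm_fst_le[of z w] by (simp add: p)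
      hence "joint_kernel \<sigma> z w * norm z \<le> (C * norm p powr - (2 * n + 2)) * norm p"
        using 1 by (intro mult_mono) (auto simp: C_def)
      also have "\<dots> = C * norm p powr (- (2 * n + 2) + 1)" unfolding powr_add using p0 by simp
      also have "- (2 * n + 2) + 1 = - (real DIM('a \<times> 'a) + 1)" by (simp add: n_def)
      finally have 2: "joint_kernel \<sigma> z w * norm z \<le> C * norm p powr - (real DIM('a \<times> 'a) + 1)" .
      have "norm ((q z w * joint_kernel \<sigma> z w) *\<^sub>R z) = \<bar>q z w\<bar> * (joint_kernel \<sigma> z w * norm z)"
        by (simp add: abs_mult joint_kernel_def)
      also have "\<dots> \<le> 1 * (joint_kernel \<sigma> z w * norm z)"
        by (intro mult_right_mono q) (simp add: joint_kernel_def)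
      also have "\<dots> \<le> C * norm p powr - (real DIM('a \<times> 'a) + 1)" using 2 by simp
      finally show ?thesis using True by (simp add: p C_def)
    qed (simp add: p q)
  qed
qed

text \<open>Multiplied by z, this is the value that \<open>integral_joint_kernel_sheared\<close>
  gives at y = z. This agreement is what makes two terms cancel in
  \<open>integral_joint_kernel_bump_increment\<close>.\<close>

lemma integral_joint_kernel_snd:
  fixes z :: "'a::euclidean_space"
  assumes \<sigma>: "\<sigma> > 0"
  shows "(\<integral>w. joint_kernel \<sigma> z w \<partial>lborel) = \<sigma> ^ DIM('a) * (\<integral>w. joint_kernel 1 z w \<partial>lborel)"
proof -
  have "(\<integral>w. joint_kernel \<sigma> z w \<partial>lborel) = \<bar>\<sigma>\<bar> ^ DIM('a) *\<^sub>R (\<integral>w. joint_kernel \<sigma> z (0 + \<sigma> *\<^sub>R w) \<partial>lborel)"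
    using \<sigma> by (intro integral_lborel_affine) auto
  also have "(\<lambda>w. joint_kernel \<sigma> z (0 + \<sigma> *\<^sub>R w)) = joint_kernel 1 z"
    using \<sigma> by (auto simp: joint_kernel_def fun_eq_iff)
  finally show ?thesis using \<sigma> by simp
qed

text \<open>
  Completing the square: for \<open>z = (y + \<sigma> v) / (1 + \<sigma>\<^sup>2)\<close>,
  \<open>|z|\<^sup>2 + |y - z|\<^sup>2 / \<sigma>\<^sup>2 = (|y|\<^sup>2 + |v|\<^sup>2) / (1 + \<sigma>\<^sup>2)\<close>.
\<close>

lemma integral_joint_kernel_sheared:
  fixes y :: "'a::euclidean_space"
  assumes \<sigma>: "\<sigma> > 0" and y: "y \<noteq> 0"
  shows "(\<integral>z. joint_kernel \<sigma> z (y - z) *\<^sub>R z \<partial>lborel) = (\<sigma> ^ DIM('a) * (\<integral>v. joint_kernel 1 y v \<partial>lborel)) *\<^sub>R y"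
proof -
  define n where "n = real DIM('a)"
  define k where "k = 1 + \<sigma>\<^sup>2"
  have k: "k > 0" by (simp add: k_def add_pos_nonneg)
  define Z where "Z = (\<lambda>v. (1 / k) *\<^sub>R y + (\<sigma> / k) *\<^sub>R v)"
  have Z: "Z v = (1 / k) *\<^sub>R (y + \<sigma> *\<^sub>R v)" for v by (simp add: Z_def scaleR_add_right)
  have Y: "y - Z v = (\<sigma> / k) *\<^sub>R (\<sigma> *\<^sub>R y - v)" for v
  proof -
    have "k *\<^sub>R (y - Z v) = \<sigma> *\<^sub>R (\<sigma> *\<^sub>R y - v)"
    proof -
      have "k *\<^sub>R Z v = y + \<sigma> *\<^sub>R v" using k by (simp add: Z)
      hence "k *\<^sub>R (y - Z v) = k *\<^sub>R y - (y + \<sigma> *\<^sub>R v)" by (simp only: scaleR_diff_right)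
      thus ?thesis by (simp add: k_def algebra_simps power2_eq_square)
    qed
    hence "(1 / k) *\<^sub>R (k *\<^sub>R (y - Z v)) = (1 / k) *\<^sub>R (\<sigma> *\<^sub>R (\<sigma> *\<^sub>R y - v))" by simp
    thus ?thesis using k by simp
  qed
  have sq: "(norm (Z v))\<^sup>2 + (norm (y - Z v) / \<sigma>)\<^sup>2 = ((norm y)\<^sup>2 + (norm v)\<^sup>2) / k" for v
  proof -
    have "(norm (Z v))\<^sup>2 = (norm (y + \<sigma> *\<^sub>R v))\<^sup>2 / k\<^sup>2"
      using k by (simp add: Z power_divide)
    moreover have "norm (y - Z v) / \<sigma> = norm (\<sigma> *\<^sub>R y - v) / k"
      using k \<sigma> by (simp add: Y)
    moreover have "(norm (y + \<sigma> *\<^sub>R v))\<^sup>2 + (norm (\<sigma> *\<^sub>R y - v))\<^sup>2 = k * ((norm y)\<^sup>2 + (norm v)\<^sup>2)"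
      unfolding power2_norm_eq_inner k_def
      by (simp add: inner_add_left inner_add_right inner_diff_left inner_diff_right inner_commute[of v y]
          algebra_simps power2_eq_square)
    ultimately have "(norm (Z v))\<^sup>2 + (norm (y - Z v) / \<sigma>)\<^sup>2 = (k * ((norm y)\<^sup>2 + (norm v)\<^sup>2)) / k\<^sup>2"
      by (simp add: power_divide add_divide_distrib[symmetric])
    thus ?thesis using k by (simp add: power2_eq_square)
  qed
  have J: "joint_kernel \<sigma> (Z v) (y - Z v) = k powr (n + 1) * joint_kernel 1 y v" for v
    unfolding joint_kernel_def sq n_def[symmetric] powr_divide powr_minus[of k]
    by (simp add: divide_inverse)
  have ny: "norm y > 0" using y by simp
  have i1: "integrable lborel (joint_kernel 1 y)"
    using integrable_power2_add_powr[OF ny, of "n + 1", where 'a='a] DIM_ge_1_real[where 'a='a]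
    by (simp add: joint_kernel_def[abs_def] n_def)
  have i2: "integrable lborel (\<lambda>v. joint_kernel 1 y v *\<^sub>R v)"
  proof (rule Bochner_Integration.integrable_bound)
    show "integrable lborel (\<lambda>v::'a. ((norm y)\<^sup>2 + (norm v)\<^sup>2) powr - (n + 1 / 2))"
      using DIM_ge_1_real[where 'a='a] by (intro integrable_power2_add_powr[OF ny]) (simp add: n_def)
    show "AE v in lborel. norm (joint_kernel 1 y v *\<^sub>R v) \<le> norm (((norm y)\<^sup>2 + (norm v)\<^sup>2) powr - (n + 1 / 2))"
    proof (intro always_eventually allI)
      fix v :: 'a
      define s where "s = (norm y)\<^sup>2 + (norm v)\<^sup>2"
      have s: "(norm v)\<^sup>2 \<le> s" by (simp add: s_def)
      have "norm v = ((norm v)\<^sup>2) powr (1 / 2)" using power2_powr_half[of "norm v" 1] by simp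
      also have "\<dots> \<le> s powr (1 / 2)" using s by (intro powr_mono2) auto
      finally have "s powr - (n + 1) * norm v \<le> s powr - (n + 1) * s powr (1 / 2)" by (intro mult_left_mono) auto
      also have "\<dots> = s powr - (n + 1 / 2)" unfolding powr_add[symmetric]
        by (rule arg_cong[where f="\<lambda>e. s powr e"]) simp
      finally show "norm (joint_kernel 1 y v *\<^sub>R v) \<le> norm (((norm y)\<^sup>2 + (norm v)\<^sup>2) powr - (n + 1 / 2))"
        by (simp add: joint_kernel_def s_def n_def)
    qed
  qed measurable
  have odd: "(\<integral>v. joint_kernel 1 y v *\<^sub>R v \<partial>lborel) = 0"
  proof (rule integral_lborel_odd)
    show "joint_kernel 1 y (- v) *\<^sub>R - v = - (joint_kernel 1 y v *\<^sub>R v)" for v by (simp add: joint_kernel_def)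
  qed measurable
  \<comment> \<open>The powers of \<open>k\<close> cancel: k ^ (- n) from the Jacobian, k ^ (n + 1)
    from the kernel and k ^ (- 1) from \<open>Z\<close>. The part of \<open>Z v\<close> proportional
    to \<open>v\<close> integrates to 0 by oddness.\<close>
  have "(\<integral>z. joint_kernel \<sigma> z (y - z) *\<^sub>R z \<partial>lborel)
      = \<bar>\<sigma> / k\<bar> ^ DIM('a) *\<^sub>R (\<integral>v. joint_kernel \<sigma> (Z v) (y - Z v) *\<^sub>R Z v \<partial>lborel)"
    unfolding Z_def using \<sigma> k by (intro integral_lborel_affine) auto
  also have "(\<lambda>v. joint_kernel \<sigma> (Z v) (y - Z v) *\<^sub>R Z v)
      = (\<lambda>v. (k powr n) *\<^sub>R (joint_kernel 1 y v *\<^sub>R y + \<sigma> *\<^sub>R (joint_kernel 1 y v *\<^sub>R v)))"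
  proof
    fix v
    have "joint_kernel \<sigma> (Z v) (y - Z v) *\<^sub>R Z v = (k powr (n + 1) * joint_kernel 1 y v) *\<^sub>R Z v"
      by (simp only: J)
    also have "\<dots> = ((k powr (n + 1) * (1 / k)) * joint_kernel 1 y v) *\<^sub>R (y + \<sigma> *\<^sub>R v)"
      by (simp add: Z)
    also have "k powr (n + 1) * (1 / k) = k powr n" using k by (simp add: powr_add)
    finally have "joint_kernel \<sigma> (Z v) (y - Z v) *\<^sub>R Z v = (k powr n * joint_kernel 1 y v) *\<^sub>R (y + \<sigma> *\<^sub>R v)" .
    thus "joint_kernel \<sigma> (Z v) (y - Z v) *\<^sub>R Z v = (k powr n) *\<^sub>R (joint_kernel 1 y v *\<^sub>R y + \<sigma> *\<^sub>R (joint_kernel 1 y v *\<^sub>R v))"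
      by (simp add: scaleR_add_right mult_ac)
  qed
  also have "(\<integral>v. (k powr n) *\<^sub>R (joint_kernel 1 y v *\<^sub>R y + \<sigma> *\<^sub>R (joint_kernel 1 y v *\<^sub>R v)) \<partial>lborel)
      = (k powr n) *\<^sub>R ((\<integral>v. joint_kernel 1 y v \<partial>lborel) *\<^sub>R y)"
  proof -
    have "(\<integral>v. joint_kernel 1 y v *\<^sub>R y + \<sigma> *\<^sub>R (joint_kernel 1 y v *\<^sub>R v) \<partial>lborel)
       = (\<integral>v. joint_kernel 1 y v *\<^sub>R y \<partial>lborel) + (\<integral>v. \<sigma> *\<^sub>R (joint_kernel 1 y v *\<^sub>R v) \<partial>lborel)"
      using i1 i2 by (intro Bochner_Integration.integral_add) (auto simp del: scaleR_scaleR)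
    thus ?thesis using i1 by (simp add: odd del: scaleR_scaleR)
  qed
  also have "\<bar>\<sigma> / k\<bar> ^ DIM('a) *\<^sub>R ((k powr n) *\<^sub>R ((\<integral>v. joint_kernel 1 y v \<partial>lborel) *\<^sub>R y))
      = (\<sigma> ^ DIM('a) * (\<integral>v. joint_kernel 1 y v \<partial>lborel)) *\<^sub>R y"
    using k \<sigma> by (simp add: n_def powr_realpow power_divide)
  finally show ?thesis .
qed

text \<open>Since \<open>bump x = 0\<close>, the second difference is q1 - q2 - q3, and outside the
  ball each term vanishes near the origin, so it is integrable on its own. The term with q3 is odd
  in z. The term with q1 as a function of y = z + w and the one with q2 as a function of y = z lead
  to the same integral over y.\<close>

lemma integral_joint_kernel_bump_increment:
  fixes x :: "'a::euclidean_space"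
  assumes \<sigma>: "\<sigma> > 0" and x: "norm x > 1"
  shows "integral\<^sup>L (lborel \<Otimes>\<^sub>M lborel)
    (\<lambda>(z, w). ((bump_increment w (x + z) - bump_increment w x) * joint_kernel \<sigma> z w) *\<^sub>R z) = 0"
proof -
  \<comment> \<open>Half the distance of \<open>x\<close> from the unit ball: if |(z, w)| < d, then
    z, w and z + w all have norm at most 2 d.\<close>
  define d where "d = (norm x - 1) / 2"
  have d: "d > 0" using x by (simp add: d_def)
  define q1 where "q1 = (\<lambda>z w. bump (x + (z + w)))"
  define q2 where "q2 = (\<lambda>(z::'a) (w::'a). bump (x + z))"
  define q3 where "q3 = (\<lambda>(z::'a) (w::'a). bump (x + w))"
  have z0: "bump (x + v) = 0" if "norm v \<le> 2 * d" for v
    using that norm_triangle_ineq2[of x "- v"] by (intro bump_eq_0) (simp add: d_def)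
  have le: "norm z \<le> norm (z, w)" "norm w \<le> norm (z, w)" for z w :: 'a
    using norm_fst_le[of z w] norm_snd_le[of w z] by auto
  have b1: "\<bar>bump v\<bar> \<le> 1" for v :: 'a using bump_nonneg[of v] bump_le_1[of v] by simp
  note int = integrable_joint_kernel[OF _ _ _ d \<sigma>]
  have i1: "integrable (lborel \<Otimes>\<^sub>M lborel) (\<lambda>(z, w). (q1 z w * joint_kernel \<sigma> z w) *\<^sub>R z)"
  proof (rule int)
    show "q1 z w = 0" if "norm (z, w) < d" for z w
      unfolding q1_def using le(1)[of z w] le(2)[of w z] that norm_triangle_ineq[of z w] by (intro z0) linarith
  qed (auto simp: q1_def b1)
  have i2: "integrable (lborel \<Otimes>\<^sub>M lborel) (\<lambda>(z, w). (q2 z w * joint_kernel \<sigma> z w) *\<^sub>R z)"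
  proof (rule int)
    show "q2 z w = 0" if "norm (z, w) < d" for z w
      unfolding q2_def using le(1)[of z w] le(2)[of w z] that d by (intro z0) linarith
  qed (auto simp: q2_def b1)
  have i3: "integrable (lborel \<Otimes>\<^sub>M lborel) (\<lambda>(z, w). (q3 z w * joint_kernel \<sigma> z w) *\<^sub>R z)"
  proof (rule int)
    show "q3 z w = 0" if "norm (z, w) < d" for z w
      unfolding q3_def using le(1)[of z w] le(2)[of w z] that d by (intro z0) linarith
  qed (auto simp: q3_def b1)
  have eq: "((bump_increment w (x + z) - bump_increment w x) * joint_kernel \<sigma> z w) *\<^sub>R z
     = (q1 z w * joint_kernel \<sigma> z w) *\<^sub>R z - (q2 z w * joint_kernel \<sigma> z w) *\<^sub>R z - (q3 z w * joint_kernel \<sigma> z w) *\<^sub>R z" for z w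
    using z0[of 0] d by (simp add: bump_increment_def q1_def q2_def q3_def algebra_simps)
  have "integral\<^sup>L (lborel \<Otimes>\<^sub>M lborel) (\<lambda>(z, w). (q3 z w * joint_kernel \<sigma> z w) *\<^sub>R z)
      = (\<integral>w. (\<integral>z. (q3 z w * joint_kernel \<sigma> z w) *\<^sub>R z \<partial>lborel) \<partial>lborel)"
    by (rule lborel_pair.integral_snd[OF i3, symmetric])
  also have "(\<integral>z. (q3 z w * joint_kernel \<sigma> z w) *\<^sub>R z \<partial>lborel) = 0" for w
  proof (rule integral_lborel_odd)
    show "(\<lambda>z. (q3 z w * joint_kernel \<sigma> z w) *\<^sub>R z) \<in> borel_measurable borel"
      unfolding q3_def by measurable
  qed (simp add: q3_def)
  hence "(\<integral>w. (\<integral>z. (q3 z w * joint_kernel \<sigma> z w) *\<^sub>R z \<partial>lborel) \<partial>lborel) = 0" by simp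
  finally have I3: "integral\<^sup>L (lborel \<Otimes>\<^sub>M lborel) (\<lambda>(z, w). (q3 z w * joint_kernel \<sigma> z w) *\<^sub>R z) = 0" .
  define M where "M = (\<lambda>y::'a. \<integral>v. joint_kernel 1 y v \<partial>lborel)"
  have I2: "integral\<^sup>L (lborel \<Otimes>\<^sub>M lborel) (\<lambda>(z, w). (q2 z w * joint_kernel \<sigma> z w) *\<^sub>R z)
      = (\<integral>y. (bump (x + y) * (\<sigma> ^ DIM('a) * M y)) *\<^sub>R y \<partial>lborel)"
  proof -
    have "(\<integral>w. (q2 z w * joint_kernel \<sigma> z w) *\<^sub>R z \<partial>lborel) = (bump (x + z) * (\<sigma> ^ DIM('a) * M z)) *\<^sub>R z" for z
    proof (cases "z = 0")
      case False
      have "integrable lborel (joint_kernel 1 z)"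
        using integrable_power2_add_powr[of "norm z" "real DIM('a) + 1", where 'a='a] False
        by (simp add: joint_kernel_def[abs_def])
      from integrable_lborel_affine[OF this, of 0 "1 / \<sigma>"] have "integrable lborel (joint_kernel \<sigma> z)"
        using \<sigma> by (simp add: joint_kernel_def[abs_def])
      thus ?thesis using integral_joint_kernel_snd[OF \<sigma>, of z] by (simp add: q2_def M_def)
    qed simp
    thus ?thesis using lborel_pair.integral_fst[OF i2] by simp
  qed
  have I1: "integral\<^sup>L (lborel \<Otimes>\<^sub>M lborel) (\<lambda>(z, w). (q1 z w * joint_kernel \<sigma> z w) *\<^sub>R z)
      = (\<integral>y. (bump (x + y) * (\<sigma> ^ DIM('a) * M y)) *\<^sub>R y \<partial>lborel)"
  proof -
    define g where "g = (\<lambda>z y. (bump (x + y) * joint_kernel \<sigma> z (y - z)) *\<^sub>R z)"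
    have A: "(\<lambda>(z, w). (q1 z w * joint_kernel \<sigma> z w) *\<^sub>R z) = (\<lambda>(z, w). g z (z + w))"
      by (auto simp: g_def q1_def)
    have mg: "case_prod g \<in> borel_measurable (borel \<Otimes>\<^sub>M borel)" unfolding g_def by measurable
    note S = integrable_pair_shear[OF mg i1[unfolded A]]
    have "(\<integral>z. g z y \<partial>lborel) = (bump (x + y) * (\<sigma> ^ DIM('a) * M y)) *\<^sub>R y" for y
    proof (cases "y = 0")
      case False
      have "(\<integral>z. g z y \<partial>lborel) = bump (x + y) *\<^sub>R (\<integral>z. joint_kernel \<sigma> z (y - z) *\<^sub>R z \<partial>lborel)"
        unfolding g_def scaleR_scaleR[symmetric] by (rule integral_scaleR_right)
      thus ?thesis by (simp add: integral_joint_kernel_sheared[OF \<sigma> False] M_def)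
    next
      case True
      have "bump x = 0" using z0[of 0] d by simp
      thus ?thesis by (simp add: g_def True)
    qed
    thus ?thesis unfolding A S(2) using lborel_pair.integral_snd[OF S(1)] by simp
  qed
  have "integral\<^sup>L (lborel \<Otimes>\<^sub>M lborel) (\<lambda>(z, w). ((bump_increment w (x + z) - bump_increment w x) * joint_kernel \<sigma> z w) *\<^sub>R z)
    = integral\<^sup>L (lborel \<Otimes>\<^sub>M lborel) (\<lambda>(z, w). (q1 z w * joint_kernel \<sigma> z w) *\<^sub>R z)
    - integral\<^sup>L (lborel \<Otimes>\<^sub>M lborel) (\<lambda>(z, w). (q2 z w * joint_kernel \<sigma> z w) *\<^sub>R z)
    - integral\<^sup>L (lborel \<Otimes>\<^sub>M lborel) (\<lambda>(z, w). (q3 z w * joint_kernel \<sigma> z w) *\<^sub>R z)"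
    unfolding eq case_prod_beta'
    using i1 i2 i3 unfolding case_prod_beta'
    by (subst Bochner_Integration.integral_diff) (auto intro!: Bochner_Integration.integrable_diff simp: Bochner_Integration.integral_diff)
  thus ?thesis by (simp add: I1 I2 I3)
qed

text \<open>With t = |w| / |z| the quadratic form is |z|^2 (1 + (t / \<sigma>)^2), and the
  substitution \<sigma> = t \<rho> yields c |z| ^ (- 2 n - 2) t ^ (\<alpha> - 1 - n). The exponent
  \<alpha> - 2 - n of the weight is chosen to make this the product of the two Riesz
  kernels.\<close>

lemma integral_joint_kernel_scale:
  assumes \<alpha>: "0 < \<alpha>" "\<alpha> < 1"
  obtains c where "c > 0"
    "\<And>z w :: 'a::euclidean_space. z \<noteq> 0 \<Longrightarrow> w \<noteq> 0 \<Longrightarrow>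
       integrable lborel (\<lambda>\<sigma>. indicator {0<..} \<sigma> * (\<sigma> powr (\<alpha> - 2 - real DIM('a)) * joint_kernel \<sigma> z w))"
    "\<And>z w :: 'a. z \<noteq> 0 \<Longrightarrow> w \<noteq> 0 \<Longrightarrow>
       (\<integral>\<sigma>. indicator {0<..} \<sigma> * (\<sigma> powr (\<alpha> - 2 - real DIM('a)) * joint_kernel \<sigma> z w) \<partial>lborel)
       = c * (norm z powr - (real DIM('a) + \<alpha> + 1) * norm w powr - (real DIM('a) + (1 - \<alpha>)))"
proof -
  define n where "n = real DIM('a)"
  have n: "n \<ge> 1" unfolding n_def by (rule DIM_ge_1_real)
  \<comment> \<open>The integrand after the substitution, free of z and w. It is at most \<rho> ^
    (\<alpha> + n) near 0 and \<rho> ^ (\<alpha> - 2 - n) at infinity, hence integrable.\<close>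
  define J where "J = (\<lambda>\<rho>::real. indicator {0<..} \<rho> * (\<rho> powr (\<alpha> - 2 - n) * (1 + (1 / \<rho>)\<^sup>2) powr - (n + 1)))"
  have [measurable]: "J \<in> borel_measurable borel" unfolding J_def by measurable
  have J0: "J \<rho> \<ge> 0" for \<rho> by (simp add: J_def)
  have Jpos: "J \<rho> > 0" if "\<rho> > 0" for \<rho>
  proof -
    have "1 + (1 / \<rho>)\<^sup>2 > 0" by (simp add: add_pos_nonneg)
    thus ?thesis using that by (simp add: J_def)
  qed
  have iJ: "integrable lborel J"
  proof (rule integrableI_nonneg)
    have "(\<integral>\<^sup>+\<rho>. ennreal (J \<rho>) \<partial>lborel) \<le> (\<integral>\<^sup>+\<rho>. ennreal (\<rho> powr 0) * indicator {0..1} \<rho> + ennreal (\<rho> powr - 2) * indicator {1..} \<rho> \<partial>lborel)"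
    proof (intro nn_integral_mono)
      fix \<rho> :: real
      consider "\<rho> \<le> 0" | "0 < \<rho>" "\<rho> < 1" | "\<rho> \<ge> 1" by linarith
      thus "ennreal (J \<rho>) \<le> ennreal (\<rho> powr 0) * indicator {0..1} \<rho> + ennreal (\<rho> powr - 2) * indicator {1..} \<rho>"
      proof cases
        case 1
        thus ?thesis by (simp add: J_def)
      next
        case 2
        have "(1 + (1 / \<rho>)\<^sup>2) powr - (n + 1) \<le> ((1 / \<rho>)\<^sup>2) powr - (n + 1)"
          using 2 n by (intro powr_mono2') auto
        also have "\<dots> = (1 / \<rho>) powr - (2 * n + 2)"
        proof -
          have e: "- (n + 1) = - (2 * n + 2) / 2" by (simp add: field_simps)
          show ?thesis unfolding e by (rule power2_powr_half) (use 2 in simp)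
        qed
        also have "\<dots> = \<rho> powr (2 * n + 2)"
          unfolding powr_divide powr_minus by simp
        finally have "J \<rho> \<le> \<rho> powr (\<alpha> - 2 - n) * \<rho> powr (2 * n + 2)"
          using 2 by (simp add: J_def mult_left_mono)
        also have "\<dots> = \<rho> powr (\<alpha> + n)"
          unfolding powr_add[symmetric] by (rule arg_cong[where f="\<lambda>e. \<rho> powr e"]) simp
        also have "\<dots> \<le> \<rho> powr 0" using 2 \<alpha> n by (intro powr_mono') auto
        finally show ?thesis using 2 by (simp add: ennreal_leI)
      next
        case 3
        have "(1 + (1 / \<rho>)\<^sup>2) powr - (n + 1) \<le> 1 powr - (n + 1)"
          using 3 n by (intro powr_mono2') auto
        hence "J \<rho> \<le> \<rho> powr (\<alpha> - 2 - n) * 1"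
          using 3 unfolding J_def by (simp add: mult_left_le)
        also have "\<dots> \<le> \<rho> powr - 2" using 3 \<alpha> n by (simp add: powr_mono)
        finally have "ennreal (J \<rho>) \<le> ennreal (\<rho> powr - 2) * indicator {1..} \<rho>"
          using 3 by (simp add: ennreal_leI)
        thus ?thesis by (rule order_trans) simp
      qed
    qed
    also have "\<dots> < \<infinity>"
      using nn_integral_powr_0_1[of 0] nn_integral_powr_1_infinity[of "- 2"]
      by (subst nn_integral_add) auto
    finally show "(\<integral>\<^sup>+\<rho>. ennreal (J \<rho>) \<partial>lborel) < \<infinity>" .
  qed (use J0 in auto)
  define c where "c = (\<integral>\<rho>. J \<rho> \<partial>lborel)"
  have c: "c > 0"
  proof -
    have "c \<noteq> 0"
    proof
      assume "c = 0"
      hence "AE \<rho> in lborel. J \<rho> = 0"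
        using integral_nonneg_eq_0_iff_AE[OF iJ] J0 by (simp add: c_def)
      hence "AE \<rho> in lborel. \<rho> \<notin> {0<..<1::real}" by eventually_elim (use Jpos in force)
      hence "emeasure lborel {0<..<1::real} = 0"
        by (subst (asm) AE_iff_measurable[of "{0<..<1::real}"]) auto
      thus False by simp
    qed
    moreover have "c \<ge> 0" unfolding c_def by (intro integral_nonneg_AE) (simp add: J0)
    ultimately show ?thesis by simp
  qed
  have scale: "indicator {0<..} \<sigma> * (\<sigma> powr (\<alpha> - 2 - n) * joint_kernel \<sigma> z w)
      = norm z powr - (2 * n + 2) * (norm w / norm z) powr (\<alpha> - 2 - n) * J (0 + (norm z / norm w) *\<^sub>R \<sigma>)"
    if "z \<noteq> 0" "w \<noteq> 0" for z w :: 'a and \<sigma>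
  proof (cases "\<sigma> > 0")
    case True
    define t where "t = norm w / norm z"
    have t: "t > 0" using that by (simp add: t_def)
    have "(norm z)\<^sup>2 + (norm w / \<sigma>)\<^sup>2 = (norm z)\<^sup>2 * (1 + (t / \<sigma>)\<^sup>2)"
    proof -
      have "norm w = norm z * t" using that by (simp add: t_def)
      thus ?thesis by (simp add: power_divide power_mult_distrib distrib_left)
    qed
    hence "joint_kernel \<sigma> z w = ((norm z)\<^sup>2) powr - (n + 1) * (1 + (t / \<sigma>)\<^sup>2) powr - (n + 1)"
      by (simp add: joint_kernel_def n_def powr_mult)
    also have "((norm z)\<^sup>2) powr - (n + 1) = norm z powr - (2 * n + 2)"
    proof -
      have e: "- (n + 1) = - (2 * n + 2) / 2" by (simp add: field_simps)
      show ?thesis unfolding e by (rule power2_powr_half) simp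
    qed
    finally have jk: "joint_kernel \<sigma> z w = norm z powr - (2 * n + 2) * (1 + (t / \<sigma>)\<^sup>2) powr - (n + 1)" .
    have s: "0 + (norm z / norm w) *\<^sub>R \<sigma> = \<sigma> / t" using that by (simp add: t_def)
    have "\<sigma> powr (\<alpha> - 2 - n) = t powr (\<alpha> - 2 - n) * (\<sigma> / t) powr (\<alpha> - 2 - n)"
      using t True by (simp add: powr_mult[symmetric])
    moreover have "J (\<sigma> / t) = (\<sigma> / t) powr (\<alpha> - 2 - n) * (1 + (t / \<sigma>)\<^sup>2) powr - (n + 1)"
      using t True by (simp add: J_def)
    ultimately show ?thesis unfolding s jk t_def[symmetric] using True by (simp add: mult_ac)
  next
    case False
    hence "(norm z / norm w) * \<sigma> \<le> 0" by (intro mult_nonneg_nonpos) auto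
    thus ?thesis using False by (simp add: J_def)
  qed
  show thesis
  proof (rule that[OF c])
    fix z w :: 'a assume zw: "z \<noteq> 0" "w \<noteq> 0"
    have ne: "norm z / norm w \<noteq> 0" using zw by simp
    show "integrable lborel (\<lambda>\<sigma>. indicator {0<..} \<sigma> * (\<sigma> powr (\<alpha> - 2 - real DIM('a)) * joint_kernel \<sigma> z w))"
      unfolding n_def[symmetric] scale[OF zw]
      using integrable_lborel_affine[OF iJ, of 0 "norm z / norm w"] ne by (intro integrable_mult_right) blast
    have "c = \<bar>norm z / norm w\<bar> ^ DIM(real) *\<^sub>R (\<integral>\<sigma>. J (0 + (norm z / norm w) *\<^sub>R \<sigma>) \<partial>lborel)"
      unfolding c_def using ne by (intro integral_lborel_affine) auto
    hence I: "(\<integral>\<sigma>. J (0 + (norm z / norm w) *\<^sub>R \<sigma>) \<partial>lborel) = (norm w / norm z) * c"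
      using zw by (simp add: field_simps)
    have "(\<integral>\<sigma>. indicator {0<..} \<sigma> * (\<sigma> powr (\<alpha> - 2 - n) * joint_kernel \<sigma> z w) \<partial>lborel)
      = norm z powr - (2 * n + 2) * (norm w / norm z) powr (\<alpha> - 2 - n) * ((norm w / norm z) * c)"
      unfolding scale[OF zw] using I by simp
    also have "\<dots> = c * (norm z powr - (2 * n + 2) * ((norm w / norm z) powr (\<alpha> - 2 - n) * (norm w / norm z)))"
      by (simp add: mult_ac)
    also have "(norm w / norm z) powr (\<alpha> - 2 - n) * (norm w / norm z) = (norm w / norm z) powr (\<alpha> - 2 - n + 1)"
      unfolding powr_add using zw by simp
    also have "\<dots> = norm w powr (\<alpha> - 2 - n + 1) * norm z powr - (\<alpha> - 2 - n + 1)"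
      unfolding powr_divide powr_minus by (simp add: divide_inverse)
    also have "norm z powr - (2 * n + 2) * (norm w powr (\<alpha> - 2 - n + 1) * norm z powr - (\<alpha> - 2 - n + 1))
      = (norm z powr - (2 * n + 2) * norm z powr - (\<alpha> - 2 - n + 1)) * norm w powr (\<alpha> - 2 - n + 1)"
      by (simp only: mult_ac)
    also have "norm z powr - (2 * n + 2) * norm z powr - (\<alpha> - 2 - n + 1) = norm z powr - (n + \<alpha> + 1)"
      unfolding powr_add[symmetric] by (rule arg_cong[where f="\<lambda>e. norm z powr e"]) simp
    also have "norm w powr (\<alpha> - 2 - n + 1) = norm w powr - (n + (1 - \<alpha>))"
      by (rule arg_cong[where f="\<lambda>e. norm w powr e"]) simp
    finally show "(\<integral>\<sigma>. indicator {0<..} \<sigma> * (\<sigma> powr (\<alpha> - 2 - real DIM('a)) * joint_kernel \<sigma> z w) \<partial>lborel)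
       = c * (norm z powr - (real DIM('a) + \<alpha> + 1) * norm w powr - (real DIM('a) + (1 - \<alpha>)))"
      by (simp only: n_def)
  qed
qed

text \<open>
  The product of the two Riesz kernels is a superposition of the kernels \<open>joint_kernel \<sigma>\<close>,
  for each of which the integral vanishes.
\<close>

theorem frac_nabla_frac_bump_eq_0:
  fixes x :: "'a::euclidean_space"
  assumes \<alpha>: "0 < \<alpha>" "\<alpha> < 1" and x: "norm x > 1"
  shows "frac_nabla \<alpha> (frac_bump (1 - \<alpha>)) x = 0"
proof -
  define n where "n = real DIM('a)"
  define s where "s = 1 - \<alpha>"
  have s: "0 < s" "s < 1" using \<alpha> by (auto simp: s_def)
  obtain c where c: "c > 0"
    and ic: "\<And>z w :: 'a. z \<noteq> 0 \<Longrightarrow> w \<noteq> 0 \<Longrightarrow>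
       integrable lborel (\<lambda>\<sigma>. indicator {0<..} \<sigma> * (\<sigma> powr (\<alpha> - 2 - n) * joint_kernel \<sigma> z w))"
    and Ic: "\<And>z w :: 'a. z \<noteq> 0 \<Longrightarrow> w \<noteq> 0 \<Longrightarrow>
       (\<integral>\<sigma>. indicator {0<..} \<sigma> * (\<sigma> powr (\<alpha> - 2 - n) * joint_kernel \<sigma> z w) \<partial>lborel)
       = c * (norm z powr - (n + \<alpha> + 1) * norm w powr - (n + s))"
    using integral_joint_kernel_scale[OF \<alpha>, where 'a='a] unfolding n_def s_def by blast
  define D where "D = (\<lambda>z w. bump_increment w (x + z) - bump_increment w x)"
  have D: "\<bar>D z w\<bar> \<le> 12 * min 1 (norm w) * min 1 (norm z)" for z w
    using bump_increment_lipschitz[of w "x + z" x] by (simp add: D_def)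
  have D0: "D z w = 0" if "z = 0 \<or> w = 0" for z w using D[of z w] that by auto
  define q where "q = (\<lambda>\<sigma>. indicat_real {0<..} \<sigma> * \<sigma> powr (\<alpha> - 2 - n))"
  have [measurable]: "q \<in> borel_measurable borel" unfolding q_def by measurable
  have q0: "q \<sigma> \<ge> 0" for \<sigma> by (simp add: q_def)
  define P where "P = (\<lambda>(p :: 'a \<times> 'a) \<sigma>. q \<sigma> *\<^sub>R ((D (fst p) (snd p) * joint_kernel \<sigma> (fst p) (snd p)) *\<^sub>R fst p))"
  define L where "L = (\<lambda>z w :: 'a. (D z w * norm w powr - (n + s)) *\<^sub>R riesz_kernel \<alpha> z)"
  have P_eq: "P (z, w) \<sigma> = (indicator {0<..} \<sigma> * (\<sigma> powr (\<alpha> - 2 - n) * joint_kernel \<sigma> z w)) *\<^sub>R (D z w *\<^sub>R z)" for z w \<sigma>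
    by (simp add: P_def q_def mult_ac)
  \<comment> \<open>The superposition formula is available only for nonzero z and w; on the
    exceptional set the second difference \<open>D\<close> vanishes.\<close>
  have P0: "P (z, w) = (\<lambda>_. 0)" if "z = 0 \<or> w = 0" for z w
    using D0[OF that] by (simp add: P_eq fun_eq_iff)
  have iP: "integrable lborel (P p)" for p
  proof (cases p)
    case (Pair z w)
    show ?thesis
    proof (cases "z = 0 \<or> w = 0")
      case False
      hence "integrable lborel (\<lambda>\<sigma>. (indicator {0<..} \<sigma> * (\<sigma> powr (\<alpha> - 2 - n) * joint_kernel \<sigma> z w)) *\<^sub>R (D z w *\<^sub>R z))"
        by (intro integrable_scaleR_left ic) auto
      thus ?thesis unfolding Pair P_eq[abs_def] .
    qed (simp add: Pair P0)
  qed
  have intP: "(\<integral>\<sigma>. P (z, w) \<sigma> \<partial>lborel) = c *\<^sub>R L z w" for z w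
  proof (cases "z = 0 \<or> w = 0")
    case False
    have "(\<integral>\<sigma>. P (z, w) \<sigma> \<partial>lborel)
      = (c * (norm z powr - (n + \<alpha> + 1) * norm w powr - (n + s))) *\<^sub>R (D z w *\<^sub>R z)"
      unfolding P_eq using False ic[of z w] Ic[of z w] by (subst integral_scaleR_left) auto
    thus ?thesis by (simp add: L_def riesz_kernel_def n_def mult_ac)
  qed (simp add: P0 L_def D0)
  \<comment> \<open>The product bound on \<open>D\<close> gives one \<open>trunc_kernel\<close> in
    each variable. This majorant is integrable over pairs and so permits exchanging the integral
    over \<sigma> with the one over (z, w).\<close>
  have normP: "(\<integral>\<sigma>. norm (P (z, w) \<sigma>) \<partial>lborel) \<le> 12 * c * (trunc_kernel \<alpha> z * trunc_kernel s w)" for z w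
  proof (cases "z = 0 \<or> w = 0")
    case False
    have "norm (P (z, w) \<sigma>) = (indicator {0<..} \<sigma> * (\<sigma> powr (\<alpha> - 2 - n) * joint_kernel \<sigma> z w)) * (\<bar>D z w\<bar> * norm z)" for \<sigma>
    proof -
      have "0 \<le> indicator {0<..} \<sigma> * (\<sigma> powr (\<alpha> - 2 - n) * joint_kernel \<sigma> z w)" by (simp add: joint_kernel_def)
      thus ?thesis unfolding P_eq by (simp only: norm_scaleR abs_of_nonneg)
    qed
    hence "(\<integral>\<sigma>. norm (P (z, w) \<sigma>) \<partial>lborel)
      = (c * (norm z powr - (n + \<alpha> + 1) * norm w powr - (n + s))) * (\<bar>D z w\<bar> * norm z)"
      using False Ic[of z w] by simp
    also have "\<dots> = c * (norm (riesz_kernel \<alpha> z) * norm w powr - (n + s)) * \<bar>D z w\<bar>"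
      by (simp add: riesz_kernel_def n_def mult_ac)
    also have "\<dots> \<le> c * (norm (riesz_kernel \<alpha> z) * norm w powr - (n + s)) * (12 * min 1 (norm w) * min 1 (norm z))"
      using c by (intro mult_left_mono D) auto
    also have "\<dots> = 12 * c * ((min 1 (norm z) * norm (riesz_kernel \<alpha> z)) * (min 1 (norm w) * norm w powr - (n + s)))"
      by (simp add: mult_ac)
    also have "\<dots> = 12 * c * (trunc_kernel \<alpha> z * trunc_kernel s w)"
      unfolding trunc_kernel_eq n_def min_norm_powr_eq_trunc_kernel ..
    finally show ?thesis .
  qed (use c in \<open>simp add: P0 trunc_kernel_nonneg\<close>)
  define T where "T = (\<lambda>p :: 'a \<times> 'a. 12 * c * (trunc_kernel \<alpha> (fst p) * trunc_kernel s (snd p)))"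
  have iT: "integrable lborel T"
  proof -
    have "integrable (lborel \<Otimes>\<^sub>M lborel) (\<lambda>(z::'a, w::'a). trunc_kernel \<alpha> z * trunc_kernel s w)"
    proof (rule integrable_pair_lborelI)
      show "integrable lborel (\<lambda>w. trunc_kernel \<alpha> z * trunc_kernel s (w::'a))" for z :: 'a
        by (intro integrable_mult_right integrable_trunc_kernel s)
      show "integrable lborel (\<lambda>z::'a. trunc_kernel \<alpha> z * (\<integral>w. trunc_kernel s (w::'a) \<partial>lborel))"
        by (intro integrable_mult_left integrable_trunc_kernel \<alpha>)
    qed (auto simp: trunc_kernel_nonneg abs_mult)
    hence "integrable (lborel \<Otimes>\<^sub>M lborel) T"
      unfolding T_def case_prod_beta' by (rule integrable_mult_right)
    thus ?thesis by (simp only: lborel_prod)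
  qed
  have [measurable]: "(\<lambda>p. D (f p) (g p)) \<in> borel_measurable M"
    if [measurable]: "f \<in> borel_measurable M" "g \<in> borel_measurable M" for f g and M :: "(('a \<times> 'a) \<times> real) measure"
    unfolding D_def by measurable
  have mfst [measurable]: "fst \<in> borel_measurable (borel :: ('a \<times> 'a) measure)" "snd \<in> borel_measurable (borel :: ('a \<times> 'a) measure)"
    by (intro borel_measurable_continuous_onI continuous_intros)+
  have iPP: "integrable (lborel \<Otimes>\<^sub>M lborel) (case_prod P)"
  proof (rule integrable_pair_lborelI[OF _ iP iT])
    show "case_prod P \<in> borel_measurable (borel \<Otimes>\<^sub>M borel)"
      unfolding P_def case_prod_beta' by measurable
    show "(\<integral>\<sigma>. norm (P p \<sigma>) \<partial>lborel) \<le> T p" for p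
      using normP[of "fst p" "snd p"] by (simp add: T_def)
  qed
  have "(\<integral>p. P p \<sigma> \<partial>lborel) = 0" for \<sigma>
  proof (cases "\<sigma> > 0")
    case True
    have "(\<integral>p. P p \<sigma> \<partial>lborel) = q \<sigma> *\<^sub>R (\<integral>p. (D (fst p) (snd p) * joint_kernel \<sigma> (fst p) (snd p)) *\<^sub>R fst p \<partial>lborel)"
      unfolding P_def by (rule integral_scaleR_right)
    also have "(\<integral>p. (D (fst p) (snd p) * joint_kernel \<sigma> (fst p) (snd p)) *\<^sub>R fst p \<partial>lborel) = 0"
      using integral_joint_kernel_bump_increment[OF True x]
      unfolding lborel_prod case_prod_beta' D_def .
    finally show ?thesis by simp
  qed (simp add: P_def q_def)
  hence "(\<integral>\<sigma>. (\<integral>p. P p \<sigma> \<partial>lborel) \<partial>lborel) = 0" by simp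
  hence Z: "(\<integral>p. (\<integral>\<sigma>. P p \<sigma> \<partial>lborel) \<partial>lborel) = 0"
    using lborel_pair.integral_fst[OF iPP] lborel_pair.integral_snd[OF iPP] by simp
  have PL: "(\<lambda>p. \<integral>\<sigma>. P p \<sigma> \<partial>lborel) = (\<lambda>p. c *\<^sub>R (case p of (z, w) \<Rightarrow> L z w))"
    by (auto simp: fun_eq_iff intP)
  have "integrable lborel (\<lambda>p. c *\<^sub>R (case p of (z, w) \<Rightarrow> L z w))"
    using lborel_pair.integrable_fst[OF iPP] unfolding PL .
  from integrable_scaleR_right[OF this, of "1 / c"] have iL: "integrable (lborel \<Otimes>\<^sub>M lborel) (\<lambda>(z, w). L z w)"
    using c by (simp add: lborel_prod)
  have "c *\<^sub>R (\<integral>p. (case p of (z, w) \<Rightarrow> L z w) \<partial>lborel) = 0"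
    using Z unfolding PL by simp
  hence "integral\<^sup>L (lborel \<Otimes>\<^sub>M lborel) (\<lambda>(z, w). L z w) = 0"
    using c by (simp add: lborel_prod)
  hence "(\<integral>z. (\<integral>w. L z w \<partial>lborel) \<partial>lborel) = 0"
    using lborel_pair.integral_fst[OF iL] by simp
  moreover have "(\<integral>w. L z w \<partial>lborel) = (frac_bump s (x + z) - frac_bump s x) *\<^sub>R riesz_kernel \<alpha> z" for z
    unfolding L_def D_def n_def frac_bump_diff(1)[OF s]
    by (rule integral_scaleR_left) (rule frac_bump_diff(2)[OF s])
  ultimately show ?thesis by (simp add: frac_nabla_def s_def)
qed

section \<open>The contradiction from a nonzero value of \<Phi>\<close>

theorem theorem1p3:
  fixes \<alpha> p :: real and \<Phi> :: "real \<Rightarrow> real"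
  assumes "0 < \<alpha>" and "\<alpha> < 1"
    and "1 \<le> p" and "p < real CARD('n::finite) / (real CARD('n) - \<alpha>)"
    and "\<exists>L. L-lipschitz_on UNIV \<Phi>"
    and "\<Phi> 0 = 0" and "\<forall>t. \<Phi> t \<ge> 0"
    and "\<forall>f :: (real ^ 'n) \<Rightarrow> real. f \<in> BV_frac \<alpha> p \<longrightarrow>
           (\<Phi> \<circ> f) \<in> BV_frac \<alpha> p \<and>
           measure_supp (total_variation (frac_grad \<alpha> (\<Phi> \<circ> f)))
             \<subseteq> measure_supp (total_variation (frac_grad \<alpha> f))"
  shows "\<forall>t. \<Phi> t = 0"
proof (rule ccontr)
  assume "\<not> (\<forall>t. \<Phi> t = 0)"
  then obtain t where t: "\<Phi> t \<noteq> 0" by blast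
  let ?k = "frac_const CARD('n) \<alpha>"
  have k: "?k \<noteq> 0"
  proof -
    have "Gamma ((real CARD('n) + \<alpha> + 1) / 2) > 0" "Gamma ((1 - \<alpha>) / 2) > 0"
      using assms(1,2) by (auto intro!: Gamma_real_pos)
    thus ?thesis by (simp add: frac_const_def)
  qed
  obtain L where L: "L-lipschitz_on UNIV \<Phi>" using assms(5) by blast
  have \<Phi>: "\<bar>\<Phi> a - \<Phi> b\<bar> \<le> L * \<bar>a - b\<bar>" for a b
    using lipschitz_onD[OF L, of a b] by (simp add: dist_real_def)
  have s: "0 < 1 - \<alpha>" "1 - \<alpha> < 1" using assms(1,2) by auto
  define b where "b = (frac_bump (1 - \<alpha>) :: real ^ 'n \<Rightarrow> real)"
  obtain B where B: "lipschitz_L1 b B"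
    using lipschitz_L1_frac_bump[OF s, where 'a="real ^ 'n"] unfolding b_def by blast
  \<comment> \<open>Any point outside the closed unit ball would do: there \<open>b\<close> is known
    to be positive.\<close>
  define x where "x = (2 *\<^sub>R axis undefined 1 :: real ^ 'n)"
  have bx: "b x > 0" unfolding b_def
    by (rule frac_bump_pos[OF s]) (simp add: x_def norm_axis_1)
  \<comment> \<open>Makes f x = t, so that \<Phi> (f x) is nonzero. The sign of \<open>t\<close> is
    arbitrary, which is why |c| enters the bound on \<open>f\<close>.\<close>
  define c where "c = t / b x"
  define f where "f = (\<lambda>y. c * b y)"
  have f: "lipschitz_L1 f (\<bar>c\<bar> * B)"
    using lipschitz_L1_compose[OF B, of "\<lambda>a. c * a" "\<bar>c\<bar>"]
    by (simp add: f_def comp_def abs_mult flip: right_diff_distrib)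
  note g = lipschitz_L1_compose[OF f \<Phi> assms(6)]
  have "frac_nabla \<alpha> f y = c *\<^sub>R frac_nabla \<alpha> b y" for y
  proof -
    have "(\<lambda>z. (f (y + z) - f y) *\<^sub>R riesz_kernel \<alpha> z) = (\<lambda>z. c *\<^sub>R ((b (y + z) - b y) *\<^sub>R riesz_kernel \<alpha> z))"
      by (simp add: f_def algebra_simps)
    thus ?thesis unfolding frac_nabla_def by (simp only: integral_scaleR_right)
  qed
  hence "frac_nabla \<alpha> f y = 0" if "y \<notin> cball 0 1" for y
    using frac_nabla_frac_bump_eq_0[OF assms(1,2), of y] that by (simp add: b_def)
  hence "measure_supp (total_variation (frac_grad \<alpha> f)) \<subseteq> cball 0 1"
    unfolding frac_grad_eq_density[OF f assms(1,2)]
    by (intro measure_supp_density_vm_subset) auto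
  moreover have "f \<in> BV_frac \<alpha> p" by (rule lipschitz_L1_in_BV_frac[OF f assms(1-3)])
  ultimately have supp: "measure_supp (total_variation (frac_grad \<alpha> (\<Phi> \<circ> f))) \<subseteq> cball 0 1"
    using assms(8) by blast
  \<comment> \<open>Continuity of the density gives vanishing at every point outside the ball.
    Vanishing almost everywhere would not suffice, since the potential is followed along a single
    half-line.\<close>
  have "frac_nabla \<alpha> (\<Phi> \<circ> f) y = 0" if "norm y > 1" for y
  proof -
    have "?k *\<^sub>R frac_nabla \<alpha> (\<Phi> \<circ> f) y = 0"
    proof (rule density_eq_0_outside_supp[where F="\<lambda>x. ?k *\<^sub>R frac_nabla \<alpha> (\<Phi> \<circ> f) x"])
      show "integrable lborel (\<lambda>x. ?k *\<^sub>R frac_nabla \<alpha> (\<Phi> \<circ> f) x)"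
        by (intro integrable_scaleR_right integrable_frac_nabla[OF g assms(1,2)])
      show "continuous_on UNIV (\<lambda>x. ?k *\<^sub>R frac_nabla \<alpha> (\<Phi> \<circ> f) x)"
        by (intro continuous_intros continuous_on_frac_nabla[OF g assms(1,2)])
      show "y \<notin> measure_supp (total_variation (density_vm (\<lambda>x. ?k *\<^sub>R frac_nabla \<alpha> (\<Phi> \<circ> f) x)))"
        using supp that unfolding frac_grad_eq_density[OF g assms(1,2)] by auto
    qed
    thus ?thesis using k by simp
  qed
  hence "(\<Phi> \<circ> f) x = 0"
    using assms(7) by (intro nonneg_eq_0_if_frac_nabla_eq_0_outside_ball[OF g assms(1,2)]) auto
  thus False using t bx by (simp add: f_def c_def)
qed

end
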